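(* Let $q=2^r$. Whenever $\pm$ appears, either $+$ is chosen everywhere (with $n\ge2$ even) or $-$ is chosen everywhere (with $n\ge1$ odd for $i=1$, and $n\ge3$ odd for $i=2$). Let $\{C_{i,j}^\pm(n,q)\}_{j=0}^{N_i^\pm(n,q)}$ be the weight distribution of $C(DC_i^\pm(n,q))$ for $i=1,2$, and assume $q\ge4$ in the case $i=2$. (a) For $j=0,\dots,N_1^\pm(n,q)$, $$C_{1,j}^\pm(n,q)=\sum\binom{q^{-1}A_1^\pm(n,q)(B_1^\pm(n,q)+1)}{\nu_0}\prod_{tr(\beta^{-1})=0}\binom{q^{-1}A_1^\pm(n,q)(B_1^\pm(n,q)+q+1)}{\nu_\beta}\prod_{tr(\beta^{-1})=1}\binom{q^{-1}A_1^\pm(n,q)(B_1^\pm(n,q)-q+1)}{\nu_\beta}.$$ The products are over $\beta\in\mathbb{F}_q^*$, and the sum is over all families of nonnegative integers $\{\nu_\beta\}_{\beta\in\mathbb{F}_q}$ with $\sum_\beta\nu_\beta=j$ and $\sum_\beta\nu_\beta\beta=0$. (b) For $j=0,\dots,N_2^\pm(n,q)$, $$C_{2,j}^\pm(n,q)=\sum\binom{q^{-1}A_2^\pm(n,q)(B_2^\pm(n,q)+q^3-q^2-1)}{\nu_0}\prod_{\substack{\tau\in\mathbb{Z},\ |\tau|<2\sqrt q\\ \tau\equiv-1\ (\mathrm{mod}\ 4)}}\ \prod_{\beta\in\mathbb{F}_q^*:\,K(\lambda;\beta^{-1})=\tau}\binom{q^{-1}A_2^\pm(n,q)(B_2^\pm(n,q)+q\tau-q^2-1)}{\nu_\beta}.$$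 The sum is over all families of nonnegative integers $\{\nu_\beta\}_{\beta\in\mathbb{F}_q}$ with $\sum_\beta\nu_\beta=j$ and $\sum_\beta\nu_\beta\beta=0$.
   Context: Let $q=2^r$ and let $\mathbb{F}_q$ be the field with $q$ elements. Let $tr(x)=x+x^2+\cdots+x^{2^{r-1}}$, $\lambda(x)=(-1)^{tr(x)}$, and $K(\lambda;a)=\sum_{\alpha\in\mathbb{F}_q^*}\lambda(\alpha+a\alpha^{-1})$. Binomial coefficients satisfy $\binom ba=0$ if $a>b$ or $a<0$. $Tr$ is the matrix trace. $O^+(2n,q)$ is the group of $g\in GL(2n,q)$ preserving $\theta^+(x)=\sum_{i=1}^nx_ix_{n+i}$. $P^+=P^+(2n,q)$ is the subgroup of all products $\begin{bmatrix}A&0\\0&{}^tA^{-1}\end{bmatrix}\begin{bmatrix}1_n&B\\0&1_n\end{bmatrix}$ with $A\in GL(n,q)$ and $B$ an $n\times n$ symmetric matrix with zero diagonal. For $0\le s\le n$, $\sigma_s^+$ is the $2n\times2n$ matrix which, in block form for $2n=s+(n-s)+s+(n-s)$, is $\begin{bmatrix}0&0&1_s&0\\0&1_{n-s}&0&0\\1_s&0&0&0\\0&0&0&1_{n-s}\end{bmatrix}$. The double cosets are: - $DC_1^+(n,q)=P^+\sigma_{n-1}^+P^+$ and $DC_2^+(n,q)=P^+\sigma_{n-2}^+P^+$ for even $n\ge2$; - $DC_1^-(n,q)=P^+\sigma_{n-1}^+P^+$ for odd $n\ge1$; - $DC_2^-(n,q)=P^+\sigma_{n-2}^+P^+$ for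 odd $n\ge3$. With $\left[\begin{smallmatrix}n\\k\end{smallmatrix}\right]_q=\prod_{j=0}^{k-1}\frac{q^{n-j}-1}{q^{k-j}-1}$ and empty products equal to $1$, define: - $A_1^+(n,q)=q^{(5n^2-6n)/4}\left[\begin{smallmatrix}n\\1\end{smallmatrix}\right]_q\prod_{j=1}^{n/2}(q^{2j-1}-1)$; - $B_1^+(n,q)=q^{(n-2)^2/4}\prod_{j=1}^{n/2}(q^{2j}-1)$; - $A_2^+(n,q)=q^{(5n^2-6n)/4}\left[\begin{smallmatrix}n\\2\end{smallmatrix}\right]_q\prod_{j=1}^{(n-2)/2}(q^{2j-1}-1)$; - $B_2^+(n,q)=q^{(n^2-8n+12)/4}(q^{n-1}-1)(q^n-1)\prod_{j=1}^{(n-2)/2}(q^{2j}-1)$; - $A_1^-(n,q)=q^{(5n^2-4n-1)/4}\left[\begin{smallmatrix}n\\1\end{smallmatrix}\right]_q\prod_{j=1}^{(n-1)/2}(q^{2j-1}-1)$; - $B_1^-(n,q)=q^{(n^2-6n+5)/4}(q^n-1)\prod_{j=1}^{(n-1)/2}(q^{2j}-1)$; - $A_2^-(n,q)=q^{(5n^2-8n+3)/4}\left[\begin{smallmatrix}n\\2\end{smallmatrix}\right]_q\prod_{j=1}^{(n-1)/2}(q^{2j-1}-1)$; - $B_2^-(n,q)=q^{(n-3)^2/4}(q^n-1)\prod_{j=1}^{(n-1)/2}(q^{2j}-1)$. $N_i^\pm(n,q)=A_i^\pm(n,q)B_i^\pm(n,q)=|DC_i^\pm(n,q)|$. For an ordering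 $g_1,\dots,g_N$ of $DC_i^\pm(n,q)$, the binary code is $C(DC_i^\pm(n,q))=\{u\in\mathbb{F}_2^N:\sum_ju_j\,Tr\,g_j=0\text{ in }\mathbb{F}_q\}$. Its weight distribution $C_{i,j}^\pm(n,q)$ is the number of codewords of Hamming weight $j$. *)

theory Defs
  imports
    Complex_Main
    "HOL-Library.Z2"
    "HOL-Number_Theory.Cong"
    "Jordan_Normal_Form.Matrix"
begin

text \<open>
  Throughout, \<^typ>\<open>'a\<close> is the field with \<open>q = 2 ^ r\<close> elements, and \<open>r\<close> is passed explicitly.
\<close>

definition field_tr :: "nat \<Rightarrow> 'a::field \<Rightarrow> 'a" where
  "field_tr r x = (\<Sum>i<r. x ^ (2 ^ i))"

text \<open>The trace lies in the prime field, so \<open>(-1) ^ tr x\<close> is 1 for trace 0 and -1 for trace 1.\<close>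

definition add_char :: "nat \<Rightarrow> 'a::field \<Rightarrow> int" where
  "add_char r x = (if field_tr r x = 0 then 1 else - 1)"

definition kloosterman :: "nat \<Rightarrow> 'a::{finite,field} \<Rightarrow> int" where
  "kloosterman r a = (\<Sum>\<alpha>\<in>UNIV - {0}. add_char r (\<alpha> + a * inverse \<alpha>))"

definition mat_trace :: "'a::comm_monoid_add mat \<Rightarrow> 'a" where
  "mat_trace A = (\<Sum>i<dim_row A. A $$ (i, i))"

definition alternating_mats :: "nat \<Rightarrow> 'a::zero mat set" where
  "alternating_mats n = {B \<in> carrier_mat n n. transpose_mat B = B \<and> (\<forall>i<n. B $$ (i, i) = 0)}"

definition P_plus :: "nat \<Rightarrow> 'a::field mat set" where
  "P_plus n =
    {four_block_mat A (0\<^sub>m n n) (0\<^sub>m n n) (transpose_mat A') *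
       four_block_mat (1\<^sub>m n) B (0\<^sub>m n n) (1\<^sub>m n) | A A' B.
       A \<in> carrier_mat n n \<and> A' \<in> carrier_mat n n \<and>
       inverts_mat A A' \<and> inverts_mat A' A \<and> B \<in> alternating_mats n}"

text \<open>
  The \<open>4 \<times> 4\<close> block matrix for \<open>2n = s + (n - s) + s + (n - s)\<close>, grouped into
  four \<open>n \<times> n\<close> quarters.
\<close>

definition sigma_plus :: "nat \<Rightarrow> nat \<Rightarrow> 'a::field mat" where
  "sigma_plus n s =
    (let D = four_block_mat (0\<^sub>m s s) (0\<^sub>m s (n - s)) (0\<^sub>m (n - s) s) (1\<^sub>m (n - s));
         E = four_block_mat (1\<^sub>m s) (0\<^sub>m s (n - s)) (0\<^sub>m (n - s) s) (0\<^sub>m (n - s) (n - s))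
     in four_block_mat D E E D)"

text \<open>
  The double coset \<open>P\<^sup>+ \<sigma>\<^sub>n\<^sub>-\<^sub>i P\<^sup>+\<close>; it is \<open>DC\<^sub>i\<^sup>+\<close> for even \<open>n\<close> and \<open>DC\<^sub>i\<^sup>-\<close> for odd \<open>n\<close>.
\<close>

definition DC :: "nat \<Rightarrow> nat \<Rightarrow> 'a::field mat set" where
  "DC i n = {p * sigma_plus n (n - i) * p' | p p'. p \<in> P_plus n \<and> p' \<in> P_plus n}"

definition ordering_of :: "'b set \<Rightarrow> 'b list \<Rightarrow> bool" where
  "ordering_of S gs \<longleftrightarrow> distinct gs \<and> set gs = S"

definition trace_code :: "'a::field mat list \<Rightarrow> bit vec set" where
  "trace_code gs =
    {u \<in> carrier_vec (length gs). (\<Sum>k<length gs. of_bit (u $ k) * mat_trace (gs ! k)) = 0}"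

definition hamming_weight :: "bit vec \<Rightarrow> nat" where
  "hamming_weight u = card {k. k < dim_vec u \<and> u $ k \<noteq> 0}"

definition weight_dist :: "bit vec set \<Rightarrow> nat \<Rightarrow> nat" where
  "weight_dist C j = card {u \<in> C. hamming_weight u = j}"

definition qbinom :: "real \<Rightarrow> nat \<Rightarrow> nat \<Rightarrow> real" where
  "qbinom q n k = (\<Prod>j<k. (q ^ (n - j) - 1) / (q ^ (k - j) - 1))"

datatype pm = Plus | Minus

text \<open>
  Some of the exponents are negative (in \<open>B2 Plus\<close> for \<open>n = 4\<close> and \<open>B1 Minus\<close> for \<open>n = 3\<close>), so the
  factors are real-valued.
\<close>

primrec A1 :: "pm \<Rightarrow> nat \<Rightarrow> real \<Rightarrow> real" where
  "A1 Plus n q = q powr ((5 * real n ^ 2 - 6 * real n) / 4) * qbinom q n 1 *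
     (\<Prod>j = 1..n div 2. (q ^ (2 * j - 1) - 1))"
| "A1 Minus n q = q powr ((5 * real n ^ 2 - 4 * real n - 1) / 4) * qbinom q n 1 *
     (\<Prod>j = 1..(n - 1) div 2. (q ^ (2 * j - 1) - 1))"

primrec B1 :: "pm \<Rightarrow> nat \<Rightarrow> real \<Rightarrow> real" where
  "B1 Plus n q = q powr ((real n - 2) ^ 2 / 4) * (\<Prod>j = 1..n div 2. (q ^ (2 * j) - 1))"
| "B1 Minus n q = q powr ((real n ^ 2 - 6 * real n + 5) / 4) * (q ^ n - 1) *
     (\<Prod>j = 1..(n - 1) div 2. (q ^ (2 * j) - 1))"

primrec A2 :: "pm \<Rightarrow> nat \<Rightarrow> real \<Rightarrow> real" where
  "A2 Plus n q = q powr ((5 * real n ^ 2 - 6 * real n) / 4) * qbinom q n 2 *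
     (\<Prod>j = 1..(n - 2) div 2. (q ^ (2 * j - 1) - 1))"
| "A2 Minus n q = q powr ((5 * real n ^ 2 - 8 * real n + 3) / 4) * qbinom q n 2 *
     (\<Prod>j = 1..(n - 1) div 2. (q ^ (2 * j - 1) - 1))"

primrec B2 :: "pm \<Rightarrow> nat \<Rightarrow> real \<Rightarrow> real" where
  "B2 Plus n q = q powr ((real n ^ 2 - 8 * real n + 12) / 4) * (q ^ (n - 1) - 1) * (q ^ n - 1) *
     (\<Prod>j = 1..(n - 2) div 2. (q ^ (2 * j) - 1))"
| "B2 Minus n q = q powr ((real n - 3) ^ 2 / 4) * (q ^ n - 1) *
     (\<Prod>j = 1..(n - 1) div 2. (q ^ (2 * j) - 1))"

definition N1 :: "pm \<Rightarrow> nat \<Rightarrow> real \<Rightarrow> real" where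
  "N1 \<epsilon> n q = A1 \<epsilon> n q * B1 \<epsilon> n q"

definition N2 :: "pm \<Rightarrow> nat \<Rightarrow> real \<Rightarrow> real" where
  "N2 \<epsilon> n q = A2 \<epsilon> n q * B2 \<epsilon> n q"

definition families :: "nat \<Rightarrow> ('a::{finite,field} \<Rightarrow> nat) set" where
  "families j = {\<nu>. (\<Sum>\<beta>\<in>UNIV. \<nu> \<beta>) = j \<and> (\<Sum>\<beta>\<in>UNIV. of_nat (\<nu> \<beta>) * \<beta>) = 0}"

text \<open>
  The upper arguments of the binomial coefficients in the weight formulas are real expressions whose
  values are nonnegative integers (the numbers of elements of the double coset with given trace).
  On such arguments \<open>gchoose\<close> is the ordinary binomial coefficient, which vanishes when the lower
  argument exceeds the upper one.
\<close>

end

theory Submission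
  imports Defs
    "HOL-Computational_Algebra.Polynomial"
    "Jordan_Normal_Form.Determinant"
begin

text \<open>
  A codeword is a set of positions, and grouping positions by the trace of the matrix standing there
  shows that the weight distribution depends only on the numbers of elements of the double coset with
  given trace.

  Put \<open>s = n - i\<close>. Counting the pairs \<open>(p, p')\<close> with \<open>p \<sigma> p'\<close> of trace \<open>\<beta>\<close> reduces these numbers to
  counting the \<open>p \<in> P\<close> with \<open>Tr (p \<sigma>) = \<beta>\<close>. If \<open>p\<close> is given by \<open>(A, B)\<close>, then \<open>Tr (p \<sigma>)\<close> is an affine
  function of the alternating matrix \<open>B\<close>, hence equidistributed unless its linear part vanishes; this
  happens iff \<open>A\<close> is block lower triangular with symmetric upper left \<open>s \<times> s\<close> block, and then the trace is
  \<open>Tr D + Tr D\<^sup>-\<^sup>1\<close> for the other diagonal block \<open>D\<close>, of size \<open>i \<le> 2\<close>.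
  For \<open>i = 2\<close> counting such \<open>D\<close> produces a Kloosterman sum.

  The bound \<open>\<bar>K\<bar> < 2 \<surd>q\<close> is Hasse's theorem for \<open>y\<^sup>2 + x y = x\<^sup>3 + b\<^sup>2\<close>. As in Manin's proof one
  considers the points \<open>Frob + n Q\<close> on a twist over the rational function field. Only their abscissae
  are needed: consecutive abscissae satisfy a symmetric biquadratic relation, so the sequence is
  obtained by Vieta jumping, and the heights form a quadratic polynomial in \<open>n\<close> with linear
  coefficient \<open>\<plusminus>K\<close> and constant term \<open>q\<close>, which is nonnegative at all integers.
\<close>

section \<open>Finite fields of characteristic 2\<close>

text \<open>The two signs come from the parity of \<open>n - i\<close>: the admissible upper left
  blocks of \<open>A\<close> are invertible symmetric matrices, whose number has different closed
  forms for even and odd size.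

  The Kloosterman sum \<open>K\<close> meets the heights through cancellation: in lowest terms the
  abscissa of \<open>Frob +- Q\<close> loses two degrees for every nonzero \<open>e\<close> with a
  prescribed value of \<open>tr (e + b / e)\<close>. The numbers of \<open>e\<close> with trace 0
  and 1 add up to \<open>q - 1\<close> and differ by \<open>K\<close>, so the heights at 0 and 1 are
  \<open>q\<close> and \<open>q + 1 -+ K\<close>. The second difference 2 is a parallelogram law,
  found by computing the height of one quadratic form in two ways; no addition law on a curve is set
  up.

  Nonnegativity at the integers bounds the discriminant by 1 rather than 0. The strict bound
  therefore also rests on \<open>K\<close> being odd, from the congruence modulo 4, and on
  \<open>K^2\<close> not being \<open>4 q + 1\<close>, because \<open>q\<close> is not a product of
  two consecutive integers. Both use \<open>q >= 4\<close>.\<close>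

locale binary_field =
  fixes r :: nat and type_token :: "'a::{finite,field} itself"
  assumes card_field: "card (UNIV :: 'a set) = 2 ^ r"
begin

abbreviation tr :: "'a \<Rightarrow> 'a" where "tr \<equiv> field_tr r"

lemma r_pos: "0 < r"
proof (rule ccontr)
  assume "\<not> 0 < r"
  then have "card (UNIV :: 'a set) = 1" using card_field by simp
  then obtain x where "(UNIV :: 'a set) = {x}" by (auto simp: card_1_singleton_iff)
  then have "(0::'a) = 1" by (metis UNIV_I singletonD)
  then show False by simp
qed

text \<open>Translation by 1 permutes the field, so comparing the sums over all elements gives
  \<open>2 ^ r = 0\<close> in the field.\<close>

lemma two_eq_0 [simp]: "(2::'a) = 0"
proof -
  have "(\<Sum>a\<in>(UNIV::'a set). a + 1) = (\<Sum>a\<in>(UNIV::'a set). a)"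
    by (rule sum.reindex_bij_witness[where j="\<lambda>a. a + 1" and i="\<lambda>a. a - 1"]) auto
  then have "(of_nat (card (UNIV :: 'a set)) :: 'a) = 0"
    by (simp add: sum.distrib)
  then have "(2::'a) ^ r = 0" by (simp add: card_field)
  then show ?thesis by simp
qed

lemma add_self [simp]: "x + x = (0::'a)"
  using two_eq_0 by (metis mult_2 mult_zero_left)

lemma minus_eq [simp]: "- x = (x::'a)"
  by (simp add: minus_unique)

lemma diff_eq [simp]: "x - y = x + (y::'a)"
  by (metis diff_conv_add_uminus minus_eq)

lemma add_self2 [simp]: "x + (x + y) = (y::'a)"
  by (simp flip: add.assoc)

lemma add_eq_0: "x + y = 0 \<longleftrightarrow> x = (y::'a)"
  by (metis add_self add_self2 add_0_right)

lemma square_add: "(x + y)\<^sup>2 = x\<^sup>2 + (y::'a)\<^sup>2"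
  by (simp add: power2_sum two_eq_0)

text \<open>Fermat's argument: multiplication by a nonzero \<open>x\<close> permutes the nonzero
  elements, so their product absorbs the factor \<open>x ^ (2 ^ r - 1)\<close>.\<close>

lemma power_q [simp]: "x ^ (2 ^ r) = (x::'a)"
proof (cases "x = 0")
  case True
  then show ?thesis using r_pos by simp
next
  case False
  let ?U = "UNIV - {0::'a}"
  have "(\<Prod>a\<in>?U. x * a) = (\<Prod>a\<in>?U. a)"
    using False by (intro prod.reindex_bij_witness[where j="\<lambda>a. x * a" and i="\<lambda>a. a / x"]) auto
  then have "x ^ card ?U * (\<Prod>a\<in>?U. a) = (\<Prod>a\<in>?U. a)"
    by (simp add: prod.distrib)
  moreover have "(\<Prod>a\<in>?U. a) \<noteq> 0" by simp
  ultimately have "x ^ card ?U = 1" by simp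
  moreover have "card ?U = 2 ^ r - 1" by (simp add: card_field card_Diff_singleton)
  ultimately have "x ^ (2 ^ r - 1) = 1" by simp
  then have "x ^ Suc (2 ^ r - 1) = x" by (simp only: power_Suc mult_1_right)
  moreover have "Suc (2 ^ r - 1) = 2 ^ r" by simp
  ultimately show ?thesis by metis
qed

lemma frob_add: "(x + y) ^ (2 ^ i) = x ^ (2 ^ i) + (y::'a) ^ (2 ^ i)"
proof (induction i)
  case (Suc i)
  have "(x + y) ^ (2 ^ Suc i) = ((x + y) ^ (2 ^ i))\<^sup>2" by (simp add: power_mult[symmetric] mult.commute)
  also have "\<dots> = (x ^ (2 ^ i))\<^sup>2 + (y ^ (2 ^ i))\<^sup>2" by (simp only: Suc square_add)
  also have "\<dots> = x ^ (2 ^ Suc i) + y ^ (2 ^ Suc i)" by (simp add: power_mult[symmetric] mult.commute)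
  finally show ?case .
qed simp

lemma tr_add: "tr (x + y) = tr x + tr y"
  by (simp add: field_tr_def frob_add sum.distrib)

lemma tr_0 [simp]: "tr 0 = 0" by (simp add: field_tr_def power_0_left)

text \<open>Squaring shifts the conjugates of \<open>x\<close> cyclically, since
  \<open>x ^ (2 ^ r)\<close> is \<open>x\<close> again.\<close>

lemma tr_square: "tr (x\<^sup>2) = tr x"
proof -
  have "tr (x\<^sup>2) = (\<Sum>i<r. x ^ (2 ^ Suc i))"
    by (simp add: field_tr_def power_mult[symmetric] mult.commute)
  also have "\<dots> + x = (\<Sum>i<Suc r. x ^ (2 ^ i))"
    by (subst sum.lessThan_Suc_shift) (simp add: add.commute)
  also have "\<dots> = tr x + x" by (simp add: field_tr_def)
  finally show ?thesis by simp
qed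

lemma sum_square: "(\<Sum>i\<in>A. f i :: 'a)\<^sup>2 = (\<Sum>i\<in>A. (f i)\<^sup>2)"
  by (induction A rule: infinite_finite_induct) (auto simp: square_add)

lemma tr_cases: "tr x = 0 \<or> tr x = 1"
proof -
  have "(tr x)\<^sup>2 = tr (x\<^sup>2)"
    by (simp add: field_tr_def sum_square power_mult[symmetric] mult.commute)
  then have "tr x * tr x = tr x" by (simp only: tr_square power2_eq_square[of "tr x"])
  then show ?thesis by simp
qed

section \<open>The additive character and Artin-Schreier equations\<close>

lemma add_char_0 [simp]: "add_char r (0::'a) = 1"
  by (simp add: add_char_def)

lemma add_char_square: "add_char r (x\<^sup>2) = add_char r (x::'a)"
  by (simp add: add_char_def tr_square)

lemma square_inj: "inj (\<lambda>x::'a. x\<^sup>2)"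
proof (rule injI)
  fix x y :: 'a assume "x\<^sup>2 = y\<^sup>2"
  then have "(x + y)\<^sup>2 = 0" by (simp add: square_add)
  then show "x = y" by (simp add: add_eq_0)
qed

lemma square_bij: "bij (\<lambda>x::'a. x\<^sup>2)"
  using square_inj finite_UNIV_inj_surj by (metis bijI finite)

text \<open>The trace is a polynomial function of degree \<open>2 ^ (r - 1)\<close>, so this is the
  bound on the number of roots; \<open>card_tr_0\<close> shows that it is attained.\<close>

lemma card_tr_0_le: "card {x. tr x = 0} \<le> 2 ^ (r - 1)"
proof -
  define p :: "'a poly" where "p = (\<Sum>i<r. monom 1 (2 ^ i))"
  have poly: "poly p x = tr x" for x
    by (simp add: p_def poly_sum poly_monom field_tr_def)
  have "coeff p (2 ^ (r - 1)) = (\<Sum>i<r. if i = r - 1 then 1 else 0)"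
    by (simp add: p_def coeff_sum)
  also have "\<dots> = 1" using r_pos by simp
  finally have nz: "p \<noteq> 0" by auto
  have "degree p \<le> 2 ^ (r - 1)" unfolding p_def
    by (intro degree_sum_le) (auto intro: order.trans[OF degree_monom_le])
  moreover have "card {x. poly p x = 0} \<le> degree p" using nz by (rule card_poly_roots_bound)
  ultimately show ?thesis by (simp add: poly)
qed

lemma card_artin_schreier_fibre: "card {z::'a. z\<^sup>2 + z = w\<^sup>2 + w} = 2"
proof -
  have "{z::'a. z\<^sup>2 + z = w\<^sup>2 + w} = {w, w + 1}"
  proof -
    have "z\<^sup>2 + z = w\<^sup>2 + w \<longleftrightarrow> (z + w) * (z + w + 1) = 0" for z
    proof -
      have "(z + w) * (z + w + 1) = (z + w)\<^sup>2 + (z + w)" by (simp add: power2_eq_square algebra_simps)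
      also have "\<dots> = (z\<^sup>2 + z) + (w\<^sup>2 + w)" by (simp add: square_add algebra_simps)
      finally show ?thesis by (simp only: add_eq_0)
    qed
    moreover have "z + w + 1 = 0 \<longleftrightarrow> z = w + 1" for z
      by (metis add_eq_0 add.assoc)
    ultimately show ?thesis by (auto simp: add_eq_0)
  qed
  then show ?thesis by simp
qed

text \<open>The image lies in the kernel of the trace by \<open>tr_square\<close>. The map is
  two-to-one, so the image already has the \<open>2 ^ (r - 1)\<close> elements that
  \<open>card_tr_0_le\<close> allows for the kernel.\<close>

lemma artin_schreier_image: "range (\<lambda>z::'a. z\<^sup>2 + z) = {x. tr x = 0}"
  and card_tr_0: "card {x. tr x = 0} = 2 ^ (r - 1)"
proof -
  let ?f = "\<lambda>z::'a. z\<^sup>2 + z"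
  have sub: "range ?f \<subseteq> {x. tr x = 0}"
    by (auto simp: tr_add tr_square)
  have "card (UNIV :: 'a set) = (\<Sum>y\<in>range ?f. card {z. ?f z = y})"
    by (subst card_eq_sum, subst sum.image_gen[where g="?f"]) auto
  also have "\<dots> = (\<Sum>y\<in>range ?f. 2)"
    by (intro sum.cong) (auto simp: card_artin_schreier_fibre)
  finally have "2 * card (range ?f) = 2 ^ r" by (simp add: card_field)
  then have *: "card (range ?f) = 2 ^ (r - 1)"
    using r_pos by (cases r) auto
  show "range ?f = {x. tr x = 0}"
    using sub card_tr_0_le * card_mono[OF _ sub] by (intro card_subset_eq) auto
  then show "card {x. tr x = 0} = 2 ^ (r - 1)" using * by simp
qed

text \<open>Here root counts turn into character values; the characters in the matrix counts below
  all enter through this equation.\<close>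

lemma card_artin_schreier: "int (card {z::'a. z\<^sup>2 + z = c}) = 1 + add_char r c"
proof (cases "tr c = 0")
  case True
  then obtain w where "c = w\<^sup>2 + w" using artin_schreier_image by blast
  then show ?thesis using True card_artin_schreier_fibre by (simp add: add_char_def)
next
  case False
  then have "{z::'a. z\<^sup>2 + z = c} = {}" using artin_schreier_image by blast
  then show ?thesis using False by (simp add: add_char_def)
qed

lemma sum_add_char: "(\<Sum>x\<in>UNIV. add_char r (x::'a)) = 0"
proof -
  have "(\<Sum>x\<in>UNIV. add_char r (x::'a)) =
      (\<Sum>x\<in>{x. tr x = 0}. add_char r x) + (\<Sum>x\<in>- {x. tr x = 0}. add_char r x)"
    by (subst sum.union_disjoint[symmetric]) (auto intro: sum.cong)
  also have "\<dots> = int (card {x. tr x = 0}) - int (card (- {x. tr x = 0}))"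
    by (simp add: add_char_def)
  also have "card (- {x. tr x = 0}) = 2 ^ r - 2 ^ (r - 1)"
    by (simp add: Compl_eq_Diff_UNIV card_Diff_subset card_field card_tr_0)
  also have "2 ^ r - 2 ^ (r - 1) = (2 ^ (r - 1) :: nat)"
    using r_pos by (cases r) auto
  finally show ?thesis by (simp add: card_tr_0)
qed

lemma sum_add_char_nonzero: "(\<Sum>x\<in>UNIV - {0}. add_char r (x::'a)) = - 1"
  using sum_add_char by (simp add: sum_diff1)

lemma add_inverse_eq_0: "{x. x \<noteq> 0 \<and> x + inverse x = (0::'a)} = {1}"
proof -
  have "x = inverse x \<Longrightarrow> x = 1" if "x \<noteq> 0" for x :: 'a
  proof -
    assume "x = inverse x"
    then have "x\<^sup>2 = 1\<^sup>2" using that by (metis power2_eq_square right_inverse one_power2)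
    then show "x = 1" using square_inj by (metis injD)
  qed
  then show ?thesis by (auto simp: add_eq_0)
qed

text \<open>Clearing the denominator gives \<open>x^2 + 1 = t x\<close>; the substitution
  \<open>x = t z\<close> makes it an Artin-Schreier equation with right-hand side
  \<open>1 / t^2\<close>.\<close>

lemma artin_schreier_add_inverse:
  fixes t :: 'a
  assumes "t \<noteq> 0"
  shows "{z. z\<^sup>2 + z = inverse (t\<^sup>2)} = (\<lambda>x. x * inverse t) ` {x. x \<noteq> 0 \<and> x + inverse x = t}"
proof -
  have 1: "(x * inverse t)\<^sup>2 + x * inverse t = inverse (t\<^sup>2) \<longleftrightarrow> x \<noteq> 0 \<and> x + inverse x = t" for x
  proof -
    have "(x * inverse t)\<^sup>2 + x * inverse t = inverse (t\<^sup>2) \<longleftrightarrow> x\<^sup>2 + x * t = 1"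
      using assms by (simp add: field_simps power2_eq_square)
    also have "\<dots> \<longleftrightarrow> x\<^sup>2 + 1 = x * t"
      using add_self2[of "x\<^sup>2"] by metis
    also have "\<dots> \<longleftrightarrow> x \<noteq> 0 \<and> x + inverse x = t"
    proof -
      have "x\<^sup>2 + 1 = x * t \<longleftrightarrow> x + inverse x = t" if "x \<noteq> 0"
      proof -
        have "x * (x + inverse x) = x\<^sup>2 + 1" using that by (simp add: distrib_left power2_eq_square)
        then show ?thesis using that by (metis mult_left_cancel)
      qed
      then show ?thesis by (cases "x = 0") auto
    qed
    finally show ?thesis .
  qed
  show ?thesis
  proof (rule equalityI; rule subsetI)
    fix z assume "z \<in> {z. z\<^sup>2 + z = inverse (t\<^sup>2)}"
    moreover have z: "z * t * inverse t = z" using assms by simp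
    ultimately have "(z * t * inverse t)\<^sup>2 + z * t * inverse t = inverse (t\<^sup>2)"
      by (simp only: mem_Collect_eq)
    then have "z * t \<in> {x. x \<noteq> 0 \<and> x + inverse x = t}" using 1[of "z * t"] by blast
    moreover have "z = z * t * inverse t" using assms by simp
    ultimately show "z \<in> (\<lambda>x. x * inverse t) ` {x. x \<noteq> 0 \<and> x + inverse x = t}" by blast
  qed (use 1 in auto)
qed

lemma card_add_inverse:
  fixes t :: 'a
  assumes "t \<noteq> 0"
  shows "int (card {x. x \<noteq> 0 \<and> x + inverse x = t}) = 1 + add_char r (inverse t)"
proof -
  have "inj (\<lambda>x. x * inverse t)" using assms by (auto intro: injI)
  then have "card {x. x \<noteq> 0 \<and> x + inverse x = t} = card {z. z\<^sup>2 + z = inverse (t\<^sup>2)}"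
    unfolding artin_schreier_add_inverse[OF assms] by (intro card_image[symmetric]) (auto intro: inj_on_subset)
  also have "inverse (t\<^sup>2) = (inverse t)\<^sup>2" by (simp add: power_inverse)
  finally show ?thesis by (simp only: card_artin_schreier add_char_square)
qed

end

section \<open>Weights of a trace code\<close>

text \<open>A subset with given profile amounts to an independent choice of a
  \<open>\<nu> \<beta>\<close>-element subset in each fibre of \<open>f\<close>.\<close>

lemma card_subsets_profile:
  fixes f :: "'k \<Rightarrow> 'b::finite"
  assumes I: "finite I"
  shows "card {S. S \<subseteq> I \<and> (\<forall>\<beta>. card {k \<in> S. f k = \<beta>} = \<nu> \<beta>)} =
    (\<Prod>\<beta>\<in>UNIV. card {k \<in> I. f k = \<beta>} choose \<nu> \<beta>)"
proof -
  let ?T = "\<lambda>\<beta>. {T. T \<subseteq> {k \<in> I. f k = \<beta>} \<and> card T = \<nu> \<beta>}"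
  have "card {S. S \<subseteq> I \<and> (\<forall>\<beta>. card {k \<in> S. f k = \<beta>} = \<nu> \<beta>)} = card (PiE UNIV ?T)"
  proof (rule bij_betw_same_card)
    show "bij_betw (\<lambda>S \<beta>. {k \<in> S. f k = \<beta>}) {S. S \<subseteq> I \<and> (\<forall>\<beta>. card {k \<in> S. f k = \<beta>} = \<nu> \<beta>)} (PiE UNIV ?T)"
    proof (rule bij_betwI[where g="\<lambda>F. \<Union>\<beta>. F \<beta>"])
      have eq: "{k \<in> \<Union> (range F). f k = \<beta>} = F \<beta>" if "F \<in> PiE UNIV ?T" for F \<beta>
        using that by fastforce
      then show "(\<lambda>\<beta>. {k \<in> \<Union> (range F). f k = \<beta>}) = F" if "F \<in> PiE UNIV ?T" for F
        using that by auto
      show "(\<lambda>F. \<Union> (range F)) \<in> PiE UNIV ?T \<rightarrow> {S. S \<subseteq> I \<and> (\<forall>\<beta>. card {k \<in> S. f k = \<beta>} = \<nu> \<beta>)}"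
      proof
        fix F assume F: "F \<in> PiE UNIV ?T"
        then show "\<Union> (range F) \<in> {S. S \<subseteq> I \<and> (\<forall>\<beta>. card {k \<in> S. f k = \<beta>} = \<nu> \<beta>)}"
          unfolding mem_Collect_eq eq[OF F] by fastforce
      qed
    qed auto
  qed
  also have "\<dots> = (\<Prod>\<beta>\<in>UNIV. card {k \<in> I. f k = \<beta>} choose \<nu> \<beta>)"
    using I by (subst card_PiE) (auto simp: n_subsets)
  finally show ?thesis .
qed

lemma finite_families: "finite (families j :: ('a::{finite,field} \<Rightarrow> nat) set)"
proof (rule finite_subset)
  show "families j \<subseteq> PiE (UNIV::'a set) (\<lambda>_. {..j})"
    unfolding families_def by (auto intro!: member_le_sum)
qed (auto intro: finite_PiE)

text \<open>Both the size and the sum of a subset depend only on how many of its elements lie in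
  each fibre of \<open>f\<close>. Sorting the subsets by this profile, the profiles meeting both
  conditions are those in \<open>families j\<close>.\<close>

lemma card_subsets_weighted_sum:
  fixes f :: "'k \<Rightarrow> 'b::{finite,field}"
  assumes I: "finite I"
  shows "card {S. S \<subseteq> I \<and> card S = j \<and> (\<Sum>k\<in>S. f k) = 0} =
    (\<Sum>\<nu>\<in>families j. \<Prod>\<beta>\<in>UNIV. card {k \<in> I. f k = \<beta>} choose \<nu> \<beta>)"
proof -
  let ?A = "{S. S \<subseteq> I \<and> card S = j \<and> (\<Sum>k\<in>S. f k) = 0}"
  let ?prof = "\<lambda>S \<beta>. card {k \<in> S. f k = \<beta>}"
  have fin: "finite S" if "S \<subseteq> I" for S using I that finite_subset by blast
  have c: "(\<Sum>\<beta>\<in>UNIV. ?prof S \<beta>) = card S" if "S \<subseteq> I" for S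
    using sum.group[OF fin[OF that], of UNIV f "\<lambda>_. 1::nat"] by simp
  have s: "(\<Sum>\<beta>\<in>UNIV. of_nat (?prof S \<beta>) * \<beta>) = (\<Sum>k\<in>S. f k)" if "S \<subseteq> I" for S
  proof -
    have "(\<Sum>\<beta>\<in>UNIV. of_nat (?prof S \<beta>) * \<beta>) = (\<Sum>\<beta>\<in>UNIV. \<Sum>k\<in>{k \<in> S. f k = \<beta>}. f k)"
      by (intro sum.cong) auto
    then show ?thesis using sum.group[OF fin[OF that], of UNIV f f] by simp
  qed
  have "card ?A = (\<Sum>S\<in>?A. 1)" by simp
  also have "\<dots> = (\<Sum>\<nu>\<in>families j. \<Sum>S\<in>{S\<in>?A. ?prof S = \<nu>}. 1)"
  proof (rule sum.group[symmetric])
    show "finite ?A" using I by (auto intro: finite_subset[of _ "Pow I"])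
    show "?prof ` ?A \<subseteq> families j" unfolding families_def using c s by auto
  qed (rule finite_families)
  also have "\<dots> = (\<Sum>\<nu>\<in>families j. card {S. S \<subseteq> I \<and> (\<forall>\<beta>. ?prof S \<beta> = \<nu> \<beta>)})"
  proof (intro sum.cong refl)
    fix \<nu> :: "'b \<Rightarrow> nat" assume \<nu>: "\<nu> \<in> families j"
    have "card S = j \<and> (\<Sum>k\<in>S. f k) = 0" if "S \<subseteq> I" "\<forall>\<beta>. ?prof S \<beta> = \<nu> \<beta>" for S
      using c[OF that(1)] s[OF that(1)] that(2) \<nu> by (simp add: families_def)
    then have "{S\<in>?A. ?prof S = \<nu>} = {S. S \<subseteq> I \<and> (\<forall>\<beta>. ?prof S \<beta> = \<nu> \<beta>)}"
      by (auto simp: fun_eq_iff)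
    then show "(\<Sum>S\<in>{S\<in>?A. ?prof S = \<nu>}. 1) = card {S. S \<subseteq> I \<and> (\<forall>\<beta>. ?prof S \<beta> = \<nu> \<beta>)}"
      by simp
  qed
  finally show ?thesis by (simp add: card_subsets_profile[OF I])
qed

text \<open>Codewords correspond to their supports, that is, to sets of positions with vanishing
  trace sum. As \<open>gs\<close> lists \<open>D\<close> without repetition, positions with trace
  \<open>\<beta>\<close> are as many as elements of \<open>D\<close> with trace
  \<open>\<beta>\<close>.\<close>

lemma weight_dist_trace_code:
  fixes gs :: "'a::{finite,field} mat list"
  assumes "ordering_of D gs"
  shows "weight_dist (trace_code gs) j =
    (\<Sum>\<nu>\<in>families j. \<Prod>\<beta>\<in>UNIV. card {w \<in> D. mat_trace w = \<beta>} choose \<nu> \<beta>)"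
proof -
  let ?I = "{..<length gs}"
  let ?f = "\<lambda>k. mat_trace (gs ! k)"
  let ?supp = "\<lambda>u :: bit vec. {k. k < dim_vec u \<and> u $ k \<noteq> 0}"
  have sum: "(\<Sum>k<length gs. of_bit (u $ k) * mat_trace (gs ! k)) = (\<Sum>k\<in>?supp u. ?f k)"
    if "u \<in> carrier_vec (length gs)" for u
    using that by (intro sum.mono_neutral_cong_right) (auto simp: not_less intro: bit.exhaust)
  have "weight_dist (trace_code gs) j = card {S. S \<subseteq> ?I \<and> card S = j \<and> (\<Sum>k\<in>S. ?f k) = 0}"
    unfolding weight_dist_def
  proof (rule bij_betw_same_card)
    show "bij_betw ?supp {u \<in> trace_code gs. hamming_weight u = j}
        {S. S \<subseteq> ?I \<and> card S = j \<and> (\<Sum>k\<in>S. ?f k) = 0}"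
    proof (rule bij_betwI[where g="\<lambda>S. vec (length gs) (\<lambda>k. of_bool (k \<in> S))"])
      show "?supp \<in> {u \<in> trace_code gs. hamming_weight u = j} \<rightarrow> {S. S \<subseteq> ?I \<and> card S = j \<and> (\<Sum>k\<in>S. ?f k) = 0}"
        using sum by (auto simp: trace_code_def hamming_weight_def)
      show supp: "?supp (vec (length gs) (\<lambda>k. of_bool (k \<in> S))) = S"
        if "S \<in> {S. S \<subseteq> ?I \<and> card S = j \<and> (\<Sum>k\<in>S. ?f k) = 0}" for S
        using that by auto
      show "(\<lambda>S. vec (length gs) (\<lambda>k. of_bool (k \<in> S))) \<in>
          {S. S \<subseteq> ?I \<and> card S = j \<and> (\<Sum>k\<in>S. ?f k) = 0} \<rightarrow> {u \<in> trace_code gs. hamming_weight u = j}"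
        using sum supp by (auto simp: trace_code_def hamming_weight_def simp del: index_vec dim_vec)
      show "vec (length gs) (\<lambda>k. of_bool (k \<in> ?supp u)) = u"
        if "u \<in> {u \<in> trace_code gs. hamming_weight u = j}" for u
        using that by (intro eq_vecI) (auto simp: trace_code_def)
    qed
  qed
  also have "\<dots> = (\<Sum>\<nu>\<in>families j. \<Prod>\<beta>\<in>UNIV. card {k \<in> ?I. ?f k = \<beta>} choose \<nu> \<beta>)"
    by (rule card_subsets_weighted_sum) simp
  moreover have "card {k \<in> ?I. ?f k = \<beta>} = card {w \<in> D. mat_trace w = \<beta>}" for \<beta>
  proof (rule bij_betw_same_card)
    have "bij_betw (\<lambda>k. gs ! k) ?I D"
      using assms bij_betw_nth[of gs ?I D] by (auto simp: ordering_of_def)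
    then show "bij_betw (\<lambda>k. gs ! k) {k \<in> ?I. ?f k = \<beta>} {w \<in> D. mat_trace w = \<beta>}"
      unfolding bij_betw_def inj_on_def by blast
  qed
  ultimately show ?thesis by simp
qed

section \<open>Counting matrices over a finite field\<close>

lemma finite_carrier_mat [simp]: "finite (carrier_mat m n :: 'b::finite mat set)"
  and card_carrier_mat: "card (carrier_mat m n :: 'b::finite mat set) = card (UNIV :: 'b set) ^ (m * n)"
proof -
  let ?I = "{..<m} \<times> {..<n}"
  have b: "bij_betw (\<lambda>f. mat m n f) (?I \<rightarrow>\<^sub>E (UNIV :: 'b set)) (carrier_mat m n)"
  proof (rule bij_betwI[where g="\<lambda>A. restrict (\<lambda>ij. A $$ ij) ?I"])
    fix f :: "nat \<times> nat \<Rightarrow> 'b" assume "f \<in> ?I \<rightarrow>\<^sub>E UNIV"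
    then show "restrict (\<lambda>ij. mat m n f $$ ij) ?I = f"
      by (auto simp: fun_eq_iff restrict_def PiE_def extensional_def)
  qed (auto intro!: eq_matI)
  then show "finite (carrier_mat m n :: 'b mat set)"
    using bij_betw_finite by (metis finite finite_PiE finite_SigmaI finite_lessThan)
  show "card (carrier_mat m n :: 'b mat set) = card (UNIV :: 'b set) ^ (m * n)"
    using bij_betw_same_card[OF b] by (simp add: card_PiE)
qed

lemma four_block_inj:
  assumes "four_block_mat A B C D = four_block_mat A' B' C' D'"
    "A \<in> carrier_mat m k" "B \<in> carrier_mat m l" "C \<in> carrier_mat n k" "D \<in> carrier_mat n l"
    "A' \<in> carrier_mat m k" "B' \<in> carrier_mat m l" "C' \<in> carrier_mat n k" "D' \<in> carrier_mat n l"
  shows "A = A'" "B = B'" "C = C'" "D = D'"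
proof -
  let ?M = "four_block_mat A B C D" and ?M' = "four_block_mat A' B' C' D'"
  have e: "?M $$ (i, j) = ?M' $$ (i, j)" for i j using assms(1) by simp
  show "A = A'"
  proof (rule eq_matI)
    fix i j assume "i < dim_row A'" "j < dim_col A'"
    then show "A $$ (i, j) = A' $$ (i, j)" using e[of i j] assms(2-) by auto
  qed (use assms in auto)
  show "B = B'"
  proof (rule eq_matI)
    fix i j assume "i < dim_row B'" "j < dim_col B'"
    then show "B $$ (i, j) = B' $$ (i, j)" using e[of i "j + k"] assms(2-) by auto
  qed (use assms in auto)
  show "C = C'"
  proof (rule eq_matI)
    fix i j assume "i < dim_row C'" "j < dim_col C'"
    then show "C $$ (i, j) = C' $$ (i, j)" using e[of "i + m" j] assms(2-) by auto
  qed (use assms in auto)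
  show "D = D'"
  proof (rule eq_matI)
    fix i j assume "i < dim_row D'" "j < dim_col D'"
    then show "D $$ (i, j) = D' $$ (i, j)" using e[of "i + m" "j + k"] assms(2-) by auto
  qed (use assms in auto)
qed

lemma four_block_cases:
  assumes "M \<in> carrier_mat (m + n) (k + l)"
  obtains A B C D where "M = four_block_mat A B C D"
    "A \<in> carrier_mat m k" "B \<in> carrier_mat m l" "C \<in> carrier_mat n k" "D \<in> carrier_mat n l"
proof -
  obtain A B C D where s: "split_block M m k = (A, B, C, D)" by (metis prod_cases4)
  show ?thesis using split_block[OF s, of n l] assms that by auto
qed

section \<open>Invertible matrices and their inverses\<close>

definition GL :: "nat \<Rightarrow> 'b::comm_ring_1 mat set" where
  "GL n = {A \<in> carrier_mat n n. det A \<noteq> 0}"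

definition sym_mats :: "nat \<Rightarrow> 'b mat set" where
  "sym_mats n = {A \<in> carrier_mat n n. transpose_mat A = A}"

definition sym_GL :: "nat \<Rightarrow> 'b::comm_ring_1 mat set" where
  "sym_GL n = sym_mats n \<inter> GL n"

text \<open>The adjugate formula as a total function, so that the inverse need not be carried along
  as a separate witness like \<open>A'\<close> in \<open>P_plus\<close>.\<close>

definition minv :: "'b::field mat \<Rightarrow> 'b mat" where
  "minv A = inverse (det A) \<cdot>\<^sub>m adj_mat A"

lemma GL_carrier: "A \<in> GL n \<Longrightarrow> A \<in> carrier_mat n n"
  by (simp add: GL_def)

lemma finite_GL [simp]: "finite (GL n :: 'b::{finite,comm_ring_1} mat set)"
  unfolding GL_def by simp

lemma minv:
  assumes "A \<in> GL n"
  shows "minv A \<in> carrier_mat n n" "A * minv A = 1\<^sub>m n" "minv A * A = 1\<^sub>m n"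
proof -
  have A: "A \<in> carrier_mat n n" "det A \<noteq> 0" using assms by (auto simp: GL_def)
  note a = adj_mat[OF A(1)]
  show "minv A \<in> carrier_mat n n" using a(1) by (simp add: minv_def)
  have "x \<cdot>\<^sub>m (y \<cdot>\<^sub>m B) = (x * y) \<cdot>\<^sub>m B" for x y :: 'a and B by (intro eq_matI) auto
  moreover have "(1::'a) \<cdot>\<^sub>m B = B" for B by (intro eq_matI) auto
  ultimately have e: "inverse (det A) \<cdot>\<^sub>m (det A \<cdot>\<^sub>m B) = B" for B using A(2) by simp
  show "A * minv A = 1\<^sub>m n" unfolding minv_def
    using A a by (simp add: mult_smult_distrib[of _ n n _ n] e)
  show "minv A * A = 1\<^sub>m n" unfolding minv_def
    using A a by (simp add: mult_smult_assoc_mat[of _ n n _ n] e)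
qed

lemma GL_I:
  assumes "A \<in> carrier_mat n n" "B \<in> carrier_mat n n" "A * B = 1\<^sub>m n"
  shows "A \<in> GL n"
proof -
  have "det A * det B = 1" using det_mult[OF assms(1,2)] assms(3) by simp
  then show ?thesis using assms(1) by (auto simp: GL_def)
qed

lemma minv_unique:
  assumes "A \<in> GL n" "B \<in> carrier_mat n n" "A * B = 1\<^sub>m n \<or> B * A = 1\<^sub>m n"
  shows "minv A = B"
proof -
  have A: "A \<in> carrier_mat n n" using assms(1) by (rule GL_carrier)
  note m = minv[OF assms(1)]
  show ?thesis using assms(3)
  proof
    assume 1: "A * B = 1\<^sub>m n"
    have "minv A = minv A * (A * B)" using m 1 by simp
    also have "\<dots> = B" using m A assms(2) by (simp flip: assoc_mult_mat[OF m(1) A assms(2)])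
    finally show ?thesis .
  next
    assume 1: "B * A = 1\<^sub>m n"
    have "minv A = (B * A) * minv A" using m 1 by simp
    also have "\<dots> = B" using m A assms(2) by (simp add: assoc_mult_mat[OF assms(2) A m(1)])
    finally show ?thesis .
  qed
qed

lemma GL_mult: "A \<in> GL n \<Longrightarrow> B \<in> GL n \<Longrightarrow> A * B \<in> GL n"
  for A :: "'b::idom mat"
  by (auto simp: GL_def det_mult)

lemma minv_GL: "A \<in> GL n \<Longrightarrow> minv A \<in> GL n"
  using minv[of A n] by (intro GL_I[of _ _ A]) (auto simp: GL_carrier)

lemma transpose_GL: "A \<in> GL n \<Longrightarrow> transpose_mat A \<in> GL n"
  by (auto simp: GL_def det_transpose)

lemma minv_cancel:
  assumes A: "A \<in> GL n" and B: "B \<in> carrier_mat n k"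
  shows "minv A * (A * B) = B" "A * (minv A * B) = B"
  using minv[OF A] B
  by (simp_all flip: assoc_mult_mat[OF minv(1)[OF A] GL_carrier[OF A] B]
      assoc_mult_mat[OF GL_carrier[OF A] minv(1)[OF A] B])

section \<open>The order of the general linear group\<close>

definition unit_col :: "nat \<Rightarrow> 'b::zero_neq_one mat" where
  "unit_col n = mat n 1 (\<lambda>(i, j). if i = 0 then 1 else 0)"

lemma unit_col_carrier [simp]: "unit_col n \<in> carrier_mat n 1"
  by (simp add: unit_col_def)

lemma mult_unit_col:
  assumes "A \<in> carrier_mat n (Suc m)"
  shows "A * unit_col (Suc m) = mat n 1 (\<lambda>(i, j). A $$ (i, 0) :: 'b::semiring_1)"
proof (rule eq_matI)
  fix i j assume ij: "i < dim_row (mat n 1 (\<lambda>(i, j). A $$ (i, 0)))" "j < dim_col (mat n 1 (\<lambda>(i, j). A $$ (i, 0)))"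
  then have "(A * unit_col (Suc m)) $$ (i, j) = (\<Sum>k\<in>{0..<Suc m}. A $$ (i, k) * (if k = 0 then 1 else 0))"
    using assms unfolding unit_col_def by (auto simp: scalar_prod_def intro!: sum.cong)
  also have "\<dots> = A $$ (i, 0)" by (simp add: if_distrib cong: if_cong)
  finally show "(A * unit_col (Suc m)) $$ (i, j) = mat n 1 (\<lambda>(i, j). A $$ (i, 0)) $$ (i, j)"
    using ij by simp
qed (use assms in \<open>auto simp: unit_col_def\<close>)

text \<open>A nonzero vector is completed to a basis by all unit vectors except one at whose index
  it has a nonzero entry.\<close>

lemma ex_GL_first_col:
  fixes W :: "'b::field mat"
  assumes W: "W \<in> carrier_mat (Suc m) 1" and nz: "W \<noteq> 0\<^sub>m (Suc m) 1"
  obtains G where "G \<in> GL (Suc m)" "G * unit_col (Suc m) = W"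
proof -
  obtain k where k: "k < Suc m" "W $$ (k, 0) \<noteq> 0"
    using nz W by (metis One_nat_def carrier_matD eq_matI index_zero_mat(1,2,3) less_Suc0)
  \<comment> \<open>For \<open>j >= 1\<close> the values of \<open>\<tau>\<close> run once through
    all indices except \<open>k\<close>: the position that would yield \<open>k\<close> takes 0
    instead. So column \<open>j\<close> of \<open>G\<close> is the unit vector with index
    \<open>\<tau> j\<close>.\<close>
  define \<tau> where "\<tau> j = (if j = k then 0 else j)" for j
  define G where "G = mat (Suc m) (Suc m) (\<lambda>(i, j). if j = 0 then W $$ (i, 0) else if i = \<tau> j then 1 else 0)"
  have G: "G \<in> carrier_mat (Suc m) (Suc m)" by (simp add: G_def)
  have "det G \<noteq> 0"
  proof
    assume "det G = 0"
    then obtain x where x: "x \<in> carrier_vec (Suc m)" "x \<noteq> 0\<^sub>v (Suc m)" "G *\<^sub>v x = 0\<^sub>v (Suc m)"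
      using det_0_iff_vec_prod_zero_field[OF G] by blast
    have row: "W $$ (i, 0) * x $ 0 + (\<Sum>j\<in>{1..<Suc m}. if i = \<tau> j then x $ j else 0) = 0" if "i < Suc m" for i
    proof -
      have "(G *\<^sub>v x) $ i = (\<Sum>j\<in>{0..<Suc m}. G $$ (i, j) * x $ j)"
        using that x(1) by (auto simp: G_def scalar_prod_def)
      also have "\<dots> = G $$ (i, 0) * x $ 0 + (\<Sum>j\<in>{1..<Suc m}. G $$ (i, j) * x $ j)"
        by (subst sum.atLeast_Suc_lessThan) auto
      also have "(\<Sum>j\<in>{1..<Suc m}. G $$ (i, j) * x $ j) = (\<Sum>j\<in>{1..<Suc m}. if i = \<tau> j then x $ j else 0)"
        using that by (intro sum.cong) (auto simp: G_def)
      finally have "0\<^sub>v (Suc m) $ i = G $$ (i, 0) * x $ 0 + (\<Sum>j\<in>{1..<Suc m}. if i = \<tau> j then x $ j else 0)"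
        unfolding x(3) .
      moreover have "0\<^sub>v (Suc m) $ i = (0::'b)" "G $$ (i, 0) = W $$ (i, 0)" using that by (simp_all add: G_def)
      ultimately show ?thesis by (simp only:)
    qed
    \<comment> \<open>Row \<open>k\<close> meets only the first column of \<open>G\<close>, which
      forces \<open>x $ 0 = 0\<close>; each remaining row then isolates one further
      coordinate.\<close>
    have "(\<Sum>j\<in>{1..<Suc m}. if k = \<tau> j then x $ j else 0) = 0"
      by (intro sum.neutral) (auto simp: \<tau>_def)
    then have x0: "x $ 0 = 0" using row[OF k(1)] k(2) by simp
    have "x $ j = 0" if "j \<in> {1..<Suc m}" for j
    proof -
      have "\<tau> j = \<tau> j' \<longleftrightarrow> j' = j" if "j' \<in> {1..<Suc m}" for j'
        using that \<open>j \<in> _\<close> by (auto simp: \<tau>_def split: if_splits)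
      then have "(\<Sum>j'\<in>{1..<Suc m}. if \<tau> j = \<tau> j' then x $ j' else 0) = (\<Sum>j'\<in>{1..<Suc m}. if j' = j then x $ j' else 0)"
        by (intro sum.cong) auto
      also have "\<dots> = x $ j" using that by simp
      finally show ?thesis using row[of "\<tau> j"] x0 that by (auto simp: \<tau>_def split: if_splits)
    qed
    then have "x = 0\<^sub>v (Suc m)" using x(1) x0
      by (intro eq_vecI) (auto simp: less_Suc_eq_0_disj)
    then show False using x(2) by simp
  qed
  then have "G \<in> GL (Suc m)" using G by (simp add: GL_def)
  moreover have "G * unit_col (Suc m) = W"
    unfolding mult_unit_col[OF G] using W by (intro eq_matI) (auto simp: G_def)
  ultimately show ?thesis using that by blast
qed

lemma card_GL_0: "card (GL 0 :: 'b::{finite,field} mat set) = 1"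
proof -
  have "GL 0 = {1\<^sub>m 0 :: 'b mat}" by (auto simp: GL_def intro!: eq_matI)
  then show ?thesis by simp
qed

text \<open>The group is transitive on nonzero columns, of which there are
  \<open>q ^ Suc m - 1\<close>, so the fibres of the first-column map are left translates of the one
  over the first unit vector. That fibre consists of block matrices with a free first row
  \<open>W\<close> and an arbitrary invertible \<open>A\<close>.\<close>

lemma card_GL_Suc:
  defines "q \<equiv> card (UNIV :: 'b::{finite,field} set)"
  shows "card (GL (Suc m) :: 'b mat set) = (q ^ Suc m - 1) * q ^ m * card (GL m :: 'b mat set)"
proof -
  let ?E = "unit_col (Suc m) :: 'b mat"
  let ?F = "\<lambda>W. {A \<in> GL (Suc m). A * ?E = W}"
  have sum: "card (GL (Suc m) :: 'b mat set) = (\<Sum>W\<in>carrier_mat (Suc m) 1 - {0\<^sub>m (Suc m) 1}. card (?F W))"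
  proof -
    have "A * ?E \<in> carrier_mat (Suc m) 1 - {0\<^sub>m (Suc m) 1}" if A: "A \<in> GL (Suc m)" for A
    proof -
      have "A * ?E \<noteq> 0\<^sub>m (Suc m) 1"
      proof
        assume 0: "A * ?E = 0\<^sub>m (Suc m) 1"
        have "?E = minv A * (A * ?E)"
          using minv_cancel(1)[OF A unit_col_carrier] by simp
        also have "\<dots> = 0\<^sub>m (Suc m) 1" unfolding 0 using minv[OF A] by simp
        finally have "?E $$ (0, 0) = 0\<^sub>m (Suc m) 1 $$ (0, 0)" by simp
        then show False by (simp add: unit_col_def)
      qed
      then show ?thesis using mult_carrier_mat[OF GL_carrier[OF A] unit_col_carrier] by simp
    qed
    then have "(\<Sum>W\<in>carrier_mat (Suc m) 1 - {0\<^sub>m (Suc m) 1}. \<Sum>A\<in>?F W. 1) = (\<Sum>A\<in>(GL (Suc m) :: 'b mat set). 1::nat)"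
      by (intro sum.group) auto
    then show ?thesis by simp
  qed
  have same: "card (?F W) = card (?F ?E)" if W: "W \<in> carrier_mat (Suc m) 1 - {0\<^sub>m (Suc m) 1}" for W
  proof -
    obtain G where G: "G \<in> GL (Suc m)" "G * ?E = W" using ex_GL_first_col W by blast
    note c = GL_carrier[OF G(1)] GL_carrier[OF minv_GL[OF G(1)]]
    have "bij_betw (\<lambda>A. minv G * A) (?F W) (?F ?E)"
    proof (rule bij_betwI[where g="\<lambda>A. G * A"])
      show "(\<lambda>A. G * A) \<in> ?F ?E \<rightarrow> ?F W"
        using G(2) GL_mult[OF G(1)] by (auto simp: assoc_mult_mat[OF c(1) GL_carrier unit_col_carrier])
      have "minv G * W = ?E"
        unfolding G(2)[symmetric] using minv_cancel(1)[OF G(1) unit_col_carrier] .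
      then show "(\<lambda>A. minv G * A) \<in> ?F W \<rightarrow> ?F ?E"
        using GL_mult[OF minv_GL[OF G(1)]]
        by (auto simp: assoc_mult_mat[OF c(2) GL_carrier unit_col_carrier])
    qed (auto simp: minv_cancel[OF G(1) GL_carrier])
    then show ?thesis by (rule bij_betw_same_card)
  qed
  have fibre: "card (?F ?E) = q ^ m * card (GL m :: 'b mat set)"
  proof -
    let ?b = "\<lambda>(W, A). four_block_mat (1\<^sub>m 1) W (0\<^sub>m m 1) A :: 'b mat"
    have "bij_betw ?b (carrier_mat 1 m \<times> GL m) (?F ?E)"
      unfolding bij_betw_def
    proof
      show "inj_on ?b (carrier_mat 1 m \<times> GL m)"
        by (rule inj_onI) (auto dest!: GL_carrier dest: four_block_inj(2,4)[where m=1 and k=1 and n=m and l=m])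
      show "?b ` (carrier_mat 1 m \<times> GL m) = ?F ?E"
      proof (intro equalityI subsetI)
        fix M assume "M \<in> ?b ` (carrier_mat 1 m \<times> GL m)"
        then obtain W A where M: "M = four_block_mat (1\<^sub>m 1) W (0\<^sub>m m 1) A" "W \<in> carrier_mat 1 m" "A \<in> GL m"
          by auto
        have c: "M \<in> carrier_mat (Suc m) (Suc m)" using M GL_carrier[OF M(3)] by auto
        have "det M = det (1\<^sub>m 1 :: 'b mat) * det A"
          unfolding M(1) using M GL_carrier[OF M(3)]
          by (intro det_four_block_mat_lower_left_zero) auto
        then have "M \<in> GL (Suc m)" using M(3) c by (simp add: GL_def)
        moreover have "M * ?E = ?E" unfolding mult_unit_col[OF c]
          using c GL_carrier[OF M(3)] by (intro eq_matI) (auto simp: M(1) unit_col_def)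
        ultimately show "M \<in> ?F ?E" by simp
      next
        fix M assume "M \<in> ?F ?E"
        then have M: "M \<in> GL (Suc m)" "M * ?E = ?E" by auto
        have "M \<in> carrier_mat (1 + m) (1 + m)" using GL_carrier[OF M(1)] by simp
        then obtain a W V A where b: "M = four_block_mat a W V A" "a \<in> carrier_mat 1 1" "W \<in> carrier_mat 1 m"
          "V \<in> carrier_mat m 1" "A \<in> carrier_mat m m"
          by (rule four_block_cases)
        have e: "M $$ (i, 0) = (if i = 0 then 1 else 0)" if "i < Suc m" for i
          using arg_cong[OF M(2), of "\<lambda>N. N $$ (i, 0)"] that
          unfolding mult_unit_col[OF GL_carrier[OF M(1)]] by (simp add: unit_col_def)
        have a: "a = 1\<^sub>m 1" using e[of 0] b by (intro eq_matI) auto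
        have V: "V = 0\<^sub>m m 1"
        proof (rule eq_matI)
          fix i j assume "i < dim_row (0\<^sub>m m 1)" "j < dim_col (0\<^sub>m m 1)"
          then show "V $$ (i, j) = 0\<^sub>m m 1 $$ (i, j)" using e[of "Suc i"] b by auto
        qed (use b in auto)
        have "det M = det a * det A"
          unfolding b(1) using b V by (intro det_four_block_mat_lower_left_zero) auto
        then have "A \<in> GL m" using M(1) b by (auto simp: GL_def)
        then show "M \<in> ?b ` (carrier_mat 1 m \<times> GL m)"
          using b a V by (intro image_eqI[of _ _ "(W, A)"]) auto
      qed
    qed
    then have "card (?F ?E) = card ((carrier_mat 1 m :: 'b mat set) \<times> (GL m :: 'b mat set))"
      by (rule bij_betw_same_card[THEN sym])
    then show ?thesis by (simp add: card_carrier_mat q_def)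
  qed
  show ?thesis
    unfolding sum using same fibre
    by (simp add: card_Diff_singleton card_carrier_mat q_def)
qed

section \<open>Symmetric, alternating and lower triangular matrices in block form\<close>

lemma four_block_sym_iff:
  assumes "A \<in> carrier_mat m m" "B \<in> carrier_mat m n" "W \<in> carrier_mat n m" "D \<in> carrier_mat n n"
  shows "transpose_mat (four_block_mat A B W D) = four_block_mat A B W D \<longleftrightarrow>
    transpose_mat A = A \<and> B = transpose_mat W \<and> transpose_mat D = D"
  unfolding transpose_four_block_mat[OF assms]
  using four_block_inj[where A="transpose_mat A" and A'=A and B="transpose_mat W" and B'=B and
      C="transpose_mat B" and C'=W and D="transpose_mat D" and D'=D and m=m and k=m and n=n and l=n] assms
  by (metis transpose_carrier_mat transpose_transpose)

lemma sym_mats_block_bij: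
  "bij_betw (\<lambda>(A, W, D). four_block_mat A (transpose_mat W) W D)
     (sym_mats m \<times> carrier_mat n m \<times> sym_mats n) (sym_mats (m + n))" (is "bij_betw ?b ?S ?T")
  unfolding bij_betw_def
proof
  show "inj_on ?b ?S"
    by (rule inj_onI) (auto simp: sym_mats_def dest: four_block_inj[where m=m and k=m and n=n and l=n])
  show "?b ` ?S = ?T"
  proof (intro equalityI subsetI)
    fix M assume "M \<in> ?b ` ?S"
    then show "M \<in> ?T"
      by (auto simp: sym_mats_def four_block_sym_iff[of _ m _ n])
  next
    fix M assume M: "M \<in> ?T"
    then have "M \<in> carrier_mat (m + n) (m + n)" by (simp add: sym_mats_def)
    then obtain A B W D where b: "M = four_block_mat A B W D" "A \<in> carrier_mat m m"
      "B \<in> carrier_mat m n" "W \<in> carrier_mat n m" "D \<in> carrier_mat n n"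
      by (rule four_block_cases)
    then have "transpose_mat A = A \<and> B = transpose_mat W \<and> transpose_mat D = D"
      using M four_block_sym_iff[OF b(2-5)] by (auto simp: sym_mats_def)
    then show "M \<in> ?b ` ?S" using b by (intro image_eqI[of _ _ "(A, W, D)"]) (auto simp: sym_mats_def)
  qed
qed

lemma four_block_alternating_iff:
  assumes "A \<in> carrier_mat m m" "B \<in> carrier_mat m n" "W \<in> carrier_mat n m" "D \<in> carrier_mat n n"
  shows "four_block_mat A B W D \<in> alternating_mats (m + n) \<longleftrightarrow>
    A \<in> alternating_mats m \<and> B = transpose_mat W \<and> D \<in> alternating_mats n"
proof -
  let ?M = "four_block_mat A B W D"
  have "(\<forall>i<m + n. ?M $$ (i, i) = 0) \<longleftrightarrow> (\<forall>i<m. A $$ (i, i) = 0) \<and> (\<forall>i<n. D $$ (i, i) = 0)"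
  proof safe
    fix i assume "\<forall>i<m + n. ?M $$ (i, i) = 0" "i < m"
    then show "A $$ (i, i) = 0" using assms by (auto dest: spec[of _ i])
  next
    fix i assume "\<forall>i<m + n. ?M $$ (i, i) = 0" "i < n"
    then show "D $$ (i, i) = 0" using assms by (auto dest: spec[of _ "i + m"])
  qed (use assms in auto)
  then show ?thesis using assms four_block_sym_iff[OF assms] by (auto simp: alternating_mats_def)
qed

lemma alternating_mats_block_bij:
  "bij_betw (\<lambda>(A, W, D). four_block_mat A (transpose_mat W) W D)
     (alternating_mats m \<times> carrier_mat n m \<times> alternating_mats n) (alternating_mats (m + n))" (is "bij_betw ?b ?S ?T")
  unfolding bij_betw_def
proof
  show "inj_on ?b ?S"
    by (rule inj_onI) (auto simp: alternating_mats_def dest: four_block_inj[where m=m and k=m and n=n and l=n])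
  show "?b ` ?S = ?T"
  proof (intro equalityI subsetI)
    fix M assume "M \<in> ?b ` ?S"
    then obtain A W D where "M = four_block_mat A (transpose_mat W) W D" "A \<in> alternating_mats m"
      "W \<in> carrier_mat n m" "D \<in> alternating_mats n" by auto
    then show "M \<in> ?T"
      using four_block_alternating_iff[of A m "transpose_mat W" n W D] by (simp add: alternating_mats_def)
  next
    fix M assume M: "M \<in> ?T"
    then have "M \<in> carrier_mat (m + n) (m + n)" by (simp add: alternating_mats_def)
    then obtain A B W D where b: "M = four_block_mat A B W D" "A \<in> carrier_mat m m"
      "B \<in> carrier_mat m n" "W \<in> carrier_mat n m" "D \<in> carrier_mat n n"
      by (rule four_block_cases)
    then have "A \<in> alternating_mats m \<and> B = transpose_mat W \<and> D \<in> alternating_mats n"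
      using M four_block_alternating_iff[OF b(2-5)] by auto
    then show "M \<in> ?b ` ?S" using b by (intro image_eqI[of _ _ "(A, W, D)"]) auto
  qed
qed

lemma finite_alternating_mats [simp]: "finite (alternating_mats n :: 'b::{finite,zero} mat set)"
  by (simp add: alternating_mats_def)

lemma finite_sym_mats [simp]: "finite (sym_mats n :: 'b::finite mat set)"
  by (simp add: sym_mats_def)

lemma card_alternating_mats_add:
  "card (alternating_mats (m + n) :: 'b::{finite,zero} mat set) =
    card (alternating_mats m :: 'b mat set) * card (UNIV :: 'b set) ^ (m * n) * card (alternating_mats n :: 'b mat set)"
  using bij_betw_same_card[OF alternating_mats_block_bij[of m n, where 'a='b]]
  by (simp add: card_carrier_mat mult.commute[of n m])

lemma card_alternating_mats:
  "card (alternating_mats n :: 'b::{finite,zero} mat set) = card (UNIV :: 'b set) ^ (n * (n - 1) div 2)"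
proof (induction n)
  case 0
  have "alternating_mats 0 = {0\<^sub>m 0 0 :: 'b mat}" by (auto simp: alternating_mats_def intro!: eq_matI)
  then show ?case by simp
next
  case (Suc n)
  have "alternating_mats 1 = {0\<^sub>m 1 1 :: 'b mat}" by (auto simp: alternating_mats_def intro!: eq_matI)
  moreover have "Suc n * (Suc n - 1) div 2 = n * (n - 1) div 2 + n"
  proof -
    have "Suc n * (Suc n - 1) = n * (n - 1) + 2 * n" by (cases n) auto
    then show ?thesis by simp
  qed
  ultimately show ?case
    using card_alternating_mats_add[of 1 n, where 'b='b] Suc by (simp add: power_add)
qed

lemma lower_block_GL_bij:
  "bij_betw (\<lambda>(A, W, D). four_block_mat A (0\<^sub>m m n) W D)
     (GL m \<times> carrier_mat n m \<times> GL n)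
     {M \<in> GL (m + n). \<forall>i<m. \<forall>j\<in>{m..<m + n}. M $$ (i, j) = (0::'b::idom)}" (is "bij_betw ?b ?S ?T")
  unfolding bij_betw_def
proof
  show "inj_on ?b ?S"
    by (rule inj_onI) (auto simp: GL_def dest: four_block_inj[where m=m and k=m and n=n and l=n])
  have det: "det (four_block_mat A (0\<^sub>m m n) W D) = det A * det D"
    if "A \<in> carrier_mat m m" "W \<in> carrier_mat n m" "D \<in> carrier_mat n n" for A W D :: "'b mat"
    using that by (intro det_four_block_mat_upper_right_zero) auto
  show "?b ` ?S = ?T"
  proof (intro equalityI subsetI)
    fix M assume "M \<in> ?b ` ?S"
    then show "M \<in> ?T" by (auto simp: GL_def det)
  next
    fix M assume M: "M \<in> ?T"
    then have "M \<in> carrier_mat (m + n) (m + n)" by (simp add: GL_def)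
    then obtain A B W D where b: "M = four_block_mat A B W D" "A \<in> carrier_mat m m"
      "B \<in> carrier_mat m n" "W \<in> carrier_mat n m" "D \<in> carrier_mat n n"
      by (rule four_block_cases)
    have B: "B = 0\<^sub>m m n"
    proof (rule eq_matI)
      fix i j assume "i < dim_row (0\<^sub>m m n)" "j < dim_col (0\<^sub>m m n)"
      moreover have "\<forall>i<m. \<forall>j\<in>{m..<m + n}. M $$ (i, j) = 0" using M by blast
      ultimately have "M $$ (i, j + m) = 0" by auto
      then show "B $$ (i, j) = 0\<^sub>m m n $$ (i, j)"
        using b \<open>i < _\<close> \<open>j < _\<close> by auto
    qed (use b in auto)
    then have "A \<in> GL m \<and> D \<in> GL n" using M b det[OF b(2,4,5)] by (auto simp: GL_def)
    then show "M \<in> ?b ` ?S" using b B by (intro image_eqI[of _ _ "(A, W, D)"]) auto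
  qed
qed

section \<open>Counting invertible symmetric matrices with Schur complements\<close>

lemma det_schur:
  fixes K :: "'b::field mat"
  assumes K: "K \<in> GL m" and W: "W \<in> carrier_mat n m" "W' \<in> carrier_mat m n" and N: "N \<in> carrier_mat n n"
  shows "det (four_block_mat K W' W N) = det K * det (N - W * minv K * W')"
proof -
  note c = GL_carrier[OF K] minv[OF K]
  let ?S = "N - W * minv K * W'"
  \<comment> \<open>Block elimination: a unipotent lower factor clears \<open>W\<close> and leaves
    the Schur complement in the last block.\<close>
  have "four_block_mat K W' W N = four_block_mat (1\<^sub>m m) (0\<^sub>m m n) (W * minv K) (1\<^sub>m n) * four_block_mat K W' (0\<^sub>m n m) ?S"
  proof -
    have 1: "W * minv K * K = W" using c W by (simp add: assoc_mult_mat[of _ n m _ m _ m])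
    have 2: "W * minv K * W' + ?S = N" using c W N by (intro eq_matI) auto
    have "W * minv K \<in> carrier_mat n m" "?S \<in> carrier_mat n n" using c W by auto
    then show ?thesis
      using c W N 1 2 by (subst mult_four_block_mat[of _ m m _ n _ n]) (auto simp: 1 2)
  qed
  moreover have "det (four_block_mat (1\<^sub>m m) (0\<^sub>m m n) (W * minv K) (1\<^sub>m n)) = det (1\<^sub>m m) * det (1\<^sub>m n :: 'b mat)"
    using c W by (intro det_four_block_mat_upper_right_zero) auto
  moreover have "det (four_block_mat K W' (0\<^sub>m n m) ?S) = det K * det ?S"
    using c W by (intro det_four_block_mat_lower_left_zero) auto
  moreover have "four_block_mat (1\<^sub>m m) (0\<^sub>m m n) (W * minv K) (1\<^sub>m n) \<in> carrier_mat (m + n) (m + n)"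
    "four_block_mat K W' (0\<^sub>m n m) ?S \<in> carrier_mat (m + n) (m + n)"
    using c W by auto
  ultimately show ?thesis by (simp only: det_mult det_one mult_1_left)
qed

lemma minv_sym:
  assumes "K \<in> sym_GL m"
  shows "transpose_mat (minv K) = minv K"
proof -
  have K: "K \<in> GL m" "transpose_mat K = K" using assms by (auto simp: sym_GL_def sym_mats_def)
  note m = minv[OF K(1)]
  have "K * transpose_mat (minv K) = transpose_mat (minv K * K)"
    using transpose_mult[OF m(1) GL_carrier[OF K(1)]] K(2) by simp
  also have "\<dots> = 1\<^sub>m m" unfolding m(3) by simp
  finally show ?thesis using minv_unique[OF K(1), of "transpose_mat (minv K)"] m(1) by simp
qed

text \<open>For invertible symmetric \<open>K\<close> the Schur complement is \<open>N\<close>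
  translated by a fixed symmetric matrix, so the count does not depend on \<open>K\<close> and
  \<open>W\<close>.\<close>

lemma card_sym_schur:
  fixes K :: "'b::{finite,field} mat"
  assumes K: "K \<in> sym_GL m" and W: "W \<in> carrier_mat n m"
  shows "card {N \<in> sym_mats n. det (four_block_mat K (transpose_mat W) W N) \<noteq> 0} = card (sym_GL n :: 'b mat set)"
proof -
  have KG: "K \<in> GL m" using K by (simp add: sym_GL_def)
  let ?C = "W * minv K * transpose_mat W"
  note c = GL_carrier[OF KG] minv[OF KG]
  have C: "?C \<in> carrier_mat n n" using c W by auto
  have WT: "transpose_mat W \<in> carrier_mat m n" "W * minv K \<in> carrier_mat n m" using W c by auto
  have "transpose_mat ?C = W * transpose_mat (W * minv K)"
    using transpose_mult[OF WT(2,1)] by simp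
  also have "\<dots> = W * (minv K * transpose_mat W)"
    using transpose_mult[OF W c(2)] by (simp add: minv_sym[OF K])
  also have "\<dots> = ?C" using c W by (simp add: assoc_mult_mat[of _ n m _ m _ n])
  finally have CT: "transpose_mat ?C = ?C" .
  have carr: "N \<in> carrier_mat n n" if "N \<in> sym_mats n" for N :: "'b mat"
    using that by (simp add: sym_mats_def)
  obtain C where C: "C \<in> carrier_mat n n" "transpose_mat C = C"
    and det: "\<And>N. N \<in> sym_mats n \<Longrightarrow> det (four_block_mat K (transpose_mat W) W N) = det K * det (N - C)"
  proof (rule that)
    show "det (four_block_mat K (transpose_mat W) W N) = det K * det (N - ?C)" if "N \<in> sym_mats n" for N
      using det_schur[OF KG W _ carr[OF that]] W by simp
  qed (use C CT in auto)
  have closed: "N - C \<in> sym_mats n" "N + C \<in> sym_mats n" and inv: "N - C + C = N" "N + C - C = N"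
    if "N \<in> sym_mats n" for N
  proof -
    note N = carr[OF that]
    have "transpose_mat (N - C) = N - C" "transpose_mat (N + C) = N + C"
      using transpose_minus[OF N C(1)] transpose_add[OF N C(1)] C(2) that by (simp_all add: sym_mats_def)
    moreover show "N - C + C = N" "N + C - C = N" using N C by (auto intro!: eq_matI)
    moreover have "N - C \<in> carrier_mat n n" "N + C \<in> carrier_mat n n"
      using minus_carrier_mat[OF C(1)] add_carrier_mat[OF C(1)] by blast+
    ultimately show "N - C \<in> sym_mats n" "N + C \<in> sym_mats n" unfolding sym_mats_def by blast+
  qed
  have GL: "N \<in> sym_GL n \<longleftrightarrow> N \<in> sym_mats n \<and> det N \<noteq> 0" for N :: "'b mat"
    using carr by (auto simp: sym_GL_def GL_def)
  have K0: "det K \<noteq> 0" using KG by (simp add: GL_def)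
  have "bij_betw (\<lambda>N. N - C) {N \<in> sym_mats n. det (four_block_mat K (transpose_mat W) W N) \<noteq> 0} (sym_GL n)"
    by (rule bij_betwI[where g="\<lambda>N. N + C"]) (auto simp: GL det closed inv K0)
  then show ?thesis by (rule bij_betw_same_card)
qed

lemma bij_betw_Collect_comp: "bij_betw f A B \<Longrightarrow> bij_betw f {x \<in> A. P (f x)} {y \<in> B. P y}"
  unfolding bij_betw_def inj_on_def by blast

lemma det_two:
  fixes A :: "'b::idom mat"
  assumes A: "A \<in> carrier_mat 2 2"
  shows "det A = A $$ (0, 0) * A $$ (1, 1) - A $$ (0, 1) * A $$ (1, 0)"
proof -
  have "A \<in> carrier_mat (1 + 1) (1 + 1)" using A by (simp add: numeral_2_eq_2)
  then obtain a b c d where e: "A = four_block_mat a b c d" and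
    car: "a \<in> carrier_mat 1 1" "b \<in> carrier_mat 1 1" "c \<in> carrier_mat 1 1" "d \<in> carrier_mat 1 1"
    by (rule four_block_cases)
  have "c * d = d * c" using car by (intro eq_matI) (auto simp: scalar_prod_def mult.commute)
  then have "det A = det (a * d - b * c)" unfolding e by (rule det_four_block_mat[OF car])
  also have "\<dots> = (a * d - b * c) $$ (0, 0)" using car by (intro det_single) auto
  finally show ?thesis using car by (simp add: e scalar_prod_def)
qed

lemma card_sym_GL_split:
  "card (sym_GL (m + n) :: 'b::{finite,idom} mat set) =
    (\<Sum>K\<in>sym_mats m. \<Sum>W\<in>carrier_mat n m.
      card {N \<in> sym_mats n. det (four_block_mat K (transpose_mat W) W N :: 'b mat) \<noteq> 0})"
proof -
  let ?b = "\<lambda>(A, W, D). four_block_mat A (transpose_mat W) W D :: 'b mat"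
  let ?R = "SIGMA K:sym_mats m. SIGMA W:carrier_mat n m. {N \<in> sym_mats n. det (four_block_mat K (transpose_mat W) W N :: 'b mat) \<noteq> 0}"
  have "?R = {x \<in> sym_mats m \<times> carrier_mat n m \<times> sym_mats n. det (?b x) \<noteq> 0}" by auto
  moreover have "sym_GL (m + n) = {M \<in> sym_mats (m + n). det M \<noteq> (0::'b)}"
    by (auto simp: sym_GL_def GL_def sym_mats_def)
  ultimately have "bij_betw ?b ?R (sym_GL (m + n))"
    using bij_betw_Collect_comp[OF sym_mats_block_bij[of m n], of "\<lambda>M. det M \<noteq> (0::'b)"] by simp
  then have "card (sym_GL (m + n) :: 'b mat set) = card ?R" by (rule bij_betw_same_card[THEN sym])
  then show ?thesis by simp
qed

lemma sym_mats_1: "sym_mats 1 = (carrier_mat 1 1 :: 'b mat set)"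
  by (auto simp: sym_mats_def intro!: eq_matI)

lemma transpose_congruence_bij:
  assumes G: "G \<in> GL n"
  shows "bij_betw (\<lambda>N. G * N * transpose_mat G) (sym_mats n) (sym_mats n :: 'b::field mat set)"
proof -
  have closed: "H * N * transpose_mat H \<in> sym_mats n" if "H \<in> GL n" "N \<in> sym_mats n" for H N :: "'b mat"
  proof -
    have c: "H \<in> carrier_mat n n" "transpose_mat H \<in> carrier_mat n n" "N \<in> carrier_mat n n" "transpose_mat N = N"
      using that by (auto simp: GL_def sym_mats_def)
    then have "transpose_mat (H * N * transpose_mat H) = H * (N * transpose_mat H)"
      using transpose_mult[of "H * N" n n "transpose_mat H" n] transpose_mult[of H n n N n] by simp
    then show ?thesis using c by (simp add: sym_mats_def assoc_mult_mat[of _ n n _ n _ n])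
  qed
  have inv: "minv G * (G * N * transpose_mat G) * transpose_mat (minv G) = N"
    "G * (minv G * N * transpose_mat (minv G)) * transpose_mat G = N" if "N \<in> sym_mats n" for N :: "'b mat"
  proof -
    note m = minv[OF G]
    have c: "G \<in> carrier_mat n n" "N \<in> carrier_mat n n" using G that by (auto simp: GL_def sym_mats_def)
    have t: "transpose_mat G * transpose_mat (minv G) = 1\<^sub>m n" "transpose_mat (minv G) * transpose_mat G = 1\<^sub>m n"
      unfolding transpose_mult[OF m(1) c(1), symmetric] transpose_mult[OF c(1) m(1), symmetric] m(2,3)
      by simp_all
    have tc: "transpose_mat G \<in> carrier_mat n n" "transpose_mat (minv G) \<in> carrier_mat n n" using c m by auto
    note as = assoc_mult_mat[of _ n n _ n _ n]
    have "minv G * (G * N * transpose_mat G) = N * transpose_mat G"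
      using c m tc by (simp add: minv_cancel[OF G, where k=n] as)
    then show "minv G * (G * N * transpose_mat G) * transpose_mat (minv G) = N"
      using c tc by (simp add: as t)
    have "G * (minv G * N * transpose_mat (minv G)) = N * transpose_mat (minv G)"
      using c m tc by (simp add: minv_cancel[OF G, where k=n] as)
    then show "G * (minv G * N * transpose_mat (minv G)) * transpose_mat G = N"
      using c tc by (simp add: as t)
  qed
  show ?thesis
    by (rule bij_betwI[where g="\<lambda>N. minv G * N * transpose_mat (minv G)"])
      (use closed[OF G] closed[OF minv_GL[OF G]] inv in auto)
qed

text \<open>A zero corner blocks the Schur complement of size one. A congruence first turns
  \<open>W\<close> into the first unit vector; then the leading 2 by 2 block is invertible whatever
  its last entry \<open>b\<close> is, and a Schur complement of size two applies. The free data are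
  \<open>b\<close>, the rest \<open>U\<close> of its column and an invertible symmetric matrix of
  size \<open>m\<close>.\<close>

lemma card_sym_zero_corner:
  assumes W: "W \<in> carrier_mat (Suc m) 1 - {0\<^sub>m (Suc m) 1}"
  defines "q \<equiv> card (UNIV :: 'b::{finite,field} set)"
  shows "card {N \<in> sym_mats (Suc m). det (four_block_mat (0\<^sub>m 1 1) (transpose_mat W) W N :: 'b mat) \<noteq> 0} =
    q * q ^ m * card (sym_GL m :: 'b mat set)"
proof -
  let ?E = "unit_col (Suc m) :: 'b mat"
  let ?M = "\<lambda>V N. four_block_mat (0\<^sub>m 1 1) (transpose_mat V) V N :: 'b mat"
  obtain G where G: "G \<in> GL (Suc m)" "G * ?E = W" using ex_GL_first_col W by blast
  note c = GL_carrier[OF G(1)]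
  have tc: "transpose_mat G \<in> carrier_mat (Suc m) (Suc m)" using c by simp
  \<comment> \<open>Multiplying by \<open>diag(1, G)\<close> on the left and by its transpose on the
    right carries the border from the unit column to \<open>W\<close> and changes the determinant by
    the square of \<open>det G\<close>.\<close>
  have congr: "det (?M W (G * N * transpose_mat G)) \<noteq> 0 \<longleftrightarrow> det (?M ?E N) \<noteq> 0" if N: "N \<in> sym_mats (Suc m)" for N
  proof -
    have Nc: "N \<in> carrier_mat (Suc m) (Suc m)" using N by (simp add: sym_mats_def)
    let ?L = "four_block_mat (1\<^sub>m 1) (0\<^sub>m 1 (Suc m)) (0\<^sub>m (Suc m) 1) G"
    let ?R = "four_block_mat (1\<^sub>m 1) (0\<^sub>m 1 (Suc m)) (0\<^sub>m (Suc m) 1) (transpose_mat G)"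
    have tW: "transpose_mat ?E * transpose_mat G = transpose_mat W"
      using transpose_mult[OF c unit_col_carrier] G(2) by simp
    have EE: "transpose_mat ?E \<in> carrier_mat 1 (Suc m)" using unit_col_carrier by simp
    have GN: "G * N \<in> carrier_mat (Suc m) (Suc m)" using c Nc by simp
    have WW: "W \<in> carrier_mat (Suc m) 1" using W by simp
    have "?L * ?M ?E N = four_block_mat (0\<^sub>m 1 1) (transpose_mat ?E) W (G * N)"
      using c Nc EE WW GN G(2) by (subst mult_four_block_mat[of _ 1 1 _ "Suc m" _ "Suc m"]) auto
    then have "?M W (G * N * transpose_mat G) = ?L * ?M ?E N * ?R"
      using tc EE WW GN tW by (simp, subst mult_four_block_mat[of _ 1 1 _ "Suc m" _ "Suc m"]) auto
    moreover have "?L \<in> carrier_mat (1 + Suc m) (1 + Suc m)" "?R \<in> carrier_mat (1 + Suc m) (1 + Suc m)"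
      "?M ?E N \<in> carrier_mat (1 + Suc m) (1 + Suc m)" "?L * ?M ?E N \<in> carrier_mat (1 + Suc m) (1 + Suc m)"
      using c tc Nc by (auto intro!: four_block_carrier_mat mult_carrier_mat[of _ _ "1 + Suc m"])
    moreover have "det ?L = det (1\<^sub>m 1) * det G" "det ?R = det (1\<^sub>m 1) * det (transpose_mat G)"
      by (rule det_four_block_mat_lower_left_zero; use c in simp)+
    then have "det ?L = det G" "det ?R = det G" by (simp_all add: det_transpose[OF c])
    ultimately have "det (?M W (G * N * transpose_mat G)) = det G * det (?M ?E N) * det G"
      by (simp only: det_mult)
    then show ?thesis using G(1) by (simp add: GL_def)
  qed
  have "bij_betw (\<lambda>N. G * N * transpose_mat G) {N \<in> sym_mats (Suc m). det (?M ?E N) \<noteq> 0}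
      {N \<in> sym_mats (Suc m). det (?M W N) \<noteq> 0}"
  proof -
    have "{N \<in> sym_mats (Suc m). det (?M ?E N) \<noteq> 0} =
        {N \<in> sym_mats (Suc m). det (?M W (G * N * transpose_mat G)) \<noteq> 0}"
      using congr by blast
    then show ?thesis
      using bij_betw_Collect_comp[OF transpose_congruence_bij[OF G(1)], of "\<lambda>N. det (?M W N) \<noteq> 0"] by simp
  qed
  then have 1: "card {N \<in> sym_mats (Suc m). det (?M W N) \<noteq> 0} = card {N \<in> sym_mats (Suc m). det (?M ?E N) \<noteq> 0}"
    by (rule bij_betw_same_card[THEN sym])
  let ?b = "\<lambda>(b, U, D). four_block_mat b (transpose_mat U) U D :: 'b mat"
  let ?S = "SIGMA b:carrier_mat 1 1. SIGMA U:carrier_mat m 1. {D \<in> sym_mats m. det (?M ?E (four_block_mat b (transpose_mat U) U D)) \<noteq> 0}"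
  have "?S = {x \<in> sym_mats 1 \<times> carrier_mat m 1 \<times> sym_mats m. det (?M ?E (?b x)) \<noteq> 0}"
    using sym_mats_1[where 'b='b] by auto
  then have "bij_betw ?b ?S {N \<in> sym_mats (Suc m). det (?M ?E N) \<noteq> 0}"
    using bij_betw_Collect_comp[OF sym_mats_block_bij[of 1 m], of "\<lambda>N. det (?M ?E N) \<noteq> 0"] by simp
  then have 2: "card {N \<in> sym_mats (Suc m). det (?M ?E N) \<noteq> 0} = card ?S"
    by (rule bij_betw_same_card[THEN sym])
  have 3: "card {D \<in> sym_mats m. det (?M ?E (four_block_mat b (transpose_mat U) U D)) \<noteq> 0} = card (sym_GL m :: 'b mat set)"
    if bU: "b \<in> carrier_mat 1 1" "U \<in> carrier_mat m 1" for b U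
  proof -
    \<comment> \<open>The border \<open>1 + (1 + m)\<close> is regrouped as \<open>2 + m\<close>:
      \<open>K\<close> is the leading block with rows \<open>(0, 1)\<close> and
      \<open>(1, b)\<close>, of determinant \<open>- 1\<close>, and \<open>V\<close> holds the two
      columns below it.\<close>
    define K where "K = mat 2 2 (\<lambda>(i, j). if i = 0 \<and> j = 0 then 0 else if i = 1 \<and> j = 1 then b $$ (0, 0) else 1)"
    define V where "V = mat m 2 (\<lambda>(i, j). if j = 0 then 0 else U $$ (i, 0))"
    have "det K = - 1" by (subst det_two) (auto simp: K_def)
    then have "K \<in> sym_GL 2" by (auto simp: sym_GL_def GL_def sym_mats_def K_def intro!: eq_matI)
    moreover have V: "V \<in> carrier_mat m 2" by (simp add: V_def)
    moreover have "?M ?E (four_block_mat b (transpose_mat U) U D) = four_block_mat K (transpose_mat V) V D"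
      if "D \<in> sym_mats m" for D
      using that bU
      by (intro eq_matI) (auto simp: K_def V_def unit_col_def sym_mats_def less_Suc_eq_0_disj numeral_2_eq_2)
    ultimately show ?thesis using card_sym_schur[of K 2 V m] by (simp cong: conj_cong)
  qed
  show ?thesis unfolding 1 2 using 3 by (simp add: card_carrier_mat q_def)
qed

lemma card_sym_GL_0: "card (sym_GL 0 :: 'b::{finite,field} mat set) = 1"
proof -
  have "sym_GL 0 = {1\<^sub>m 0 :: 'b mat}" by (auto simp: sym_GL_def sym_mats_def GL_def intro!: eq_matI)
  then show ?thesis by simp
qed

lemma sum_carrier_1:
  "(\<Sum>K\<in>carrier_mat 1 1. f K) = f (0\<^sub>m 1 1) + (\<Sum>K\<in>GL 1. f (K :: 'b::{finite,comm_ring_1} mat))"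
proof -
  have "carrier_mat 1 1 = insert (0\<^sub>m 1 1) (GL 1 :: 'b mat set)" "0\<^sub>m 1 1 \<notin> (GL 1 :: 'b mat set)"
    by (auto simp: GL_def det_single intro!: eq_matI)
  then show ?thesis by simp
qed

lemma card_GL_1: "card (GL 1 :: 'b::{finite,field} mat set) = card (UNIV :: 'b set) - 1"
  using card_GL_Suc[of 0, where 'b='b] by (simp add: card_GL_0)

lemma sum_sym_corner:
  fixes n :: nat
  defines "q \<equiv> card (UNIV :: 'b::{finite,field} set)"
  shows "card (sym_GL (Suc n) :: 'b mat set) =
    (\<Sum>W\<in>carrier_mat n 1. card {N \<in> sym_mats n. det (four_block_mat (0\<^sub>m 1 1) (transpose_mat W) W N :: 'b mat) \<noteq> 0}) +
    (q - 1) * q ^ n * card (sym_GL n :: 'b mat set)"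
proof -
  have "K \<in> sym_GL 1" if "K \<in> GL 1" for K :: "'b mat"
    using that sym_mats_1[where 'b='b] GL_carrier[OF that] by (simp add: sym_GL_def)
  then have "card {N \<in> sym_mats n. det (four_block_mat K (transpose_mat W) W N :: 'b mat) \<noteq> 0} = card (sym_GL n :: 'b mat set)"
    if "K \<in> GL 1" "W \<in> carrier_mat n 1" for K W
    using that card_sym_schur by blast
  then show ?thesis
    using card_sym_GL_split[of 1 n, where 'b='b] card_GL_1[where 'b='b]
    by (simp add: sym_mats_1[simplified] sum_carrier_1[simplified] card_carrier_mat q_def)
qed

lemma card_sym_zero_corner_zero:
  "{N \<in> sym_mats n. det (four_block_mat (0\<^sub>m 1 1) (transpose_mat (0\<^sub>m n 1)) (0\<^sub>m n 1) N :: 'b::field mat) \<noteq> 0} = {}"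
proof -
  have "det (four_block_mat (0\<^sub>m 1 1) (transpose_mat (0\<^sub>m n 1)) (0\<^sub>m n 1) N :: 'b mat) = 0" if "N \<in> sym_mats n" for N
    using that det_four_block_mat_lower_left_zero[of "0\<^sub>m 1 1" 1 "transpose_mat (0\<^sub>m n 1)" n "0\<^sub>m n 1" N]
    by (auto simp: sym_mats_def det_single)
  then show ?thesis by auto
qed

lemma card_sym_GL_1: "card (sym_GL 1 :: 'b::{finite,field} mat set) = card (UNIV :: 'b set) - 1"
proof -
  have "carrier_mat 0 1 = {0\<^sub>m 0 1 :: 'b mat}" by (auto intro!: eq_matI)
  then show ?thesis
    using sum_sym_corner[of 0, where 'b='b] card_sym_zero_corner_zero[of 0, where 'b='b] by (simp add: card_sym_GL_0)
qed

text \<open>Distinguish by the corner entry. If it is nonzero, the column below it is free and a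
  Schur complement of size \<open>Suc m\<close> remains; if it is zero, the column must be nonzero
  and \<open>card_sym_zero_corner\<close> applies.\<close>

lemma card_sym_GL_Suc_Suc:
  defines "q \<equiv> card (UNIV :: 'b::{finite,field} set)"
  shows "card (sym_GL (Suc (Suc m)) :: 'b mat set) =
    (q - 1) * q ^ Suc m * card (sym_GL (Suc m) :: 'b mat set) +
    (q ^ Suc m - 1) * q ^ Suc m * card (sym_GL m :: 'b mat set)"
proof -
  let ?f = "\<lambda>W. card {N \<in> sym_mats (Suc m). det (four_block_mat (0\<^sub>m 1 1) (transpose_mat W) W N :: 'b mat) \<noteq> 0}"
  have "(\<Sum>W\<in>carrier_mat (Suc m) 1. ?f W) = ?f (0\<^sub>m (Suc m) 1) + (\<Sum>W\<in>carrier_mat (Suc m) 1 - {0\<^sub>m (Suc m) 1}. ?f W)"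
    by (subst sum.remove[where x="0\<^sub>m (Suc m) 1"]) auto
  also have "?f (0\<^sub>m (Suc m) 1) = 0" by (simp only: card_sym_zero_corner_zero card.empty)
  also have "(\<Sum>W\<in>carrier_mat (Suc m) 1 - {0\<^sub>m (Suc m) 1}. ?f W) =
      (\<Sum>W\<in>carrier_mat (Suc m) 1 - {0\<^sub>m (Suc m) 1 :: 'b mat}. q * q ^ m * card (sym_GL m :: 'b mat set))"
    unfolding q_def by (intro sum.cong card_sym_zero_corner) auto
  finally show ?thesis
    using sum_sym_corner[of "Suc m", where 'b='b]
    by (simp add: card_Diff_singleton card_carrier_mat q_def)
qed

section \<open>Double cosets of the parabolic subgroup\<close>

text \<open>Left multiplication by \<open>h\<close> is injective on the finite set \<open>H\<close>,
  hence onto, so it reaches the unit.\<close>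

lemma (in group) finite_submonoid_subgroup:
  assumes "H \<subseteq> carrier G" "finite H" "\<one> \<in> H" "\<And>x y. x \<in> H \<Longrightarrow> y \<in> H \<Longrightarrow> x \<otimes> y \<in> H"
  shows "subgroup H G"
proof (rule subgroupI)
  fix h assume h: "h \<in> H"
  have "inj_on (\<lambda>x. h \<otimes> x) H" using assms(1) h by (intro inj_onI) (auto simp: subset_iff)
  then have "(\<lambda>x. h \<otimes> x) ` H = H"
    using assms h by (intro endo_inj_surj) auto
  then obtain x where x: "x \<in> H" "h \<otimes> x = \<one>" using assms(3) by (metis imageE)
  then have "inv h = x" using assms(1) h by (metis inv_equality inv_comm subsetD)
  then show "inv h \<in> H" using x by simp
qed (use assms in auto)

text \<open>The pairs with \<open>Q (p s p')\<close> are counted twice. As \<open>Q\<close> is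
  invariant under cyclic exchange, passing to \<open>(p' p, p')\<close> makes the condition
  independent of \<open>p'\<close>, which gives the right-hand side. On the other hand every element
  of \<open>D\<close> is the product of exactly \<open>card H\<close> pairs.\<close>

lemma (in group) card_double_coset:
  assumes fin: "finite (carrier G)" and P: "subgroup P G" and s: "s \<in> carrier G" "s \<otimes> s = \<one>"
    and Q: "\<And>x y. x \<in> carrier G \<Longrightarrow> y \<in> carrier G \<Longrightarrow> Q (x \<otimes> y) = Q (y \<otimes> x)"
  defines "D \<equiv> {p \<otimes> s \<otimes> p' | p p'. p \<in> P \<and> p' \<in> P}"
    and "H \<equiv> {h \<in> P. s \<otimes> h \<otimes> s \<in> P}"
  shows "card {w \<in> D. Q w} * card H = card P * card {p \<in> P. Q (p \<otimes> s)}"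
proof -
  note c [simp] = subgroup.mem_carrier[OF P]
  note [simp] = subgroup.m_closed[OF P] subgroup.m_inv_closed[OF P]
  have finP: "finite P" using fin by (meson P finite_subset subgroup.subset)
  have s_inv: "inv s = s" using s by (metis inv_equality)
  have ss: "s \<otimes> (s \<otimes> x) = x" if "x \<in> carrier G" for x using that s by (simp flip: m_assoc)
  let ?S = "{(p, p') \<in> P \<times> P. Q (p \<otimes> s \<otimes> p')}"
  have "card ?S = card ({p \<in> P. Q (p \<otimes> s)} \<times> P)"
  proof (rule bij_betw_same_card)
    have Q': "Q (p' \<otimes> p \<otimes> s) = Q (p \<otimes> s \<otimes> p')" if "p \<in> P" "p' \<in> P" for p p'
      using Q[of p' "p \<otimes> s"] that s by (simp add: m_assoc)
    show "bij_betw (\<lambda>(p, p'). (p' \<otimes> p, p')) ?S ({p \<in> P. Q (p \<otimes> s)} \<times> P)"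
    proof (rule bij_betwI[where g="\<lambda>(p, p'). (inv p' \<otimes> p, p')"])
      show "(\<lambda>(p, p'). (inv p' \<otimes> p, p')) \<in> {p \<in> P. Q (p \<otimes> s)} \<times> P \<rightarrow> ?S"
      proof clarsimp
        fix p p' assume p: "p \<in> P" "p' \<in> P" "Q (p \<otimes> s)"
        have "p' \<otimes> (inv p' \<otimes> p) \<otimes> s = p \<otimes> s" using p s by (simp flip: m_assoc)
        then show "Q (inv p' \<otimes> p \<otimes> s \<otimes> p')" using Q'[of "inv p' \<otimes> p" p'] p by simp
      qed
    qed (auto simp: Q' simp flip: m_assoc)
  qed
  then have 1: "card ?S = card P * card {p \<in> P. Q (p \<otimes> s)}" by (simp add: card_cartesian_product)
  \<comment> \<open>If two pairs have the same product, then \<open>p = p0 h\<close> and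
    \<open>p'\<close> is forced to be \<open>inv (s h s) p0'\<close>. Both lie in \<open>P\<close>
    exactly when \<open>h\<close> is in \<open>H\<close>.\<close>
  have fibre: "card {(p, p') \<in> P \<times> P. p \<otimes> s \<otimes> p' = p0 \<otimes> s \<otimes> p0'} = card H"
    if p0: "p0 \<in> P" "p0' \<in> P" for p0 p0'
  proof (rule bij_betw_same_card)
    show "bij_betw (\<lambda>(p, p'). inv p0 \<otimes> p) {(p, p') \<in> P \<times> P. p \<otimes> s \<otimes> p' = p0 \<otimes> s \<otimes> p0'} H"
    proof (rule bij_betwI[where g="\<lambda>h. (p0 \<otimes> h, inv (s \<otimes> h \<otimes> s) \<otimes> p0')"])
      have key: "s \<otimes> (inv p0 \<otimes> p) \<otimes> s = p0' \<otimes> inv p'" if p: "p \<in> P" "p' \<in> P" "p \<otimes> s \<otimes> p' = p0 \<otimes> s \<otimes> p0'" for p p'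
      proof -
        have "p \<otimes> s = p0 \<otimes> s \<otimes> p0' \<otimes> inv p'"
          using p p0 s by (metis c inv_solve_right m_closed)
        then have "s \<otimes> (inv p0 \<otimes> p) \<otimes> s = s \<otimes> (inv p0 \<otimes> (p0 \<otimes> (s \<otimes> (p0' \<otimes> inv p'))))"
          using p p0 s by (simp add: m_assoc)
        also have "\<dots> = p0' \<otimes> inv p'" using p p0 s ss by (simp add: inv_solve_left' flip: m_assoc[of "inv p0"])
        finally show ?thesis .
      qed
      show "(\<lambda>(p, p'). inv p0 \<otimes> p) \<in> {(p, p') \<in> P \<times> P. p \<otimes> s \<otimes> p' = p0 \<otimes> s \<otimes> p0'} \<rightarrow> H"
        using p0 key by (auto simp: H_def)
      show "(p0 \<otimes> (case x of (p, p') \<Rightarrow> inv p0 \<otimes> p), inv (s \<otimes> (case x of (p, p') \<Rightarrow> inv p0 \<otimes> p) \<otimes> s) \<otimes> p0') = x"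
        if "x \<in> {(p, p') \<in> P \<times> P. p \<otimes> s \<otimes> p' = p0 \<otimes> s \<otimes> p0'}" for x
        using that p0 key by (auto simp: inv_mult_group m_assoc simp flip: m_assoc[of p0 "inv p0"])
      show "(\<lambda>h. (p0 \<otimes> h, inv (s \<otimes> h \<otimes> s) \<otimes> p0')) \<in> H \<rightarrow> {(p, p') \<in> P \<times> P. p \<otimes> s \<otimes> p' = p0 \<otimes> s \<otimes> p0'}"
      proof
        fix h assume h: "h \<in> H"
        then have hP: "h \<in> P" "s \<otimes> h \<otimes> s \<in> P" by (auto simp: H_def)
        have "inv (s \<otimes> h \<otimes> s) = s \<otimes> (inv h \<otimes> s)" using hP s by (simp add: inv_mult_group s_inv m_assoc)
        then have "p0 \<otimes> h \<otimes> s \<otimes> (inv (s \<otimes> h \<otimes> s) \<otimes> p0') = p0 \<otimes> (h \<otimes> (s \<otimes> (s \<otimes> (inv h \<otimes> (s \<otimes> p0')))))"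
          using hP p0 s by (simp add: m_assoc)
        also have "\<dots> = p0 \<otimes> (h \<otimes> (inv h \<otimes> (s \<otimes> p0')))" using hP p0 s by (simp add: ss)
        also have "\<dots> = p0 \<otimes> s \<otimes> p0'" using hP p0 s by (simp flip: m_assoc)
        finally show "(p0 \<otimes> h, inv (s \<otimes> h \<otimes> s) \<otimes> p0') \<in> {(p, p') \<in> P \<times> P. p \<otimes> s \<otimes> p' = p0 \<otimes> s \<otimes> p0'}"
          using hP p0 by simp
      qed
      show "(case (p0 \<otimes> h, inv (s \<otimes> h \<otimes> s) \<otimes> p0') of (p, p') \<Rightarrow> inv p0 \<otimes> p) = h" if "h \<in> H" for h
        using that p0 by (auto simp: H_def simp flip: m_assoc)
    qed
  qed
  have "card ?S = (\<Sum>x\<in>?S. 1)" by simp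
  also have "\<dots> = (\<Sum>w\<in>{w \<in> D. Q w}. \<Sum>x\<in>{x \<in> ?S. (case x of (p, p') \<Rightarrow> p \<otimes> s \<otimes> p') = w}. 1)"
  proof (rule sum.group[symmetric])
    show "finite ?S" using finP by (auto intro: finite_subset[of _ "P \<times> P"])
    have "D \<subseteq> carrier G" using s by (auto simp: D_def)
    then show "finite {w \<in> D. Q w}" using fin by (auto intro: finite_subset)
  qed (auto simp: D_def)
  also have "\<dots> = (\<Sum>w\<in>{w \<in> D. Q w}. card H)"
  proof (rule sum.cong[OF refl])
    fix w assume "w \<in> {w \<in> D. Q w}"
    then obtain p0 p0' where w: "p0 \<in> P" "p0' \<in> P" "w = p0 \<otimes> s \<otimes> p0'" "Q w" by (auto simp: D_def)
    have "{x \<in> ?S. (case x of (p, p') \<Rightarrow> p \<otimes> s \<otimes> p') = w} = {(p, p') \<in> P \<times> P. p \<otimes> s \<otimes> p' = p0 \<otimes> s \<otimes> p0'}"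
      using w by auto
    then show "(\<Sum>x\<in>{x \<in> ?S. (case x of (p, p') \<Rightarrow> p \<otimes> s \<otimes> p') = w}. 1) = card H"
      using fibre[OF w(1,2)] by simp
  qed
  finally show ?thesis using 1 by simp
qed

section \<open>The ambient matrix group, cyclic invariance of the trace, and the matrix
  sigma\<close>

abbreviation matrix_group :: "nat \<Rightarrow> 'b::field itself \<Rightarrow> 'b mat monoid" where
  "matrix_group N t \<equiv> units_of (ring_mat TYPE('b) N ())"

lemma matrix_group: "group (matrix_group N TYPE('b::field))"
  and carrier_matrix_group: "carrier (matrix_group N TYPE('b)) = GL N"
  and mult_matrix_group: "mult (matrix_group N TYPE('b)) = (*)"
  and one_matrix_group: "one (matrix_group N TYPE('b)) = 1\<^sub>m N"
proof -
  interpret ring "ring_mat TYPE('b) N ()" by (rule ring_mat)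
  show "group (matrix_group N TYPE('b))" by (rule units_group)
  show "carrier (matrix_group N TYPE('b)) = GL N"
  proof (rule equalityI; rule subsetI)
    fix A assume "A \<in> carrier (matrix_group N TYPE('b))"
    then obtain B where "A \<in> carrier_mat N N" "B \<in> carrier_mat N N" "A * B = 1\<^sub>m N"
      by (auto simp: units_of_def Units_def ring_mat_simps)
    then show "A \<in> GL N" by (rule GL_I)
  next
    fix A :: "'b mat" assume "A \<in> GL N"
    then show "A \<in> carrier (matrix_group N TYPE('b))"
      using det_non_zero_imp_unit[of A N "()"] by (simp add: units_of_def GL_def)
  qed
qed (auto simp: units_of_def ring_mat_simps)

lemma mat_trace_mult_comm:
  fixes A B :: "'b::comm_semiring_0 mat"
  assumes "A \<in> carrier_mat n n" "B \<in> carrier_mat n n"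
  shows "mat_trace (A * B) = mat_trace (B * A)"
proof -
  have "mat_trace (A * B) = (\<Sum>i<n. \<Sum>k<n. A $$ (i, k) * B $$ (k, i))"
    using assms by (auto simp: mat_trace_def scalar_prod_def lessThan_atLeast0 intro!: sum.cong)
  also have "\<dots> = (\<Sum>k<n. \<Sum>i<n. B $$ (k, i) * A $$ (i, k))"
    by (subst sum.swap) (simp add: mult.commute)
  also have "\<dots> = mat_trace (B * A)"
    using assms by (auto simp: mat_trace_def scalar_prod_def lessThan_atLeast0 intro!: sum.cong)
  finally show ?thesis .
qed

text \<open>The involution of the indices whose permutation matrix is \<open>sigma_plus n s\<close>;
  multiplying by that matrix on either side then only renames indices.\<close>

definition sigma_perm :: "nat \<Rightarrow> nat \<Rightarrow> nat \<Rightarrow> nat" where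
  "sigma_perm n s i = (if i < s then i + n else if n \<le> i \<and> i < n + s then i - n else i)"

lemma sigma_perm:
  assumes "s \<le> n"
  shows "sigma_perm n s (sigma_perm n s i) = i" "sigma_perm n s i < n + n \<longleftrightarrow> i < n + n"
  using assms by (auto simp: sigma_perm_def)

lemma sigma_plus_carrier [simp]: "s \<le> n \<Longrightarrow> sigma_plus n s \<in> carrier_mat (n + n) (n + n)"
  unfolding sigma_plus_def Let_def by (intro carrier_matI) simp_all

lemma sigma_plus_index:
  assumes "s \<le> n" "i < n + n" "j < n + n"
  shows "sigma_plus n s $$ (i, j) = (if j = sigma_perm n s i then 1 else 0 :: 'b::field)"
proof -
  define D :: "'b mat" where "D = four_block_mat (0\<^sub>m s s) (0\<^sub>m s (n - s)) (0\<^sub>m (n - s) s) (1\<^sub>m (n - s))"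
  define E :: "'b mat" where "E = four_block_mat (1\<^sub>m s) (0\<^sub>m s (n - s)) (0\<^sub>m (n - s) s) (0\<^sub>m (n - s) (n - s))"
  have dim: "dim_row D = n" "dim_col D = n" "dim_row E = n" "dim_col E = n"
    using assms(1) by (simp_all add: D_def E_def)
  have D: "D $$ (i, j) = (if i = j \<and> s \<le> i then 1 else 0)" if "i < n" "j < n" for i j
    using that assms(1) by (auto simp: D_def)
  have E: "E $$ (i, j) = (if i = j \<and> i < s then 1 else 0)" if "i < n" "j < n" for i j
    using that assms(1) by (auto simp: E_def)
  have \<sigma>: "sigma_plus n s = four_block_mat D E E D"
    by (simp add: sigma_plus_def D_def E_def Let_def)
  show ?thesis
  proof (cases "i < n")
    case True
    then show ?thesis using assms by (cases "j < n") (auto simp: \<sigma> dim D E sigma_perm_def)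
  next
    case False
    then obtain i' where i': "i = n + i'" "i' < n" using assms(2) by (metis add_less_cancel_left le_Suc_ex not_less)
    have p: "sigma_perm n s i = (if i' < s then i' else i)" using i' assms(1) by (simp add: sigma_perm_def)
    show ?thesis
    proof (cases "j < n")
      case True
      then show ?thesis unfolding p using i' assms(1) by (simp add: \<sigma> dim E)
    next
      case False
      then obtain j' where "j = n + j'" "j' < n" using assms(3) by (metis add_less_cancel_left le_Suc_ex not_less)
      then show ?thesis unfolding p using i' assms(1) by (simp add: \<sigma> dim D)
    qed
  qed
qed

lemma mult_sigma_plus:
  assumes s: "s \<le> n" and A: "A \<in> carrier_mat (n + n) (n + n)" and ij: "i < n + n" "j < n + n"
  shows "(A * sigma_plus n s) $$ (i, j) = (A $$ (i, sigma_perm n s j) :: 'b::field)"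
    and "(sigma_plus n s * A) $$ (i, j) = A $$ (sigma_perm n s i, j)"
proof -
  have eq: "j = sigma_perm n s k \<longleftrightarrow> k = sigma_perm n s j" for j k
    using sigma_perm(1)[OF s] by metis
  note lt = sigma_perm(2)[OF s]
  have "(A * sigma_plus n s) $$ (i, j) = (\<Sum>k\<in>{0..<n + n}. A $$ (i, k) * sigma_plus n s $$ (k, j))"
    using A ij sigma_plus_carrier[OF s, where 'a='b] by (auto simp: scalar_prod_def)
  also have "\<dots> = (\<Sum>k\<in>{0..<n + n}. if k = sigma_perm n s j then A $$ (i, k) else 0)"
    using ij by (intro sum.cong) (auto simp: sigma_plus_index[OF s] eq[of j])
  finally show "(A * sigma_plus n s) $$ (i, j) = A $$ (i, sigma_perm n s j)" using ij lt by simp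
  have "(sigma_plus n s * A) $$ (i, j) = (\<Sum>k\<in>{0..<n + n}. sigma_plus n s $$ (i, k) * A $$ (k, j))"
    using A ij sigma_plus_carrier[OF s, where 'a='b] by (auto simp: scalar_prod_def)
  also have "\<dots> = (\<Sum>k\<in>{0..<n + n}. if k = sigma_perm n s i then A $$ (k, j) else 0)"
    using ij by (intro sum.cong) (auto simp: sigma_plus_index[OF s])
  finally show "(sigma_plus n s * A) $$ (i, j) = A $$ (sigma_perm n s i, j)" using ij lt by simp
qed

lemma sigma_plus_square:
  assumes s: "s \<le> n"
  shows "sigma_plus n s * sigma_plus n s = (1\<^sub>m (n + n) :: 'b::field mat)"
proof (rule eq_matI)
  fix i j assume "i < dim_row (1\<^sub>m (n + n) :: 'b mat)" "j < dim_col (1\<^sub>m (n + n) :: 'b mat)"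
  then show "(sigma_plus n s * sigma_plus n s) $$ (i, j) = (1\<^sub>m (n + n) :: 'b mat) $$ (i, j)"
    using sigma_perm[OF s] by (auto simp: mult_sigma_plus[OF s sigma_plus_carrier[OF s]] sigma_plus_index[OF s])
      (metis sigma_perm(1)[OF s])+
qed (use sigma_plus_carrier[OF s, where 'a='b] in auto)

lemma sigma_plus_GL: "s \<le> n \<Longrightarrow> sigma_plus n s \<in> (GL (n + n) :: 'b::field mat set)"
  by (rule GL_I[OF sigma_plus_carrier sigma_plus_carrier sigma_plus_square])

section \<open>The orthogonal group and its parabolic subgroup\<close>

definition hyperbolic :: "nat \<Rightarrow> 'b::field mat" where
  "hyperbolic n = four_block_mat (0\<^sub>m n n) (1\<^sub>m n) (0\<^sub>m n n) (0\<^sub>m n n)"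

lemma hyperbolic_carrier [simp]: "hyperbolic n \<in> carrier_mat (n + n) (n + n)"
  by (simp add: hyperbolic_def)

lemma hyperbolic_index:
  "i < n + n \<Longrightarrow> j < n + n \<Longrightarrow> hyperbolic n $$ (i, j) = (if j = i + n then 1 else 0)"
  unfolding hyperbolic_def by auto

text \<open>In characteristic 2, \<open>g\<close> preserves \<open>\<theta>(x) = x\<^sup>T J x\<close> iff \<open>g\<^sup>T J g + J\<close> is alternating.\<close>
definition orth :: "nat \<Rightarrow> 'b::field mat set" where
  "orth n = {g \<in> carrier_mat (n + n) (n + n).
     transpose_mat g * hyperbolic n * g + hyperbolic n \<in> alternating_mats (n + n)}"

lemma triple_mult_index:
  fixes g h N :: "'b::comm_semiring_0 mat"
  assumes "g \<in> carrier_mat n k" "N \<in> carrier_mat n n" "h \<in> carrier_mat n l" "i < k" "j < l"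
  shows "(transpose_mat g * N * h) $$ (i, j) = (\<Sum>a<n. \<Sum>b<n. g $$ (a, i) * N $$ (a, b) * h $$ (b, j))"
proof -
  have "(transpose_mat g * N * h) $$ (i, j) = (transpose_mat g * (N * h)) $$ (i, j)"
    using assms by (simp add: assoc_mult_mat[of _ k n _ n _ l])
  also have "\<dots> = (\<Sum>a<n. g $$ (a, i) * (\<Sum>b<n. N $$ (a, b) * h $$ (b, j)))"
    using assms by (auto simp: scalar_prod_def lessThan_atLeast0 intro!: sum.cong)
  finally show ?thesis by (simp add: sum_distrib_left mult.assoc)
qed

text \<open>The two factors in \<open>P_plus\<close> multiplied out. Since the pair
  \<open>(A, B)\<close> is determined by the product, counts over the parabolic subgroup become
  counts of pairs.\<close>

definition pmat :: "'b::field mat \<Rightarrow> 'b mat \<Rightarrow> 'b mat" where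
  "pmat A B = four_block_mat A (A * B) (0\<^sub>m (dim_row A) (dim_row A)) (transpose_mat (minv A))"

lemma P_plus_pmat: "P_plus n = (\<lambda>(A, B). pmat A B) ` (GL n \<times> alternating_mats n)"
proof -
  have prod: "four_block_mat A (0\<^sub>m n n) (0\<^sub>m n n) (transpose_mat (minv A)) *
      four_block_mat (1\<^sub>m n) B (0\<^sub>m n n) (1\<^sub>m n) = pmat A B"
    if "A \<in> GL n" "B \<in> carrier_mat n n" for A B :: "'a mat"
    using that GL_carrier[OF that(1)] minv[OF that(1)] unfolding pmat_def
    by (subst mult_four_block_mat[of _ n n _ n _ n]) auto
  have car: "B \<in> carrier_mat n n" if "B \<in> alternating_mats n" for B :: "'a mat"
    using that by (simp add: alternating_mats_def)
  show ?thesis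
  proof (intro equalityI subsetI)
    fix g :: "'a mat" assume "g \<in> P_plus n"
    then obtain A A' B where g: "g = four_block_mat A (0\<^sub>m n n) (0\<^sub>m n n) (transpose_mat A') *
        four_block_mat (1\<^sub>m n) B (0\<^sub>m n n) (1\<^sub>m n)"
      "A \<in> carrier_mat n n" "A' \<in> carrier_mat n n" "inverts_mat A A'" "B \<in> alternating_mats n"
      by (auto simp: P_plus_def)
    have 1: "A * A' = 1\<^sub>m n" using g by (auto simp: inverts_mat_def)
    then have A: "A \<in> GL n" using GL_I g by blast
    then have "A' = minv A" using minv_unique[OF A g(3)] 1 by simp
    then have "g = pmat A B" using prod[OF A car[OF g(5)]] g(1) by simp
    then show "g \<in> (\<lambda>(A, B). pmat A B) ` (GL n \<times> alternating_mats n)" using A g(5) by auto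
  next
    fix g :: "'a mat" assume "g \<in> (\<lambda>(A, B). pmat A B) ` (GL n \<times> alternating_mats n)"
    then obtain A B where g: "g = pmat A B" "A \<in> GL n" "B \<in> alternating_mats n" by auto
    moreover have "inverts_mat A (minv A)" "inverts_mat (minv A) A"
      using minv[OF g(2)] GL_carrier[OF g(2)] by (auto simp: inverts_mat_def)
    ultimately show "g \<in> P_plus n"
      unfolding P_plus_def using prod[OF g(2) car[OF g(3)], symmetric] minv(1)[OF g(2)] GL_carrier[OF g(2)]
      by blast
  qed
qed

lemma pmat_inj: "inj_on (\<lambda>(A, B). pmat A B) (GL n \<times> alternating_mats n)"
proof (rule inj_onI, clarify)
  fix A A' B B' :: "'a mat"
  assume h: "A \<in> GL n" "A' \<in> GL n" "B \<in> alternating_mats n" "B' \<in> alternating_mats n" "pmat A B = pmat A' B'"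
  then have c: "A \<in> carrier_mat n n" "A' \<in> carrier_mat n n" "B \<in> carrier_mat n n" "B' \<in> carrier_mat n n"
    by (auto simp: GL_def alternating_mats_def)
  have 1: "A = A'" "A * B = A' * B'"
    using h(5) c minv(1)[OF h(1)] minv(1)[OF h(2)] unfolding pmat_def
    by (auto dest: four_block_inj[where m=n and k=n and n=n and l=n])
  then have "B = B'" using minv_cancel(1)[OF h(1) c(3)] minv_cancel(1)[OF h(1) c(4)] by simp
  then show "A = A' \<and> B = B'" using 1 by simp
qed

lemma alternating_matsI:
  assumes "M \<in> carrier_mat n n" "\<And>i j. i < n \<Longrightarrow> j < n \<Longrightarrow> M $$ (i, j) = M $$ (j, i)"
    "\<And>i. i < n \<Longrightarrow> M $$ (i, i) = 0"
  shows "M \<in> alternating_mats n"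
  using assms by (auto simp: alternating_mats_def intro!: eq_matI)

context binary_field
begin

text \<open>The terms at \<open>(a, b)\<close> and \<open>(b, a)\<close> cancel in characteristic
  2.\<close>

lemma sum_symmetric_zero_diagonal:
  fixes f :: "nat \<Rightarrow> nat \<Rightarrow> 'a"
  assumes "\<And>a b. a < n \<Longrightarrow> b < n \<Longrightarrow> f a b = f b a" "\<And>a. a < n \<Longrightarrow> f a a = 0"
  shows "(\<Sum>a<n. \<Sum>b<n. f a b) = 0"
  using assms
proof (induction n)
  case (Suc n)
  have "(\<Sum>a<n. f a n) = (\<Sum>b<n. f n b)" using Suc.prems by (intro sum.cong) auto
  then show ?case using Suc by (simp add: sum.distrib add.assoc)
qed simp

lemma alternating_congruence:
  fixes N h :: "'a mat"
  assumes N: "N \<in> alternating_mats n" and h: "h \<in> carrier_mat n k"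
  shows "transpose_mat h * N * h \<in> alternating_mats k"
proof -
  have Nc: "N \<in> carrier_mat n n" "transpose_mat N = N" "\<And>i. i < n \<Longrightarrow> N $$ (i, i) = 0"
    using N by (auto simp: alternating_mats_def)
  have Ns: "N $$ (a, b) = N $$ (b, a)" if "a < n" "b < n" for a b
    using arg_cong[OF Nc(2), of "\<lambda>M. M $$ (a, b)"] that Nc(1) by simp
  have ix: "(transpose_mat h * N * h) $$ (i, j) = (\<Sum>a<n. \<Sum>b<n. h $$ (a, i) * N $$ (a, b) * h $$ (b, j))"
    if "i < k" "j < k" for i j using triple_mult_index[OF h Nc(1) h that] .
  have sym: "(transpose_mat h * N * h) $$ (i, j) = (transpose_mat h * N * h) $$ (j, i)" if "i < k" "j < k" for i j
  proof -
    have "(transpose_mat h * N * h) $$ (i, j) = (\<Sum>b<n. \<Sum>a<n. h $$ (a, i) * N $$ (a, b) * h $$ (b, j))"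
      unfolding ix[OF that] by (rule sum.swap)
    also have "\<dots> = (\<Sum>b<n. \<Sum>a<n. h $$ (b, j) * N $$ (b, a) * h $$ (a, i))"
      using Ns by (intro sum.cong) (auto simp: mult_ac)
    finally show ?thesis using ix[OF that(2,1)] by simp
  qed
  have "(transpose_mat h * N * h) $$ (i, i) = 0" if "i < k" for i
    unfolding ix[OF that that] using Ns Nc(3) by (intro sum_symmetric_zero_diagonal) (auto simp: mult_ac)
  moreover have c: "transpose_mat h * N * h \<in> carrier_mat k k" using Nc h by auto
  ultimately show ?thesis using sym by (intro alternating_matsI)
qed

lemma alternating_add:
  fixes M N :: "'a mat"
  assumes "M \<in> alternating_mats n" "N \<in> alternating_mats n"
  shows "M + N \<in> alternating_mats n"
  using assms transpose_add[of M n n N] by (auto simp: alternating_mats_def)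

text \<open>\<open>(g h)^T J (g h) + J\<close> is the sum of \<open>h^T (g^T J g + J) h\<close> and
  \<open>h^T J h + J\<close>, where the two copies of \<open>h^T J h\<close> cancel. Closure under
  products suffices: in the parabolic subgroup inverses come from finiteness.\<close>

lemma orth_mult:
  fixes g h :: "'a mat"
  assumes g: "g \<in> orth n" and h: "h \<in> orth n"
  shows "g * h \<in> orth n"
proof -
  let ?N = "n + n" and ?J = "hyperbolic n :: 'a mat"
  let ?X = "transpose_mat g * ?J * g"
  have c: "g \<in> carrier_mat ?N ?N" "h \<in> carrier_mat ?N ?N" "transpose_mat g \<in> carrier_mat ?N ?N"
    "transpose_mat h \<in> carrier_mat ?N ?N" "?J \<in> carrier_mat ?N ?N"
    using g h by (auto simp: orth_def)
  have X: "?X \<in> carrier_mat ?N ?N" using c by auto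
  have "transpose_mat h * (?X + ?J) * h + (transpose_mat h * ?J * h + ?J) \<in> alternating_mats ?N"
  proof (rule alternating_add)
    show "transpose_mat h * (?X + ?J) * h \<in> alternating_mats ?N"
      using g by (intro alternating_congruence[OF _ c(2)]) (simp add: orth_def)
    show "transpose_mat h * ?J * h + ?J \<in> alternating_mats ?N" using h by (simp add: orth_def)
  qed
  moreover have "transpose_mat h * (?X + ?J) * h = transpose_mat h * ?X * h + transpose_mat h * ?J * h"
    using c X by (simp add: mult_add_distrib_mat[of _ ?N ?N _ ?N] add_mult_distrib_mat[of _ ?N ?N _ _ ?N])
  moreover have "transpose_mat h * ?X * h + transpose_mat h * ?J * h + (transpose_mat h * ?J * h + ?J) = transpose_mat h * ?X * h + ?J"
  proof -
    have "Y + Z + (Z + J) = Y + J" if "Y \<in> carrier_mat ?N ?N" "Z \<in> carrier_mat ?N ?N" "J \<in> carrier_mat ?N ?N"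
      for Y Z J :: "'a mat"
      using that by (intro eq_matI) (auto simp: add.assoc)
    then show ?thesis using c X by (meson mult_carrier_mat)
  qed
  moreover have "transpose_mat (g * h) * ?J * (g * h) = transpose_mat h * ?X * h"
  proof -
    have TJ: "transpose_mat g * ?J \<in> carrier_mat ?N ?N" and gh: "g * h \<in> carrier_mat ?N ?N"
      by (intro mult_carrier_mat[of _ ?N ?N] c)+
    show ?thesis
      unfolding transpose_mult[OF c(1,2)] assoc_mult_mat[OF c(4,3,5)] assoc_mult_mat[OF c(4) TJ gh]
        assoc_mult_mat[OF TJ c(1,2), symmetric] assoc_mult_mat[OF c(4) X c(2)] ..
  qed
  ultimately show ?thesis using c by (simp add: orth_def)
qed

text \<open>Conjugation by sigma moves the entry of \<open>J\<close> at \<open>(i, i + n)\<close> to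
  the transposed place for \<open>i < s\<close> and fixes it otherwise. Adding \<open>J\<close> thus
  leaves a symmetric matrix with zero diagonal.\<close>

lemma sigma_plus_orth:
  assumes s: "s \<le> n"
  shows "sigma_plus n s \<in> (orth n :: 'a mat set)"
proof -
  let ?\<sigma> = "sigma_plus n s :: 'a mat" and ?J = "hyperbolic n :: 'a mat" and ?\<pi> = "sigma_perm n s"
  note c = sigma_plus_carrier[OF s, where 'a='a] hyperbolic_carrier[of n, where 'a='a]
  have t: "transpose_mat ?\<sigma> = ?\<sigma>"
    using c sigma_perm[OF s] by (intro eq_matI) (auto simp: sigma_plus_index[OF s])
  have ix: "(?\<sigma> * ?J * ?\<sigma> + ?J) $$ (i, j) =
      (if ?\<pi> j = ?\<pi> i + n then 1 else 0) + (if j = i + n then 1 else 0)" if "i < n + n" "j < n + n" for i j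
  proof -
    have "?\<sigma> * ?J \<in> carrier_mat (n + n) (n + n)" using c by auto
    then show ?thesis
      using that c sigma_perm(2)[OF s]
      by (simp add: mult_sigma_plus[OF s] hyperbolic_index carrier_matD[OF c(2)] del: index_mult_mat(1))
  qed
  have "(?\<sigma> * ?J * ?\<sigma> + ?J) $$ (i, j) = (?\<sigma> * ?J * ?\<sigma> + ?J) $$ (j, i)" if "i < n + n" "j < n + n" for i j
    unfolding ix[OF that] ix[OF that(2,1)] using that s by (auto simp: sigma_perm_def split: if_splits)
  moreover have "(?\<sigma> * ?J * ?\<sigma> + ?J) $$ (i, i) = 0" if "i < n + n" for i
    unfolding ix[OF that that] using that s by (auto simp: sigma_perm_def)
  moreover have "?\<sigma> * ?J * ?\<sigma> + ?J \<in> carrier_mat (n + n) (n + n)" by (intro add_carrier_mat c)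
  ultimately have "?\<sigma> * ?J * ?\<sigma> + ?J \<in> alternating_mats (n + n)"
    by (intro alternating_matsI)
  then show ?thesis unfolding orth_def mem_Collect_eq t using c by blast
qed

end

section \<open>The trace of p sigma as a function of A and B\<close>

lemma minv_lower_block:
  fixes A D W :: "'b::field mat"
  assumes A: "A \<in> GL m" and D: "D \<in> GL n" and W: "W \<in> carrier_mat n m"
  shows "minv (four_block_mat A (0\<^sub>m m n) W D) = four_block_mat (minv A) (0\<^sub>m m n) (- (minv D * W * minv A)) (minv D)"
proof -
  note c = GL_carrier[OF A] GL_carrier[OF D] minv[OF A] minv[OF D] W
  have X: "minv D * W * minv A \<in> carrier_mat n m" using c by auto
  have "D * (minv D * W * minv A) = W * minv A"
    using c minv_cancel(2)[OF D, of "W * minv A" m] by (simp add: assoc_mult_mat[of _ n n _ m _ m])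
  moreover have "D * (- Y) = - (D * Y)" if "Y \<in> carrier_mat n m" for Y
    using c that by (simp add: uminus_mult_right_mat)
  ultimately have "W * minv A + D * (- (minv D * W * minv A)) = 0\<^sub>m n m"
    using X c by (intro eq_matI) auto
  then have "four_block_mat A (0\<^sub>m m n) W D * four_block_mat (minv A) (0\<^sub>m m n) (- (minv D * W * minv A)) (minv D) = 1\<^sub>m (m + n)"
  proof -
    have "1\<^sub>m m + - 0\<^sub>m m m = (1\<^sub>m m :: 'b mat)" by (intro eq_matI) auto
    then show ?thesis using c X \<open>W * minv A + D * (- (minv D * W * minv A)) = 0\<^sub>m n m\<close>
      by (subst mult_four_block_mat[of _ m m _ n _ n _ _ m _ n]) auto
  qed
  moreover have "four_block_mat A (0\<^sub>m m n) W D \<in> carrier_mat (m + n) (m + n)"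
    "four_block_mat (minv A) (0\<^sub>m m n) (- (minv D * W * minv A)) (minv D) \<in> carrier_mat (m + n) (m + n)"
    using c X by auto
  ultimately show ?thesis using GL_I minv_unique by blast
qed

text \<open>The part of \<open>Tr (p sigma)\<close> that is free of \<open>B\<close>;
  \<open>head_form\<close> below is the part linear in \<open>B\<close>.\<close>

definition tail_trace :: "nat \<Rightarrow> nat \<Rightarrow> 'b::field mat \<Rightarrow> 'b" where
  "tail_trace s n A = (\<Sum>i\<in>{s..<n}. A $$ (i, i) + minv A $$ (i, i))"

definition head_form :: "nat \<Rightarrow> 'b::field mat \<Rightarrow> 'b mat \<Rightarrow> 'b" where
  "head_form s A B = (\<Sum>i<s. (A * B) $$ (i, i))"

lemma tail_trace_lower_block:
  fixes A D W :: "'b::field mat"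
  assumes A: "A \<in> GL s" and D: "D \<in> GL t" and W: "W \<in> carrier_mat t s"
  shows "tail_trace s (s + t) (four_block_mat A (0\<^sub>m s t) W D) = mat_trace D + mat_trace (minv D)"
proof -
  note c = GL_carrier[OF A] GL_carrier[OF D] minv(1)[OF A] minv(1)[OF D] W
  have "tail_trace s (s + t) (four_block_mat A (0\<^sub>m s t) W D) = (\<Sum>i<t. D $$ (i, i) + minv D $$ (i, i))"
    unfolding tail_trace_def minv_lower_block[OF assms]
    by (rule sum.reindex_bij_witness[where i="\<lambda>i. i + s" and j="\<lambda>i. i - s"]) (use c in auto)
  then show ?thesis using c by (simp add: mat_trace_def sum.distrib)
qed

lemma head_form_eq:
  assumes "A \<in> carrier_mat n n" "B \<in> carrier_mat n n" "s \<le> n"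
  shows "head_form s A B = (\<Sum>i<s. \<Sum>k<n. A $$ (i, k) * B $$ (k, i))"
  using assms by (auto simp: head_form_def scalar_prod_def lessThan_atLeast0 intro!: sum.cong)

lemma pmat_index:
  fixes A B :: "'b::field mat"
  assumes A: "A \<in> GL n" and B: "B \<in> carrier_mat n n"
  shows "\<And>i j. i < n \<Longrightarrow> j < n \<Longrightarrow> pmat A B $$ (i, j) = A $$ (i, j)"
    "\<And>i j. i < n \<Longrightarrow> j < n \<Longrightarrow> pmat A B $$ (i, n + j) = (A * B) $$ (i, j)"
    "\<And>i j. i < n \<Longrightarrow> j < n \<Longrightarrow> pmat A B $$ (n + i, j) = 0"
    "\<And>i j. i < n \<Longrightarrow> j < n \<Longrightarrow> pmat A B $$ (n + i, n + j) = minv A $$ (j, i)"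
    "pmat A B \<in> carrier_mat (n + n) (n + n)"
  using GL_carrier[OF A] minv(1)[OF A] B unfolding pmat_def by auto

lemma sum_lessThan_add: "(\<Sum>i<m + n. f i) = (\<Sum>i<m. f i) + (\<Sum>i<n. f (m + i) :: 'b::comm_monoid_add)" for m n :: nat
  by (induction n) (auto simp: add.assoc)

text \<open>Sigma permutes columns, so the trace collects the entries at
  \<open>(i, sigma_perm n s i)\<close>. In the index ranges of lengths \<open>s\<close>,
  \<open>t\<close>, \<open>s\<close>, \<open>t\<close> these are diagonal entries of
  \<open>A * B\<close>, of \<open>A\<close>, of the zero block and of \<open>minv A\<close>.\<close>

lemma mat_trace_pmat_sigma:
  fixes A B :: "'b::field mat"
  assumes A: "A \<in> GL (s + t)" and B: "B \<in> carrier_mat (s + t) (s + t)"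
  shows "mat_trace (pmat A B * sigma_plus (s + t) s) = head_form s A B + tail_trace s (s + t) A"
proof -
  define n where "n = s + t"
  note p = pmat_index[OF A B, folded n_def]
  have s: "s \<le> n" by (simp add: n_def)
  let ?f = "\<lambda>i. pmat A B $$ (i, sigma_perm n s i)"
  have "mat_trace (pmat A B * sigma_plus n s) = (\<Sum>i<n + n. ?f i)"
    unfolding mat_trace_def using p(5) by (intro sum.cong) (auto simp: mult_sigma_plus[OF s p(5)] simp del: index_mult_mat(1))
  also have "\<dots> = (\<Sum>i<s. ?f i) + (\<Sum>i<t. ?f (s + i)) + (\<Sum>i<s. ?f (n + i)) + (\<Sum>i<t. ?f (n + s + i))"
    unfolding sum_lessThan_add[of _ n n] by (simp add: n_def sum_lessThan_add add.assoc)
  also have "(\<Sum>i<s. ?f i) = head_form s A B" unfolding head_form_def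
    using s by (intro sum.cong) (auto simp: sigma_perm_def p add.commute[of _ n] simp del: index_mult_mat(1))
  also have "(\<Sum>i<s. ?f (n + i)) = 0" using s by (intro sum.neutral) (auto simp: sigma_perm_def p)
  also have "(\<Sum>i<t. ?f (s + i)) = (\<Sum>i\<in>{s..<n}. A $$ (i, i))"
    by (rule sum.reindex_bij_witness[where j="\<lambda>i. s + i" and i="\<lambda>i. i - s"]) (auto simp: sigma_perm_def p n_def p[unfolded n_def])
  also have "(\<Sum>i<t. ?f (n + s + i)) = (\<Sum>i\<in>{s..<n}. minv A $$ (i, i))"
    using p(4) s
    by (intro sum.reindex_bij_witness[where j="\<lambda>i. s + i" and i="\<lambda>i. i - s"])
      (auto simp: sigma_perm_def n_def add.assoc)
  finally show ?thesis by (simp add: n_def tail_trace_def sum.distrib)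
qed

lemma alternating_mats_sym:
  "B \<in> alternating_mats n \<Longrightarrow> i < n \<Longrightarrow> j < n \<Longrightarrow> B $$ (i, j) = B $$ (j, i)"
  unfolding alternating_mats_def by (metis (mono_tags, lifting) carrier_matD index_transpose_mat(1) mem_Collect_eq)

context binary_field
begin

lemma orth_upper_iff:
  fixes A C F :: "'a mat"
  assumes c: "A \<in> carrier_mat n n" "C \<in> carrier_mat n n" "F \<in> carrier_mat n n"
  shows "four_block_mat A C (0\<^sub>m n n) F \<in> orth n \<longleftrightarrow>
    transpose_mat A * F = 1\<^sub>m n \<and> transpose_mat C * F \<in> alternating_mats n"
proof -
  let ?g = "four_block_mat A C (0\<^sub>m n n) F" and ?J = "hyperbolic n :: 'a mat"
  have g: "?g \<in> carrier_mat (n + n) (n + n)" using c by auto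
  have tg: "transpose_mat ?g = four_block_mat (transpose_mat A) (0\<^sub>m n n) (transpose_mat C) (transpose_mat F)"
    using c by (subst transpose_four_block_mat[of _ n n _ n _ n]) auto
  have AF: "transpose_mat A * F \<in> carrier_mat n n" "transpose_mat C * F \<in> carrier_mat n n" using c by auto
  have "transpose_mat ?g * ?J = four_block_mat (0\<^sub>m n n) (transpose_mat A) (0\<^sub>m n n) (transpose_mat C)"
    unfolding tg hyperbolic_def using c by (subst mult_four_block_mat[of _ n n _ n _ n _ _ n _ n]) auto
  then have "transpose_mat ?g * ?J * ?g = four_block_mat (0\<^sub>m n n) (transpose_mat A * F) (0\<^sub>m n n) (transpose_mat C * F)"
    using c AF by (simp, subst mult_four_block_mat[of _ n n _ n _ n _ _ n _ n]) auto
  then have "transpose_mat ?g * ?J * ?g + ?J = four_block_mat (0\<^sub>m n n) (transpose_mat A * F + 1\<^sub>m n) (0\<^sub>m n n) (transpose_mat C * F)"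
    using AF unfolding hyperbolic_def by (simp, subst add_four_block_mat[of _ n n _ n _ n]) auto
  moreover have "four_block_mat (0\<^sub>m n n) (transpose_mat A * F + 1\<^sub>m n) (0\<^sub>m n n) (transpose_mat C * F) \<in> alternating_mats (n + n)
     \<longleftrightarrow> transpose_mat A * F + 1\<^sub>m n = 0\<^sub>m n n \<and> transpose_mat C * F \<in> alternating_mats n"
    using AF by (subst four_block_alternating_iff) (auto simp: alternating_mats_def)
  moreover have "transpose_mat A * F + 1\<^sub>m n = 0\<^sub>m n n \<longleftrightarrow> transpose_mat A * F = 1\<^sub>m n"
  proof -
    have "M + 1\<^sub>m n = 0\<^sub>m n n \<longleftrightarrow> M = 1\<^sub>m n" if M: "M \<in> carrier_mat n n" for M :: "'a mat"
    proof
      assume "M + 1\<^sub>m n = 0\<^sub>m n n"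
      then have "(M + 1\<^sub>m n) $$ (i, j) = 0" if "i < n" "j < n" for i j using that by simp
      then show "M = 1\<^sub>m n" using M by (intro eq_matI) (auto simp: add_eq_0 split: if_splits)
    next
      assume "M = 1\<^sub>m n"
      then show "M + 1\<^sub>m n = 0\<^sub>m n n" by (auto intro!: eq_matI)
    qed
    then show ?thesis using AF by blast
  qed
  ultimately show ?thesis using g by (simp add: orth_def)
qed

text \<open>This reduces membership for a matrix already known to be orthogonal, such as a conjugate
  of \<open>p\<close> by sigma, to inspecting its lower left block.\<close>

lemma P_plus_orth:
  "P_plus n = {g \<in> orth n. \<forall>i<n. \<forall>j<n. g $$ (n + i, j) = (0::'a)}"
proof (intro equalityI subsetI)
  fix g :: "'a mat" assume "g \<in> P_plus n"
  then obtain A B where g: "g = pmat A B" "A \<in> GL n" "B \<in> alternating_mats n"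
    by (auto simp: P_plus_pmat)
  have B: "B \<in> carrier_mat n n" "transpose_mat B = B" using g(3) by (auto simp: alternating_mats_def)
  note c = GL_carrier[OF g(2)] minv[OF g(2)]
  have "transpose_mat A * transpose_mat (minv A) = 1\<^sub>m n"
    unfolding transpose_mult[OF c(2,1), symmetric] c(4) by simp
  moreover have "A * B \<in> carrier_mat n n" using c B by auto
  then have "transpose_mat (A * B) * transpose_mat (minv A) = B"
    using transpose_mult[OF c(2), of "A * B" n] minv_cancel(1)[OF g(2) B(1)] B(2) by simp
  ultimately have "g \<in> orth n"
    unfolding g(1) pmat_def using c B g(3) by (simp add: orth_upper_iff)
  then show "g \<in> {g \<in> orth n. \<forall>i<n. \<forall>j<n. g $$ (n + i, j) = 0}"
    using pmat_index(3)[OF g(2) B(1)] by (simp add: g(1))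
next
  fix g :: "'a mat" assume g: "g \<in> {g \<in> orth n. \<forall>i<n. \<forall>j<n. g $$ (n + i, j) = 0}"
  then have "g \<in> carrier_mat (n + n) (n + n)" by (simp add: orth_def)
  then obtain A C G F where b: "g = four_block_mat A C G F" "A \<in> carrier_mat n n" "C \<in> carrier_mat n n"
    "G \<in> carrier_mat n n" "F \<in> carrier_mat n n" by (rule four_block_cases)
  have "G $$ (i, j) = 0" if "i < n" "j < n" for i j
    using g b that by auto
  then have "G = 0\<^sub>m n n" using b by (intro eq_matI) auto
  then have o: "transpose_mat A * F = 1\<^sub>m n" "transpose_mat C * F \<in> alternating_mats n"
    using g b orth_upper_iff[OF b(2,3,5)] by auto
  have tF: "transpose_mat F \<in> carrier_mat n n" using b by simp
  have FA: "transpose_mat F * A = 1\<^sub>m n"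
    using arg_cong[OF o(1), of transpose_mat] transpose_mult[of "transpose_mat A" n n F n] b by simp
  then have "det (transpose_mat F) * det A = 1" using det_mult[OF tF b(2)] by simp
  then have A: "A \<in> GL n" using b(2) by (auto simp: GL_def)
  have m: "minv A = transpose_mat F" using minv_unique[OF A tF] FA by simp
  have "transpose_mat (transpose_mat C * F) = transpose_mat F * C"
    using transpose_mult[of "transpose_mat C" n n F n] b by simp
  then have B: "minv A * C \<in> alternating_mats n" using o(2) m by (simp add: alternating_mats_def)
  have "g = pmat A (minv A * C)"
    unfolding pmat_def minv_cancel(2)[OF A b(3)] using b m \<open>G = 0\<^sub>m n n\<close> by simp
  then show "g \<in> P_plus n" using A B by (auto simp: P_plus_pmat)
qed

lemma P_plus_GL: "P_plus n \<subseteq> (GL (n + n) :: 'a mat set)"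
proof
  fix g :: "'a mat" assume "g \<in> P_plus n"
  then obtain A B where g: "g = pmat A B" "A \<in> GL n" "B \<in> carrier_mat n n"
    by (auto simp: P_plus_pmat alternating_mats_def)
  note c = GL_carrier[OF g(2)] minv[OF g(2)] transpose_GL[OF minv_GL[OF g(2)]]
  have "det g = det A * det (transpose_mat (minv A))"
    unfolding g(1) pmat_def using c g by (intro det_four_block_mat_lower_left_zero) auto
  then show "g \<in> GL (n + n)" using c g pmat_index(5)[OF g(2,3)] by (auto simp: GL_def)
qed

lemma P_plus_subgroup: "subgroup (P_plus n) (matrix_group (n + n) TYPE('a))"
proof -
  interpret group "matrix_group (n + n) TYPE('a)" by (rule matrix_group)
  show ?thesis
  proof (rule finite_submonoid_subgroup, unfold carrier_matrix_group mult_matrix_group one_matrix_group)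
    show "P_plus n \<subseteq> (GL (n + n) :: 'a mat set)" by (rule P_plus_GL)
    then show "finite (P_plus n :: 'a mat set)" by (rule finite_subset) simp
    have "1\<^sub>m (n + n) = (four_block_mat (1\<^sub>m n) (0\<^sub>m n n) (0\<^sub>m n n) (1\<^sub>m n) :: 'a mat)" by simp
    moreover have "four_block_mat (1\<^sub>m n) (0\<^sub>m n n) (0\<^sub>m n n) (1\<^sub>m n) \<in> (orth n :: 'a mat set)"
      by (subst orth_upper_iff) (auto simp: alternating_mats_def)
    ultimately show "1\<^sub>m (n + n) \<in> (P_plus n :: 'a mat set)" by (simp add: P_plus_orth)
    fix g h :: "'a mat" assume gh: "g \<in> P_plus n" "h \<in> P_plus n"
    then have o: "g \<in> orth n" "h \<in> orth n" by (auto simp: P_plus_orth)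
    then have c: "g \<in> carrier_mat (n + n) (n + n)" "h \<in> carrier_mat (n + n) (n + n)" by (auto simp: orth_def)
    have "(g * h) $$ (n + i, j) = 0" if "i < n" "j < n" for i j
    proof -
      have "(g * h) $$ (n + i, j) = (\<Sum>k<n + n. g $$ (n + i, k) * h $$ (k, j))"
        using that c by (auto simp: scalar_prod_def lessThan_atLeast0 intro!: sum.cong)
      also have "\<dots> = 0" unfolding sum_lessThan_add using gh that by (auto simp: P_plus_orth intro!: sum.neutral)
      finally show ?thesis .
    qed
    then show "g * h \<in> P_plus n" using orth_mult[OF o] by (simp add: P_plus_orth)
  qed
qed

text \<open>The \<open>A\<close> for which \<open>head_form s A\<close> vanishes on all alternating
  matrices. The coefficient of the free entry of \<open>B\<close> at the pair \<open>{k, l}\<close>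
  is \<open>A_kl\<close> if \<open>k < s\<close>, plus \<open>A_lk\<close> if \<open>l < s\<close>;
  the conditions say that all these coefficients are zero.\<close>

definition good :: "nat \<Rightarrow> nat \<Rightarrow> 'a mat set" where
  "good s n = {A \<in> GL n. (\<forall>i<s. \<forall>j\<in>{s..<n}. A $$ (i, j) = 0) \<and> (\<forall>i<s. \<forall>j<s. A $$ (i, j) = A $$ (j, i))}"

lemma head_form_good:
  assumes A: "A \<in> good s n" and B: "B \<in> alternating_mats n" and s: "s \<le> n"
  shows "head_form s A B = 0"
proof -
  have c: "A \<in> carrier_mat n n" "B \<in> carrier_mat n n" "transpose_mat B = B" "\<And>i. i < n \<Longrightarrow> B $$ (i, i) = 0"
    using A B by (auto simp: good_def GL_def alternating_mats_def)
  note Bs = alternating_mats_sym[OF B]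
  have "head_form s A B = (\<Sum>i<s. \<Sum>k<s. A $$ (i, k) * B $$ (k, i))"
    unfolding head_form_eq[OF c(1,2) s]
    using A s by (intro sum.cong sum.mono_neutral_right) (auto simp: good_def)
  also have "\<dots> = 0"
    using A s Bs c(4) by (intro sum_symmetric_zero_diagonal) (auto simp: good_def)
  finally show ?thesis .
qed

lemma ex_head_form_nonzero:
  assumes A: "A \<in> GL n" "A \<notin> good s n" and s: "s \<le> n"
  obtains B where "B \<in> alternating_mats n" "head_form s A B \<noteq> 0"
proof -
  note c = GL_carrier[OF A(1)]
  have "\<exists>k l. k < s \<and> l < n \<and> k \<noteq> l \<and> A $$ (k, l) + (if l < s then A $$ (l, k) else 0) \<noteq> 0"
  proof (cases "\<forall>i<s. \<forall>j\<in>{s..<n}. A $$ (i, j) = 0")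
    case False
    then obtain k l where "k < s" "s \<le> l" "l < n" "A $$ (k, l) \<noteq> 0" by auto
    then show ?thesis by (intro exI[of _ k] exI[of _ l]) auto
  next
    case True
    then obtain k l where "k < s" "l < s" "A $$ (k, l) \<noteq> A $$ (l, k)" using A unfolding good_def by blast
    then show ?thesis using s by (intro exI[of _ k] exI[of _ l]) (auto simp: add_eq_0)
  qed
  then obtain k l where kl: "k < s" "l < n" "k \<noteq> l" "A $$ (k, l) + (if l < s then A $$ (l, k) else 0) \<noteq> 0" by blast
  \<comment> \<open>The elementary alternating matrix on the pair \<open>{k, l}\<close>;
    \<open>head_form\<close> evaluates on it to the nonzero coefficient just found.\<close>
  define B :: "'a mat" where "B = mat n n (\<lambda>(i, j). if i = k \<and> j = l \<or> i = l \<and> j = k then 1 else 0)"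
  have B: "B \<in> alternating_mats n" using kl(3) by (intro alternating_matsI) (auto simp: B_def)
  then have Bc: "B \<in> carrier_mat n n" by (simp add: alternating_mats_def)
  have "(\<Sum>j<n. A $$ (i, j) * B $$ (j, i)) = (if i = k then A $$ (i, l) else 0) + (if i = l then A $$ (i, k) else 0)"
    if "i < s" for i
  proof -
    have "(\<Sum>j<n. A $$ (i, j) * B $$ (j, i)) =
        (\<Sum>j<n. (if j = l then if i = k then A $$ (i, j) else 0 else 0) + (if j = k then if i = l then A $$ (i, j) else 0 else 0))"
      using that s kl by (intro sum.cong) (auto simp: B_def)
    also have "\<dots> = (if i = k then A $$ (i, l) else 0) + (if i = l then A $$ (i, k) else 0)"
      using kl s by (simp add: sum.distrib)
    finally show ?thesis .
  qed
  then have "head_form s A B = A $$ (k, l) + (if l < s then A $$ (l, k) else 0)"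
    unfolding head_form_eq[OF c Bc s] using kl by (simp add: sum.distrib)
  then show ?thesis using that[OF B] kl(4) by simp
qed

text \<open>Translations by multiples of a \<open>B0\<close> with nonzero \<open>head_form\<close>
  map the fibres bijectively onto each other, so all of them have the same size.\<close>

lemma card_head_form_fibre:
  assumes A: "A \<in> GL n" "A \<notin> good s n" and s: "s \<le> n"
  shows "2 ^ r * card {B \<in> alternating_mats n. head_form s A B = c} = card (alternating_mats n :: 'a mat set)"
proof -
  obtain B0 where B0: "B0 \<in> alternating_mats n" "head_form s A B0 \<noteq> 0"
    using ex_head_form_nonzero[OF A s] by blast
  let ?F = "\<lambda>c. {B \<in> alternating_mats n. head_form s A B = c}"
  let ?f0 = "head_form s A B0"
  note Ac = GL_carrier[OF A(1)]
  have alt_c: "B \<in> carrier_mat n n" if "B \<in> alternating_mats n" for B :: "'a mat"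
    using that by (simp add: alternating_mats_def)
  have smult: "x \<cdot>\<^sub>m B0 \<in> alternating_mats n" for x
    using B0(1) alternating_mats_sym[OF B0(1)] by (intro alternating_matsI) (auto simp: alternating_mats_def)
  have shift: "head_form s A (B + x \<cdot>\<^sub>m B0) = head_form s A B + x * ?f0" if "B \<in> alternating_mats n" for B x
    using head_form_eq[OF Ac alt_c[OF alternating_add[OF that smult]] s] head_form_eq[OF Ac alt_c[OF that] s]
      head_form_eq[OF Ac alt_c[OF B0(1)] s] alt_c[OF that] alt_c[OF B0(1)] s
    by (simp add: sum_distrib_left sum.distrib algebra_simps)
  have twice: "B + x \<cdot>\<^sub>m B0 + x \<cdot>\<^sub>m B0 = B" if "B \<in> alternating_mats n" for B x
    using alt_c[OF that] alt_c[OF B0(1)] by (intro eq_matI) (auto simp: add.assoc)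
  have "card (?F c') = card (?F c)" for c'
  proof (rule bij_betw_same_card)
    define x where "x = (c + c') / ?f0"
    have x: "x * ?f0 = c + c'" using B0(2) by (simp add: x_def)
    have xc: "c' + (c + c') = c" "c + (c + c') = c'" by (simp_all add: add.left_commute)
    show "bij_betw (\<lambda>B. B + x \<cdot>\<^sub>m B0) (?F c') (?F c)"
      by (rule bij_betwI[where g="\<lambda>B. B + x \<cdot>\<^sub>m B0"])
        (auto simp: shift x xc twice intro!: alternating_add smult)
  qed
  then have "(\<Sum>c'\<in>UNIV. card (?F c')) = (\<Sum>c'\<in>(UNIV::'a set). card (?F c))" by (intro sum.cong refl)
  also have "\<dots> = 2 ^ r * card (?F c)" by (simp add: card_field del: Collect_conj_eq)
  finally have "(\<Sum>c'\<in>UNIV. card (?F c')) = 2 ^ r * card (?F c)" .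
  moreover have "(\<Sum>c'\<in>UNIV. \<Sum>B\<in>?F c'. 1::nat) = (\<Sum>B\<in>(alternating_mats n :: 'a mat set). 1)"
    by (rule sum.group) auto
  ultimately show ?thesis by simp
qed

definition inv_trace_count :: "nat \<Rightarrow> 'a \<Rightarrow> nat" where
  "inv_trace_count t \<beta> = card {M \<in> GL t. mat_trace M + mat_trace (minv M) = \<beta>}"

lemma lower_block_good:
  assumes "A \<in> GL s" "W \<in> carrier_mat t s" "D \<in> GL t"
  shows "(\<forall>i<s. \<forall>j<s. four_block_mat A (0\<^sub>m s t) W D $$ (i, j) = four_block_mat A (0\<^sub>m s t) W D $$ (j, i))
    \<longleftrightarrow> A \<in> (sym_GL s :: 'a mat set)"
proof -
  note c = GL_carrier[OF assms(1)] GL_carrier[OF assms(3)] assms(2)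
  have "A \<in> sym_GL s \<longleftrightarrow> (\<forall>i<s. \<forall>j<s. A $$ (i, j) = A $$ (j, i))"
  proof
    assume "A \<in> sym_GL s"
    then have "transpose_mat A = A" by (simp add: sym_GL_def sym_mats_def)
    then show "\<forall>i<s. \<forall>j<s. A $$ (i, j) = A $$ (j, i)"
      using c(1) by (metis carrier_matD index_transpose_mat(1))
  next
    assume "\<forall>i<s. \<forall>j<s. A $$ (i, j) = A $$ (j, i)"
    then show "A \<in> sym_GL s" using assms(1) c(1) by (auto simp: sym_GL_def sym_mats_def intro!: eq_matI)
  qed
  then show ?thesis using c by simp
qed

text \<open>The predicate stays arbitrary because two cases are used: constantly true, for the size
  of \<open>good\<close>, and equality with a given trace.\<close>

lemma card_good_trace:
  "card {A \<in> good s (s + t). Q (tail_trace s (s + t) A)} =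
    card (sym_GL s :: 'a mat set) * (2 ^ r) ^ (t * s) * card {M \<in> GL t. Q (mat_trace M + mat_trace (minv M) :: 'a)}"
proof -
  let ?b = "\<lambda>(A, W, D). four_block_mat A (0\<^sub>m s t) W D :: 'a mat"
  let ?S = "GL s \<times> carrier_mat t s \<times> GL t"
  let ?P = "\<lambda>M. (\<forall>i<s. \<forall>j<s. M $$ (i, j) = M $$ (j, i)) \<and> Q (tail_trace s (s + t) M)"
  have "{x \<in> ?S. ?P (?b x)} = sym_GL s \<times> carrier_mat t s \<times> {M \<in> GL t. Q (mat_trace M + mat_trace (minv M))}"
  proof -
    have "?P (?b (A, W, D)) \<longleftrightarrow> A \<in> sym_GL s \<and> Q (mat_trace D + mat_trace (minv D))"
      if "A \<in> GL s" "W \<in> carrier_mat t s" "D \<in> GL t" for A W D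
      using lower_block_good[OF that] tail_trace_lower_block[OF that(1,3,2)] by simp
    moreover have "A \<in> GL s" if "A \<in> sym_GL s" for A :: "'a mat" using that by (simp add: sym_GL_def)
    ultimately have "x \<in> ?S \<and> ?P (?b x) \<longleftrightarrow> x \<in> sym_GL s \<times> carrier_mat t s \<times> {M \<in> GL t. Q (mat_trace M + mat_trace (minv M))}" for x
      by (cases x) (simp only: mem_Sigma_iff mem_Collect_eq, blast)
    then show ?thesis by blast
  qed
  moreover have "{M \<in> {M \<in> GL (s + t). \<forall>i<s. \<forall>j\<in>{s..<s + t}. M $$ (i, j) = (0::'a)}. ?P M} =
      {A \<in> good s (s + t). Q (tail_trace s (s + t) A)}"
    by (auto simp: good_def)
  ultimately have "bij_betw ?b (sym_GL s \<times> carrier_mat t s \<times> {M \<in> GL t. Q (mat_trace M + mat_trace (minv M))})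
      {A \<in> good s (s + t). Q (tail_trace s (s + t) A)}"
    using bij_betw_Collect_comp[OF lower_block_GL_bij[of s t, where 'b='a], of ?P] by simp
  then show ?thesis
    by (simp add: bij_betw_same_card[symmetric] card_cartesian_product card_carrier_mat card_field)
qed

text \<open>Sort by \<open>A\<close>. Outside \<open>good\<close> every trace value is taken by the
  same number of \<open>B\<close>; inside, the trace is \<open>tail_trace\<close> for all
  \<open>B\<close>. The factor \<open>2 ^ r\<close> keeps the first contribution free of
  division.\<close>

lemma card_P_plus_trace:
  assumes n: "n = s + t"
  shows "2 ^ r * card {p \<in> P_plus n. mat_trace (p * sigma_plus n s) = (\<beta>::'a)} =
    card (alternating_mats n :: 'a mat set) *
      ((card (GL n :: 'a mat set) - card (good s n)) + 2 ^ r * card {A \<in> good s n. tail_trace s n A = \<beta>})"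
proof -
  let ?Alt = "alternating_mats n :: 'a mat set"
  have s: "s \<le> n" by (simp add: n)
  have car: "B \<in> carrier_mat n n" if "B \<in> ?Alt" for B using that by (simp add: alternating_mats_def)
  let ?F = "\<lambda>A. {B \<in> ?Alt. head_form s A B + tail_trace s n A = \<beta>}"
  have "bij_betw (\<lambda>(A, B). pmat A B) (GL n \<times> ?Alt) (P_plus n)"
    unfolding bij_betw_def P_plus_pmat using pmat_inj by blast
  from bij_betw_Collect_comp[OF this, of "\<lambda>p. mat_trace (p * sigma_plus n s) = \<beta>"]
  have "card {p \<in> P_plus n. mat_trace (p * sigma_plus n s) = \<beta>} =
      card {x \<in> GL n \<times> ?Alt. mat_trace ((case x of (A, B) \<Rightarrow> pmat A B) * sigma_plus n s) = \<beta>}"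
    by (rule bij_betw_same_card[THEN sym])
  also have "{x \<in> GL n \<times> ?Alt. mat_trace ((case x of (A, B) \<Rightarrow> pmat A B) * sigma_plus n s) = \<beta>} =
      (SIGMA A:GL n. ?F A)"
    using car mat_trace_pmat_sigma[of _ s t] unfolding n by (auto simp: n)
  also have "card \<dots> = (\<Sum>A\<in>GL n. card (?F A))" by simp
  finally have "2 ^ r * card {p \<in> P_plus n. mat_trace (p * sigma_plus n s) = \<beta>} = (\<Sum>A\<in>GL n. 2 ^ r * card (?F A))"
    by (simp add: sum_distrib_left)
  also have "\<dots> = (\<Sum>A\<in>GL n - good s n. card ?Alt) + (\<Sum>A\<in>good s n. if tail_trace s n A = \<beta> then 2 ^ r * card ?Alt else 0)"
  proof -
    have sub: "good s n \<subseteq> GL n" by (auto simp: good_def)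
    have "2 ^ r * card (?F A) = card ?Alt" if "A \<in> GL n - good s n" for A
    proof -
      have "?F A = {B \<in> ?Alt. head_form s A B = \<beta> + tail_trace s n A}"
        by (auto simp: add.assoc add.commute[of \<beta>])
      then show ?thesis using card_head_form_fibre[of A n s] that s by simp
    qed
    moreover have "2 ^ r * card (?F A) = (if tail_trace s n A = \<beta> then 2 ^ r * card ?Alt else 0)" if "A \<in> good s n" for A
    proof -
      have "?F A = (if tail_trace s n A = \<beta> then ?Alt else {})" using head_form_good[OF that _ s] by auto
      then show ?thesis by simp
    qed
    ultimately show ?thesis using sub
      by (subst sum.subset_diff[OF sub]) (auto intro!: arg_cong2[where f="(+)"] sum.cong)
  qed
  also have "\<dots> = card ?Alt * ((card (GL n :: 'a mat set) - card (good s n)) + 2 ^ r * card {A \<in> good s n. tail_trace s n A = \<beta>})"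
  proof -
    have sub: "good s n \<subseteq> GL n" by (auto simp: good_def)
    then have fin: "finite (good s n)" by (rule finite_subset) simp
    then have "(\<Sum>A\<in>good s n. if tail_trace s n A = \<beta> then 2 ^ r * card ?Alt else 0) =
        card {A \<in> good s n. tail_trace s n A = \<beta>} * (2 ^ r * card ?Alt)"
      by (simp add: sum.If_cases Int_def)
    then show ?thesis using sub fin by (simp add: card_Diff_subset algebra_simps)
  qed
  finally show ?thesis .
qed

text \<open>The conjugate is orthogonal, so only its lower left block matters, and its entries are
  entries of \<open>A * B\<close>, \<open>A\<close>, \<open>minv A\<close> or 0. If the upper right
  block of \<open>A\<close> vanishes, so does that of \<open>minv A\<close>; the corner of
  \<open>A * B\<close> is then the product of the corners, and the first of these is
  invertible.\<close>

lemma conj_sigma_P_plus_iff: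
  assumes n: "n = s + t" and A: "A \<in> GL n" and B: "B \<in> (alternating_mats n :: 'a mat set)"
  shows "sigma_plus n s * pmat A B * sigma_plus n s \<in> P_plus n \<longleftrightarrow>
    (\<forall>i<s. \<forall>j\<in>{s..<n}. A $$ (i, j) = 0) \<and> (\<forall>i<s. \<forall>j<s. B $$ (i, j) = 0)"
proof -
  have s: "s \<le> n" by (simp add: n)
  have Bc: "B \<in> carrier_mat n n" using B by (simp add: alternating_mats_def)
  note p = pmat_index[OF A Bc] and Ac = GL_carrier[OF A]
  let ?\<sigma> = "sigma_plus n s :: 'a mat"
  let ?h = "?\<sigma> * pmat A B * ?\<sigma>"
  have "pmat A B \<in> P_plus n" using A B by (auto simp: P_plus_pmat)
  then have "pmat A B \<in> orth n" by (simp add: P_plus_orth)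
  then have orth: "?h \<in> orth n" using sigma_plus_orth[OF s] by (intro orth_mult)
  have sp: "?\<sigma> * pmat A B \<in> carrier_mat (n + n) (n + n)" by (rule mult_carrier_mat[OF sigma_plus_carrier[OF s] p(5)])
  have ix: "?h $$ (i, j) = pmat A B $$ (sigma_perm n s i, sigma_perm n s j)" if "i < n + n" "j < n + n" for i j
    using that sigma_perm(2)[OF s]
    by (simp add: mult_sigma_plus(1)[OF s sp] mult_sigma_plus(2)[OF s p(5)] del: index_mult_mat(1))
  have "?h \<in> P_plus n \<longleftrightarrow> (\<forall>i<n. \<forall>j<n. pmat A B $$ (sigma_perm n s (n + i), sigma_perm n s j) = 0)"
    using orth ix by (simp add: P_plus_orth)
  also have "\<dots> \<longleftrightarrow> (\<forall>i<n. \<forall>j<n. (if i < s then if j < s then (A * B) $$ (i, j) else A $$ (i, j)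
      else if j < s then minv A $$ (j, i) else 0) = 0)"
    using s by (intro all_cong1 imp_cong refl) (auto simp: sigma_perm_def p add.commute[of _ n] simp del: index_mult_mat(1))
  also have "\<dots> \<longleftrightarrow> (\<forall>i<s. \<forall>j\<in>{s..<n}. A $$ (i, j) = 0) \<and> (\<forall>i<s. \<forall>j<s. B $$ (i, j) = 0)" (is "?L \<longleftrightarrow> ?Z \<and> ?B")
  proof (cases ?Z)
    case False
    then obtain i j where "i < s" "j \<in> {s..<n}" "A $$ (i, j) \<noteq> 0" by blast
    then have "A $$ (i, j) = 0" if ?L using that[rule_format, of i j] s by auto
    then have "\<not> ?L" using \<open>A $$ (i, j) \<noteq> 0\<close> by blast
    then show ?thesis using False by blast
  next
    case True
    then have "A \<in> (\<lambda>(A1, W, D). four_block_mat A1 (0\<^sub>m s t) W D) ` (GL s \<times> carrier_mat t s \<times> GL t)"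
      unfolding bij_betw_imp_surj_on[OF lower_block_GL_bij[of s t, where 'b='a]] using A n by simp
    then obtain A1 W D where b: "A = four_block_mat A1 (0\<^sub>m s t) W D" "A1 \<in> GL s" "W \<in> carrier_mat t s" "D \<in> GL t"
      by auto
    note c = GL_carrier[OF b(2)] GL_carrier[OF b(4)] b(3) minv(1)[OF b(2)] minv(1)[OF b(4)]
    have "minv A $$ (j, i) = 0" if "j < s" "i \<in> {s..<n}" for i j
      unfolding b(1) minv_lower_block[OF b(2,4,3)] using c that n by auto
    then have L: "?L \<longleftrightarrow> (\<forall>i<s. \<forall>j<s. (A * B) $$ (i, j) = 0)"
      using True s by auto
    have "B \<in> carrier_mat (s + t) (s + t)" using Bc n by simp
    then obtain B1 B2 B3 B4 where bb: "B = four_block_mat B1 B2 B3 B4" "B1 \<in> carrier_mat s s"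
      "B2 \<in> carrier_mat s t" "B3 \<in> carrier_mat t s" "B4 \<in> carrier_mat t t" by (rule four_block_cases)
    have "A * B = four_block_mat (A1 * B1) (A1 * B2) (W * B1 + D * B3) (W * B2 + D * B4)"
      unfolding b(1) bb(1) using c bb by (subst mult_four_block_mat[of _ s s _ t _ t _ _ s _ t]) auto
    then have AB: "(A * B) $$ (i, j) = (A1 * B1) $$ (i, j)" if "i < s" "j < s" for i j
      using that c bb by simp
    have A1B1: "A1 * B1 \<in> carrier_mat s s" using c bb by auto
    have "?L \<longleftrightarrow> A1 * B1 = 0\<^sub>m s s"
      unfolding L using AB A1B1 by (metis carrier_matD eq_matI index_zero_mat)
    also have "\<dots> \<longleftrightarrow> B1 = 0\<^sub>m s s"
      using minv_cancel(1)[OF b(2) bb(2)] c bb by (metis right_mult_zero_mat)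
    also have "\<dots> \<longleftrightarrow> ?B"
      using bb by (auto intro!: eq_matI)
    finally show ?thesis using True by blast
  qed
  finally show ?thesis .
qed

lemma card_stabiliser:
  assumes n: "n = s + t"
  shows "card {h \<in> P_plus n. sigma_plus n s * h * sigma_plus n s \<in> (P_plus n :: 'a mat set)} =
    card (GL s :: 'a mat set) * (2 ^ r) ^ (t * s) * card (GL t :: 'a mat set) *
    ((2 ^ r) ^ (t * s) * card (alternating_mats t :: 'a mat set))"
proof -
  let ?\<sigma> = "sigma_plus n s :: 'a mat"
  let ?X = "{A \<in> GL n. \<forall>i<s. \<forall>j\<in>{s..<n}. A $$ (i, j) = (0::'a)}"
  let ?Y = "{B \<in> alternating_mats n. \<forall>i<s. \<forall>j<s. B $$ (i, j) = (0::'a)}"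
  have "bij_betw (\<lambda>(A, B). pmat A B) (GL n \<times> alternating_mats n) (P_plus n :: 'a mat set)"
    unfolding bij_betw_def P_plus_pmat using pmat_inj by blast
  from bij_betw_Collect_comp[OF this, of "\<lambda>h. ?\<sigma> * h * ?\<sigma> \<in> P_plus n"]
  have "card {h \<in> P_plus n. ?\<sigma> * h * ?\<sigma> \<in> P_plus n} =
      card {x \<in> GL n \<times> alternating_mats n. ?\<sigma> * (case x of (A, B) \<Rightarrow> pmat A B) * ?\<sigma> \<in> P_plus n}"
    by (rule bij_betw_same_card[THEN sym])
  also have "{x \<in> GL n \<times> alternating_mats n. ?\<sigma> * (case x of (A, B) \<Rightarrow> pmat A B) * ?\<sigma> \<in> P_plus n} = ?X \<times> ?Y"
    using conj_sigma_P_plus_iff[OF n] by auto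
  also have "card (?X \<times> ?Y) = card ?X * card ?Y" by (rule card_cartesian_product)
  also have "card ?X = card (GL s :: 'a mat set) * (2 ^ r) ^ (t * s) * card (GL t :: 'a mat set)"
    using bij_betw_same_card[OF lower_block_GL_bij[of s t, where 'b='a]]
    by (simp add: n card_cartesian_product card_carrier_mat card_field)
  also have "card ?Y = (2 ^ r) ^ (t * s) * card (alternating_mats t :: 'a mat set)"
  proof -
    let ?b = "\<lambda>(A, W, D). four_block_mat A (transpose_mat W) W D :: 'a mat"
    let ?S = "alternating_mats s \<times> carrier_mat t s \<times> alternating_mats t"
    have 1: "(\<forall>i<s. \<forall>j<s. four_block_mat A (transpose_mat W) W D $$ (i, j) = 0) \<longleftrightarrow> A = 0\<^sub>m s s"
      if "A \<in> alternating_mats s" "W \<in> carrier_mat t s" "D \<in> alternating_mats t" for A W D :: "'a mat"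
      using that by (auto simp: alternating_mats_def intro!: eq_matI)
    have "0\<^sub>m s s \<in> (alternating_mats s :: 'a mat set)" by (auto simp: alternating_mats_def)
    then have "{x \<in> ?S. \<forall>i<s. \<forall>j<s. ?b x $$ (i, j) = 0} = {0\<^sub>m s s} \<times> carrier_mat t s \<times> alternating_mats t"
      using 1 by auto
    then have "bij_betw ?b ({0\<^sub>m s s} \<times> carrier_mat t s \<times> alternating_mats t) ?Y"
      using bij_betw_Collect_comp[OF alternating_mats_block_bij[of s t, where 'a='a], of "\<lambda>M. \<forall>i<s. \<forall>j<s. M $$ (i, j) = 0"] n
      by simp
    then show ?thesis
      by (simp add: bij_betw_same_card[symmetric] card_cartesian_product card_carrier_mat card_field)
  qed
  finally show ?thesis .
qed

lemma card_P_plus: "card (P_plus n :: 'a mat set) = card (GL n :: 'a mat set) * card (alternating_mats n :: 'a mat set)"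
  unfolding P_plus_pmat by (subst card_image[OF pmat_inj]) (rule card_cartesian_product)

text \<open>The order of the stabiliser is left as a factor on the left, so the identity lives in
  the natural numbers; \<open>real_card_DC_trace\<close> performs the division.\<close>

lemma card_DC_trace:
  assumes n: "n = s + t"
  shows "2 ^ r * card {w \<in> DC t n. mat_trace w = (\<beta>::'a)} *
    (card (GL s :: 'a mat set) * (2 ^ r) ^ (t * s) * card (GL t :: 'a mat set) *
     ((2 ^ r) ^ (t * s) * card (alternating_mats t :: 'a mat set))) =
    card (GL n :: 'a mat set) * card (alternating_mats n :: 'a mat set) * (card (alternating_mats n :: 'a mat set) *
      ((card (GL n :: 'a mat set) - card (sym_GL s :: 'a mat set) * (2 ^ r) ^ (t * s) * card (GL t :: 'a mat set)) +
       2 ^ r * (card (sym_GL s :: 'a mat set) * (2 ^ r) ^ (t * s) * inv_trace_count t \<beta>)))"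
proof -
  interpret G: group "matrix_group (n + n) TYPE('a)" by (rule matrix_group)
  have s: "s \<le> n" "n - t = s" by (simp_all add: n)
  let ?St = "{h \<in> P_plus n. sigma_plus n s * h * sigma_plus n s \<in> (P_plus n :: 'a mat set)}"
  let ?Tr = "{p \<in> P_plus n. mat_trace (p * sigma_plus n s) = \<beta>}"
  have Q: "(mat_trace (x * y) = \<beta>) = (mat_trace (y * x) = \<beta>)" if "x \<in> GL (n + n)" "y \<in> GL (n + n)" for x y
    using mat_trace_mult_comm[OF GL_carrier[OF that(1)] GL_carrier[OF that(2)]] by simp
  have "card {w \<in> DC t n. mat_trace w = \<beta>} * card ?St = card (P_plus n :: 'a mat set) * card ?Tr"
    using G.card_double_coset[of "P_plus n" "sigma_plus n s" "\<lambda>w. mat_trace w = \<beta>",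
        unfolded carrier_matrix_group mult_matrix_group one_matrix_group,
        OF finite_GL P_plus_subgroup sigma_plus_GL[OF s(1)] sigma_plus_square[OF s(1)] Q]
    unfolding DC_def s(2) .
  then have "2 ^ r * card {w \<in> DC t n. mat_trace w = \<beta>} * card ?St = card (P_plus n :: 'a mat set) * (2 ^ r * card ?Tr)"
    by (simp only: mult.assoc mult.left_commute)
  moreover have "card (good s n) = card (sym_GL s :: 'a mat set) * (2 ^ r) ^ (t * s) * card (GL t :: 'a mat set)"
    using card_good_trace[of s t "\<lambda>_. True"] by (simp add: n)
  moreover have "card {A \<in> good s n. tail_trace s n A = \<beta>} = card (sym_GL s :: 'a mat set) * (2 ^ r) ^ (t * s) * inv_trace_count t \<beta>"
    using card_good_trace[of s t "\<lambda>x. x = \<beta>"] by (simp add: n inv_trace_count_def)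
  ultimately show ?thesis
    by (simp only: card_P_plus_trace[OF n] card_stabiliser[OF n] card_P_plus)
qed

end

section \<open>The Hasse bound for Kloosterman sums\<close>

definition unimodular :: "'b::comm_ring_1 \<Rightarrow> 'b \<Rightarrow> bool" where
  "unimodular f g \<longleftrightarrow> (\<exists>s w. s * f + w * g = 1)"

lemma unimodular_commute: "unimodular f g \<longleftrightarrow> unimodular g f"
  unfolding unimodular_def by (metis add.commute)

lemma unimodular_mult:
  assumes "unimodular f g" "unimodular f h"
  shows "unimodular f (g * h)"
proof -
  obtain s w s' w' where 1: "s * f + w * g = 1" and 2: "s' * f + w' * h = 1"
    using assms by (auto simp: unimodular_def)
  have "(s * (s' * f + w' * h) + w * g * s') * f + (w * w') * (g * h) =
      (s * f + w * g) * (s' * f + w' * h)"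
    by (simp add: algebra_simps)
  also have "\<dots> = 1" using 1 2 by simp
  finally show ?thesis unfolding unimodular_def by blast
qed

lemma unimodular_1 [simp]: "unimodular f 1"
  unfolding unimodular_def by (intro exI[of _ 0] exI[of _ 1]) simp

lemma unimodular_power:
  assumes "unimodular f g"
  shows "unimodular (f ^ m) (g ^ k)"
proof -
  have 1: "unimodular f (g ^ k)" if "unimodular f g" for f g :: 'a and k
    using that by (induction k) (auto intro: unimodular_mult)
  show ?thesis
    using 1[OF iffD1[OF unimodular_commute 1[OF assms, of k]], of m] by (simp add: unimodular_commute)
qed

lemma unimodular_prod:
  assumes "\<And>e. e \<in> E \<Longrightarrow> unimodular f (g e)"
  shows "unimodular f (prod g E)"
  using assms by (induction E rule: infinite_finite_induct) (auto intro: unimodular_mult)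

lemma unimodular_linear:
  fixes p :: "'b::field poly"
  assumes "poly p e \<noteq> 0"
  shows "unimodular p [:- e, 1:]"
proof -
  obtain k where "p = [:- e, 1:] * k + [:poly p e:]"
    using synthetic_div_correct'[of e p] by (metis add.commute)
  then have "p - k * [:- e, 1:] = [:poly p e:]" by (metis add_diff_cancel_left' mult.commute)
  then have "[:inverse (poly p e):] * (p - k * [:- e, 1:]) = 1"
    using assms by (simp add: one_pCons)
  then have "[:inverse (poly p e):] * p + (- ([:inverse (poly p e):] * k)) * [:- e, 1:] = 1"
    by (simp only: right_diff_distrib mult_minus_left mult.assoc add_uminus_conv_diff)
  then show ?thesis unfolding unimodular_def by blast
qed

lemma unimodular_nonzero: "unimodular f g \<Longrightarrow> f \<noteq> 0 \<or> g \<noteq> (0::'b::comm_ring_1)"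
  unfolding unimodular_def by auto

text \<open>For a unimodular pair this is the naive height of the point \<open>(f : g)\<close> of
  the projective line over the rational functions. Pairs instead of fractions also admit the point
  at infinity, so a step never has to exclude it.\<close>

definition height :: "'b::zero poly \<Rightarrow> 'b poly \<Rightarrow> nat" where
  "height f g = max (degree f) (degree g)"

definition X :: "'b::comm_ring_1 poly" where "X = [:0, 1:]"

text \<open>
  The relation between the (homogenised) abscissae of two points of the quadratic twist of
  \<open>y\<^sup>2 + x y = x\<^sup>3 + b\<^sup>2\<close> over the rational function field that differ by the point with abscissa \<open>X\<close>.
\<close>
definition step_rel :: "'b::field \<Rightarrow> 'b poly \<Rightarrow> 'b poly \<Rightarrow> 'b poly \<Rightarrow> 'b poly \<Rightarrow> 'b poly" where
  "step_rel b f0 g0 f g = f0\<^sup>2 * f\<^sup>2 + X\<^sup>2 * (f0\<^sup>2 * g\<^sup>2 + g0\<^sup>2 * f\<^sup>2) + X * f0 * g0 * f * g + [:b:]\<^sup>2 * g0\<^sup>2 * g\<^sup>2"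

text \<open>A quadratic form in \<open>(F, G)\<close> vanishing at \<open>(f, g)\<close> is
  divisible by \<open>g F - f G\<close>. The cofactor is \<open>\<alpha> F - \<gamma> G\<close>, so
  \<open>(\<gamma> : \<alpha>)\<close> is the other root; the Bezout coefficients make the division
  explicit.\<close>

lemma quadratic_form_split:
  fixes A B C f g :: "'b::idom"
  assumes uni: "unimodular f g" and zero: "A * f\<^sup>2 + B * f * g + C * g\<^sup>2 = 0"
  obtains \<alpha> \<gamma> where "A = g * \<alpha>" "C = f * \<gamma>" "B = - (g * \<gamma> + f * \<alpha>)"
proof -
  obtain s w where 1: "s * f + w * g = 1" using uni by (auto simp: unimodular_def)
  \<comment> \<open>Expand \<open>A (s f + w g)^2\<close> and eliminate \<open>A f^2\<close> with
    \<open>zero\<close>: what remains is \<open>g\<close> times this polynomial.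
    \<open>\<gamma>\<close> arises in the same way from \<open>C\<close>.\<close>
  define \<alpha> where "\<alpha> = A * (2 * s * w * f + w\<^sup>2 * g) - s\<^sup>2 * (B * f + C * g)"
  define \<gamma> where "\<gamma> = C * (s\<^sup>2 * f + 2 * s * w * g) - w\<^sup>2 * (A * f + B * g)"
  have "A * (s * f + w * g)\<^sup>2 = g * \<alpha> + s\<^sup>2 * (A * f\<^sup>2 + B * f * g + C * g\<^sup>2)"
    unfolding \<alpha>_def by (simp add: algebra_simps power2_eq_square)
  then have A: "A = g * \<alpha>" using zero 1 by simp
  have "C * (s * f + w * g)\<^sup>2 = f * \<gamma> + w\<^sup>2 * (A * f\<^sup>2 + B * f * g + C * g\<^sup>2)"
    unfolding \<gamma>_def by (simp add: algebra_simps power2_eq_square)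
  then have C: "C = f * \<gamma>" using zero 1 by simp
  have "B = - (g * \<gamma> + f * \<alpha>)"
  proof (cases "f = 0 \<or> g = 0")
    case False
    have "f * g * (B + (g * \<gamma> + f * \<alpha>)) = (g * \<alpha>) * f\<^sup>2 + B * f * g + (f * \<gamma>) * g\<^sup>2"
      by (simp add: algebra_simps power2_eq_square)
    also have "\<dots> = 0" using zero by (simp only: A[symmetric] C[symmetric])
    finally have "f * g * (B + (g * \<gamma> + f * \<alpha>)) = 0" .
    then show ?thesis using False by (simp del: minus_add_distrib add: eq_neg_iff_add_eq_0)
  next
    case True
    then show ?thesis
    proof
      assume f: "f = 0"
      then have wg: "w * g = 1" using 1 by simp
      have "C = 0" using zero f wg C by simp
      then show ?thesis unfolding \<gamma>_def using f wg by (simp add: power2_eq_square algebra_simps)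
    next
      assume g: "g = 0"
      then have wg: "s * f = 1" using 1 by simp
      have "A = 0" using zero g wg A by simp
      then show ?thesis unfolding \<alpha>_def using g wg by (simp add: power2_eq_square algebra_simps)
    qed
  qed
  then show ?thesis using that A C by blast
qed

lemma coeff_mult_le:
  fixes p q :: "'b::comm_semiring_1 poly"
  assumes "degree p \<le> m" "degree q \<le> k"
  shows "coeff (p * q) (m + k) = coeff p m * coeff q k"
proof -
  have "coeff p i * coeff q (m + k - i) = 0" if "i \<noteq> m" "i \<le> m + k" for i
    using that assms by (cases "i < m") (auto simp: coeff_eq_0)
  then have "coeff (p * q) (m + k) = (\<Sum>i\<in>{m}. coeff p i * coeff q (m + k - i))"
    unfolding coeff_mult by (intro sum.mono_neutral_right) auto
  then show ?thesis by simp
qed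

lemma height_le: "degree f \<le> height f g" "degree g \<le> height f g"
  by (auto simp: height_def)

lemma height_coeff:
  assumes "unimodular f g"
  shows "coeff f (height f g) \<noteq> 0 \<or> coeff g (height f g) \<noteq> (0::'b::comm_ring_1)"
proof -
  have *: "coeff f (degree f) = 0 \<Longrightarrow> f = 0" for f :: "'b poly" by simp
  show ?thesis
    using unimodular_nonzero[OF assms] *[of f] *[of g] unfolding height_def
    by (cases "degree f" "degree g" rule: linorder_cases) (auto simp: max_def)
qed

text \<open>The height of a quadratic form given by its coefficients. As a relation it allows two
  computations for the same form to be compared through \<open>top_degree_unique\<close>.\<close>

definition top_degree :: "'b::zero poly \<Rightarrow> 'b poly \<Rightarrow> 'b poly \<Rightarrow> nat \<Rightarrow> bool" where
  "top_degree A B C d \<longleftrightarrow> degree A \<le> d \<and> degree B \<le> d \<and> degree C \<le> d \<and>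
     (coeff A d \<noteq> 0 \<or> coeff B d \<noteq> 0 \<or> coeff C d \<noteq> 0)"

lemma top_degree_unique: "top_degree A B C d \<Longrightarrow> top_degree A B C d' \<Longrightarrow> d = d'"
  unfolding top_degree_def by (meson le_antisym le_degree order_trans)

text \<open>Heights add under multiplication: the coefficients in the top degree form the product of
  two nonzero linear forms over a domain.\<close>

lemma top_degree_product:
  fixes f g \<alpha> \<gamma> :: "'b::idom poly"
  assumes "unimodular f g" "unimodular \<gamma> \<alpha>"
  shows "top_degree (g * \<alpha>) (- (g * \<gamma> + f * \<alpha>)) (f * \<gamma>) (height f g + height \<gamma> \<alpha>)"
proof -
  note c = height_le[where f=f and g=g] height_le[where f=\<gamma> and g=\<alpha>]
  have d: "degree (p * q) \<le> m + k" if "degree p \<le> m" "degree q \<le> k" for p q :: "'b poly" and m k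
    using degree_mult_le[of p q] that by linarith
  show ?thesis
    unfolding top_degree_def degree_minus coeff_minus coeff_add
    using height_coeff[OF assms(1)] height_coeff[OF assms(2)] d c
    by (auto simp: coeff_mult_le intro!: degree_add_le)
qed

lemma degree_X_mult: "degree (X * p) \<le> Suc (degree p)"
  unfolding X_def by (rule order.trans[OF degree_mult_le]) simp

lemma coeff_X_mult_Suc [simp]: "coeff (X * p) (Suc n) = coeff p n"
  unfolding X_def by simp

text \<open>With \<open>m = height f g\<close>, the outer coefficients have in degree
  \<open>2 m + 2\<close> the squares of the coefficients of \<open>g\<close> and of \<open>f\<close>
  at \<open>m\<close>, and these do not both vanish.\<close>

lemma top_degree_step:
  fixes f g :: "'b::field poly"
  assumes "unimodular f g"
  shows "top_degree (f\<^sup>2 + X\<^sup>2 * g\<^sup>2) (X * f * g) (X\<^sup>2 * f\<^sup>2 + [:b:]\<^sup>2 * g\<^sup>2) (2 * height f g + 2)"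
proof -
  define m where "m = height f g"
  note c = height_le[where f=f and g=g, folded m_def]
  have *: "degree (p\<^sup>2) \<le> 2 * degree p" for p :: "'b poly"
    by (metis degree_power_le mult.commute)
  have Xf: "degree ((X * p)\<^sup>2) \<le> 2 * m + 2" "coeff ((X * p)\<^sup>2) (2 * m + 2) = (coeff p m)\<^sup>2"
    if "degree p \<le> m" for p :: "'b poly"
  proof -
    have d: "degree (X * p) \<le> Suc m" using degree_X_mult[of p] that by linarith
    then show "degree ((X * p)\<^sup>2) \<le> 2 * m + 2" using *[of "X * p"] by linarith
    have "coeff ((X * p)\<^sup>2) (Suc m + Suc m) = coeff (X * p) (Suc m) * coeff (X * p) (Suc m)"
      unfolding power2_eq_square using d d by (rule coeff_mult_le)
    moreover have "Suc m + Suc m = 2 * m + 2" by simp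
    ultimately show "coeff ((X * p)\<^sup>2) (2 * m + 2) = (coeff p m)\<^sup>2"
      by (simp only: coeff_X_mult_Suc power2_eq_square)
  qed
  have small: "degree (p\<^sup>2) < 2 * m + 2" "degree ([:b:]\<^sup>2 * p\<^sup>2) < 2 * m + 2" if "degree p \<le> m" for p :: "'b poly"
  proof -
    show 1: "degree (p\<^sup>2) < 2 * m + 2" using *[of p] that by linarith
    have "[:b:]\<^sup>2 * p\<^sup>2 = smult (b\<^sup>2) (p\<^sup>2)" by (simp add: power2_eq_square)
    then show "degree ([:b:]\<^sup>2 * p\<^sup>2) < 2 * m + 2" using 1 degree_smult_le[of "b\<^sup>2" "p\<^sup>2"] by simp
  qed
  have B: "degree (X * f * g) \<le> 2 * m + 2"
    using degree_mult_le[of "X * f" g] degree_X_mult[of f] c by linarith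
  have "degree (f\<^sup>2 + (X * g)\<^sup>2) \<le> 2 * m + 2" "degree ((X * f)\<^sup>2 + [:b:]\<^sup>2 * g\<^sup>2) \<le> 2 * m + 2"
    using Xf(1)[OF c(1)] Xf(1)[OF c(2)] small(1)[OF c(1)] small(2)[OF c(2)]
    by (meson degree_add_le less_imp_le)+
  moreover have "coeff (f\<^sup>2 + (X * g)\<^sup>2) (2 * m + 2) = (coeff g m)\<^sup>2"
    "coeff ((X * f)\<^sup>2 + [:b:]\<^sup>2 * g\<^sup>2) (2 * m + 2) = (coeff f m)\<^sup>2"
    using Xf(2)[OF c(1)] Xf(2)[OF c(2)] small(1)[OF c(1)] small(2)[OF c(2)]
    by (simp_all only: coeff_add coeff_eq_0 add_0_left add_0_right)
  ultimately show ?thesis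
    using height_coeff[OF assms] B
    unfolding top_degree_def m_def[symmetric] power_mult_distrib by auto
qed

text \<open>The three coefficients of the form lie in the ideal of \<open>\<gamma>\<close> and
  \<open>\<alpha>\<close>. But \<open>f ^ 3\<close> and \<open>b^2 g ^ 3\<close> are combinations of
  these coefficients, and the cubes of \<open>f\<close> and \<open>g\<close> are comaximal. A
  nonzero \<open>b\<close>, that is, a smooth curve, lets \<open>b^2\<close> be divided out.\<close>

lemma step_form_primitive:
  fixes f g :: "'b::field poly"
  assumes uni: "unimodular f g" and b: "b \<noteq> 0"
    and A: "f\<^sup>2 + X\<^sup>2 * g\<^sup>2 = g0 * \<alpha>" and C: "X\<^sup>2 * f\<^sup>2 + [:b:]\<^sup>2 * g\<^sup>2 = f0 * \<gamma>"
    and B: "X * f * g = - (g0 * \<gamma> + f0 * \<alpha>)"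
  shows "unimodular \<gamma> \<alpha>"
proof -
  obtain s w where "s * f ^ 3 + w * g ^ 3 = 1"
    using unimodular_power[OF uni, of 3 3] by (auto simp: unimodular_def)
  moreover have "[:inverse b:] * [:b:] = 1" using b by (simp add: one_pCons)
  moreover define c where "c = [:inverse b:]"
  moreover define d where "d = [:b:]"
  ultimately have 1: "s * f ^ 3 + w * g ^ 3 = 1" "c * d = 1" by auto
  note h = A B C[folded d_def]
  have f3: "f ^ 3 = f * (g0 * \<alpha>) + X * g * (g0 * \<gamma> + f0 * \<alpha>)"
  proof -
    have "f ^ 3 = f * (f\<^sup>2 + X\<^sup>2 * g\<^sup>2) - X * g * (X * f * g)"
      by (simp add: algebra_simps power2_eq_square power3_eq_cube)
    then show ?thesis unfolding h by (simp add: algebra_simps)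
  qed
  have "d\<^sup>2 * g ^ 3 = g * (f0 * \<gamma>) - X\<^sup>2 * g * (g0 * \<alpha>) + X * (X ^ 3 * g ^ 3)"
    unfolding h[symmetric] by (simp add: algebra_simps power2_eq_square power3_eq_cube)
  moreover have "X ^ 3 * g ^ 3 = X * g * (g0 * \<alpha>) + f * (g0 * \<gamma> + f0 * \<alpha>)"
  proof -
    have "X ^ 3 * g ^ 3 = X * g * (f\<^sup>2 + X\<^sup>2 * g\<^sup>2) - f * (X * f * g)"
      by (simp add: algebra_simps power2_eq_square power3_eq_cube)
    then show ?thesis unfolding h by (simp add: algebra_simps)
  qed
  moreover have "g ^ 3 = c\<^sup>2 * (d\<^sup>2 * g ^ 3)"
    using 1(2) by (simp flip: mult.assoc power_mult_distrib)
  ultimately have g3: "g ^ 3 = c\<^sup>2 * (g * (f0 * \<gamma>) - X\<^sup>2 * g * (g0 * \<alpha>) +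
      X * (X * g * (g0 * \<alpha>) + f * (g0 * \<gamma> + f0 * \<alpha>)))"
    by simp
  have "(s * (X * g * g0) + w * c\<^sup>2 * (g * f0 + X * f * g0)) * \<gamma> +
     (s * (f * g0 + X * g * f0) + w * c\<^sup>2 * (X * X * g * g0 + X * f * f0 - X\<^sup>2 * g * g0)) * \<alpha> = 1"
    using 1(1) unfolding f3 g3 by (simp add: algebra_simps)
  then show ?thesis unfolding unimodular_def by blast
qed

text \<open>\<open>(f0 : g0)\<close> is one root of the quadratic form attached to
  \<open>(f : g)\<close>, and the next point is the other root. The height of the form, computed
  once from its factors and once from its coefficients, gives the parallelogram law for the point
  with abscissa \<open>X\<close>, whose height is 1.\<close>

lemma step:
  fixes f g :: "'b::field poly"
  assumes "unimodular f0 g0" "unimodular f g" "b \<noteq> 0" "step_rel b f0 g0 f g = 0"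
  obtains f' g' where "unimodular f' g'" "step_rel b f g f' g' = 0"
    "height f0 g0 + height f' g' = 2 * height f g + 2"
proof -
  let ?A = "f\<^sup>2 + X\<^sup>2 * g\<^sup>2" and ?B = "X * f * g" and ?C = "X\<^sup>2 * f\<^sup>2 + [:b:]\<^sup>2 * g\<^sup>2"
  have "?A * f0\<^sup>2 + ?B * f0 * g0 + ?C * g0\<^sup>2 = 0"
    using assms(4) unfolding step_rel_def by (simp add: algebra_simps)
  then obtain \<alpha> \<gamma> where split: "?A = g0 * \<alpha>" "?C = f0 * \<gamma>" "?B = - (g0 * \<gamma> + f0 * \<alpha>)"
    using quadratic_form_split[OF assms(1)] by metis
  have uni: "unimodular \<gamma> \<alpha>"
    using step_form_primitive[OF assms(2,3) split] .
  have "step_rel b f g \<gamma> \<alpha> = ?A * \<gamma>\<^sup>2 + ?B * \<gamma> * \<alpha> + ?C * \<alpha>\<^sup>2"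
    unfolding step_rel_def by (simp add: algebra_simps)
  also have "\<dots> = 0" unfolding split by (simp add: algebra_simps power2_eq_square)
  finally have rel: "step_rel b f g \<gamma> \<alpha> = 0" .
  have "height f0 g0 + height \<gamma> \<alpha> = 2 * height f g + 2"
    using top_degree_product[OF assms(1) uni] top_degree_step[OF assms(2), of b]
    unfolding split by (rule top_degree_unique)
  then show ?thesis using that uni rel by blast
qed

text \<open>The heights have constant second difference 2, so the first two determine the quadratic
  polynomial; being degrees, its values are nonnegative.\<close>

lemma height_sequence:
  fixes f0 g0 f1 g1 :: "'b::field poly"
  assumes "unimodular f0 g0" "unimodular f1 g1" "b \<noteq> 0" "step_rel b f0 g0 f1 g1 = 0"
  assumes h0: "int (height f0 g0) = h" and h1: "int (height f1 g1) = 1 + k + h"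
  shows "0 \<le> (int n)\<^sup>2 + k * int n + h"
proof -
  have "\<exists>f0 g0 f1 g1 :: 'b poly. unimodular f0 g0 \<and> unimodular f1 g1 \<and> step_rel b f0 g0 f1 g1 = 0 \<and>
      int (height f0 g0) = (int n)\<^sup>2 + k * int n + h \<and>
      int (height f1 g1) = (int (Suc n))\<^sup>2 + k * int (Suc n) + h"
  proof (induction n)
    case 0
    show ?case using assms by (intro exI[of _ f0] exI[of _ g0] exI[of _ f1] exI[of _ g1]) simp
  next
    case (Suc n)
    then obtain f0 g0 f1 g1 :: "'b poly" where 1: "unimodular f0 g0" "unimodular f1 g1"
      "step_rel b f0 g0 f1 g1 = 0" and
      2: "int (height f0 g0) = (int n)\<^sup>2 + k * int n + h"
      "int (height f1 g1) = (int (Suc n))\<^sup>2 + k * int (Suc n) + h" by blast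
    obtain f2 g2 where 3: "unimodular f2 g2" "step_rel b f1 g1 f2 g2 = 0"
      "height f0 g0 + height f2 g2 = 2 * height f1 g1 + 2"
      using step[OF 1(1,2) assms(3) 1(3)] by blast
    have "int (height f0 g0) + int (height f2 g2) = 2 * int (height f1 g1) + 2"
      using 3(3) by linarith
    then have "int (height f2 g2) = (int (Suc (Suc n)))\<^sup>2 + k * int (Suc (Suc n)) + h"
      using 2 by (simp add: power2_eq_square algebra_simps)
    then show ?case using 1 2 3 by blast
  qed
  then show ?thesis by (metis of_nat_0_le_iff)
qed

section \<open>Polynomials attached to the points Frob +- Q\<close>

lemma prod_linear_dvd:
  fixes p :: "'b::idom poly"
  assumes "finite E" "\<And>e. e \<in> E \<Longrightarrow> poly p e = 0"
  shows "(\<Prod>e\<in>E. [:- e, 1:]) dvd p"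
  using assms
proof (induction E)
  case (insert a E)
  then obtain k where k: "p = (\<Prod>e\<in>E. [:- e, 1:]) * k" by (auto elim: dvdE)
  have "poly (\<Prod>e\<in>E. [:- e, 1:]) a \<noteq> 0" using insert.hyps by (auto simp: poly_prod)
  moreover have "poly p a = 0" using insert.prems by simp
  ultimately have "poly k a = 0" unfolding k by simp
  then have "[:- a, 1:] dvd k" by (simp add: poly_eq_0_iff_dvd)
  then show ?case unfolding k prod.insert[OF insert.hyps]
    by (metis mult.commute mult_dvd_mono dvd_refl)
qed simp

lemma degree_prod_linear: "degree (\<Prod>e\<in>E. [:- e, 1:] :: 'b::idom poly) = card E"
  by (subst degree_prod_eq_sum_degree) auto

lemma monic_dvd_eq:
  fixes p q :: "'b::idom poly"
  assumes "p dvd q" "degree q = degree p" "lead_coeff p = 1" "lead_coeff q = 1"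
  shows "p = q"
proof -
  obtain k where k: "q = p * k" using assms(1) by (elim dvdE)
  have nz: "p \<noteq> 0" "k \<noteq> 0" using assms(4) k by auto
  then have "degree k = 0" using assms(2) unfolding k by (simp add: degree_mult_eq)
  moreover have "lead_coeff k = 1" using assms(3,4) unfolding k by (simp add: lead_coeff_mult)
  ultimately have "k = 1" by (metis degree_0_id lead_coeff_pCons(2) coeff_pCons_0 one_pCons degree_eq_zeroE)
  then show ?thesis using k by simp
qed

lemma poly_X [simp]: "poly X x = x" by (simp add: X_def)

lemma X_power: "X ^ k = monom 1 k"
  by (simp add: X_def monom_altdef)

context binary_field
begin

lemma poly_two_eq_0 [simp]: "(2::'a poly) = 0"
  by (simp add: numeral_poly)

lemma poly_add_self: "p + p = (0::'a poly)"
  by (simp flip: mult_2)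

lemma poly_square_add: "(p + p')\<^sup>2 = p\<^sup>2 + (p'::'a poly)\<^sup>2"
proof -
  have "(p + p')\<^sup>2 = p\<^sup>2 + p'\<^sup>2 + 2 * p * p'" by (rule power2_sum)
  then show ?thesis by simp
qed

lemma poly_sum_square: "(\<Sum>i\<in>A. f i :: 'a poly)\<^sup>2 = (\<Sum>i\<in>A. (f i)\<^sup>2)"
  by (induction A rule: infinite_finite_induct) (auto simp: poly_square_add)

text \<open>The square root of \<open>X ^ 2 ^ r\<close>. It is the power that clears the
  denominators of \<open>tr (b / X)\<close>.\<close>

definition X_half :: "'a poly" where "X_half = X ^ 2 ^ (r - 1)"

lemma two_power_r: "2 * 2 ^ (r - 1) = (2 ^ r :: nat)"
  using r_pos by (cases r) auto

lemma X_half_square: "X_half\<^sup>2 = X ^ 2 ^ r" "X_half * X_half = X ^ 2 ^ r"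
  using two_power_r by (simp_all add: X_half_def power2_eq_square mult_2 flip: power_add)

text \<open>This is \<open>X\<^bsup>q/2\<^esup> (tr (X + b / X) + c)\<close>.\<close>
definition trace_poly :: "'a \<Rightarrow> 'a \<Rightarrow> 'a poly" where
  "trace_poly b c = (\<Sum>i<r. X_half * X ^ 2 ^ i + [:b ^ 2 ^ i:] * X ^ (2 ^ (r - 1) - 2 ^ i)) + [:c:] * X_half"

text \<open>For \<open>S = tr (X + b / X) + c\<close> the sum \<open>S^2 + S\<close> telescopes to
  \<open>X^q + b / X^q + X + b / X\<close>, because \<open>b^q = b\<close> and
  \<open>c^2 = c\<close>. Multiplication by \<open>X^(q + 1)\<close> gives the claim.\<close>

lemma trace_poly_quadratic:
  assumes "c = 0 \<or> c = 1"
  shows "X * ((trace_poly b c)\<^sup>2 + X_half * trace_poly b c) = (X * X ^ 2 ^ r + [:b:]) * (X ^ 2 ^ r + X)"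
proof -
  define Y where "Y i = X_half * X ^ 2 ^ i + [:b ^ 2 ^ i:] * X ^ (2 ^ (r - 1) - 2 ^ i)" for i
  define Z where "Z i = X ^ 2 ^ r * X ^ 2 ^ i + [:b ^ 2 ^ i:] * X ^ (2 ^ r - 2 ^ i)" for i
  have Y: "(Y i)\<^sup>2 = Z (Suc i)" "X_half * Y i = Z i" if "i < r" for i
  proof -
    have le: "2 ^ i \<le> (2 ^ (r - 1) :: nat)" using that by (intro power_increasing) auto
    have c2: "[:x:]\<^sup>2 = [:x\<^sup>2:]" for x :: 'a by (simp add: power2_eq_square)
    have "(2 ^ (r - 1) - 2 ^ i) * 2 = (2 ^ r - 2 ^ Suc i :: nat)"
      using two_power_r by (simp add: diff_mult_distrib)
    then show "(Y i)\<^sup>2 = Z (Suc i)"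
      unfolding Y_def Z_def poly_square_add power_mult_distrib X_half_square c2
      by (simp only: power_mult[symmetric] power_Suc2)
    have "X_half * X ^ (2 ^ (r - 1) - 2 ^ i) = X ^ (2 ^ r - 2 ^ i)"
      unfolding X_half_def power_add[symmetric] two_power_r[symmetric] using le by (simp add: mult_2)
    moreover have "X_half * ([:x:] * p) = [:x:] * (X_half * p)" for x p by simp
    ultimately show "X_half * Y i = Z i"
      unfolding Y_def Z_def distrib_left mult.assoc[symmetric] X_half_square
      by (simp only: mult.assoc)
  qed
  have "(\<Sum>i<r. Z (Suc i)) + (\<Sum>i<r. Z i) = Z r + Z 0"
  proof -
    have "(\<Sum>i<r. Z (Suc i)) + Z 0 = (\<Sum>i<Suc r. Z i)"
      by (subst sum.lessThan_Suc_shift) (simp add: add.commute)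
    also have "\<dots> = (\<Sum>i<r. Z i) + Z r" by simp
    finally have "(\<Sum>i<r. Z (Suc i)) = (\<Sum>i<r. Z i) + Z r - Z 0" by (simp add: eq_diff_eq)
    then have "(\<Sum>i<r. Z (Suc i)) + (\<Sum>i<r. Z i) = Z r + Z 0 + 2 * ((\<Sum>i<r. Z i) - Z 0)"
      by (simp only: ring_distribs mult_2) simp
    then show ?thesis by (simp only: poly_two_eq_0 mult_zero_left add_0_right)
  qed
  moreover have "([:c:] * X_half)\<^sup>2 = X_half * ([:c:] * X_half)"
    using assms by (auto simp: power2_eq_square simp flip: one_pCons)
  ultimately have "(trace_poly b c)\<^sup>2 + X_half * trace_poly b c = Z r + Z 0 + ([:c:] * X_half)\<^sup>2 + ([:c:] * X_half)\<^sup>2"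
    unfolding trace_poly_def Y_def[symmetric] poly_square_add poly_sum_square distrib_left sum_distrib_left
    using Y by (simp add: algebra_simps)
  also have "\<dots> = Z r + Z 0" by (simp only: add.assoc poly_add_self add_0_right)
  finally have *: "(trace_poly b c)\<^sup>2 + X_half * trace_poly b c = Z r + Z 0" .
  have "X * X ^ (2 ^ r - 1) = (X ^ 2 ^ r :: 'a poly)"
    by (simp flip: power_Suc)
  then have "X * (Z r + Z 0) = X * X ^ 2 ^ r * X ^ 2 ^ r + [:b:] * X + X * X ^ 2 ^ r * X + [:b:] * X ^ 2 ^ r"
    unfolding Z_def by (simp add: algebra_simps)
  also have "\<dots> = (X * X ^ 2 ^ r + [:b:]) * (X ^ 2 ^ r + X)"
    by (simp add: algebra_simps)
  finally show ?thesis unfolding * .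
qed

lemma poly_trace_poly:
  assumes "e \<noteq> 0"
  shows "poly (trace_poly b c) e = e ^ 2 ^ (r - 1) * (tr (e + b * inverse e) + c)"
proof -
  have "e ^ (2 ^ (r - 1) - 2 ^ i) = e ^ 2 ^ (r - 1) * inverse e ^ 2 ^ i" if "i < r" for i
  proof -
    have "2 ^ i \<le> (2 ^ (r - 1) :: nat)" using that by (intro power_increasing) auto
    then show ?thesis using assms by (simp add: power_diff field_simps)
  qed
  then show ?thesis
    unfolding trace_poly_def field_tr_def frob_add
    by (simp add: X_half_def poly_sum sum_distrib_left distrib_left power_mult_distrib mult_ac sum.distrib
        cong: sum.cong_simp)
qed

text \<open>Only the summand \<open>i = r - 1\<close> contains a constant term. For nonzero
  \<open>b\<close> the value is nonzero, so no second factor \<open>X\<close> cancels in the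
  abscissa.\<close>

lemma poly_trace_poly_0: "poly (trace_poly b c) 0 = b ^ 2 ^ (r - 1)"
proof -
  have 1: "(2 ^ (r - 1) - 2 ^ i = (0::nat)) \<longleftrightarrow> i = r - 1" if "i < r" for i
    using that by auto
  have "poly (trace_poly b c) 0 = (\<Sum>i<r. b ^ 2 ^ i * (if 2 ^ (r - 1) - 2 ^ i = (0::nat) then 1 else 0))"
    unfolding trace_poly_def by (simp add: X_half_def poly_sum power_0_left)
  also have "\<dots> = (\<Sum>i<r. if i = r - 1 then b ^ 2 ^ i else 0)"
    by (intro sum.cong refl, subst 1) auto
  finally have "poly (trace_poly b c) 0 = (\<Sum>i<r. if i = r - 1 then b ^ 2 ^ i else 0)" .
  then show ?thesis using r_pos by simp
qed

text \<open>The leading term comes from \<open>i = r - 1\<close> alone, where \<open>X_half\<close>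
  is multiplied by itself.\<close>

lemma degree_trace_poly: "degree (trace_poly b c) = 2 ^ r" "trace_poly b c \<noteq> 0"
proof -
  have le: "2 ^ (r - 1) + 2 ^ i \<le> (2 ^ r :: nat)" "2 ^ (r - 1) + 2 ^ i = (2 ^ r :: nat) \<longleftrightarrow> i = r - 1" if "i < r" for i
  proof -
    have "2 ^ i \<le> (2 ^ (r - 1) :: nat)" using that by (intro power_increasing) auto
    then show "2 ^ (r - 1) + 2 ^ i \<le> (2 ^ r :: nat)" using two_power_r by linarith
    show "2 ^ (r - 1) + 2 ^ i = (2 ^ r :: nat) \<longleftrightarrow> i = r - 1"
      unfolding two_power_r[symmetric] by simp
  qed
  have M: "trace_poly b c = (\<Sum>i<r. monom 1 (2 ^ (r - 1) + 2 ^ i) + monom (b ^ 2 ^ i) (2 ^ (r - 1) - 2 ^ i)) +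
      monom c (2 ^ (r - 1))"
    unfolding trace_poly_def X_half_def X_power by (simp add: mult_monom smult_monom)
  have lt: "2 ^ (r - 1) < (2 ^ r :: nat)" using r_pos by simp
  have "degree (trace_poly b c) \<le> 2 ^ r" unfolding M
    using le(1) lt
    by (intro degree_add_le degree_sum_le order.trans[OF degree_monom_le]) (auto intro: diff_le_self order.trans)
  moreover have "coeff (trace_poly b c) (2 ^ r) =
      (\<Sum>i<r. coeff (monom 1 (2 ^ (r - 1) + 2 ^ i) + monom (b ^ 2 ^ i) (2 ^ (r - 1) - 2 ^ i)) (2 ^ r))"
    unfolding M coeff_add coeff_sum using lt by simp
  moreover have "2 ^ (r - 1) - k \<noteq> (2 ^ r :: nat)" for k :: nat
    using lt by linarith
  then have "(\<Sum>i<r. coeff (monom 1 (2 ^ (r - 1) + 2 ^ i) + monom (b ^ 2 ^ i) (2 ^ (r - 1) - 2 ^ i)) (2 ^ r)) =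
      (\<Sum>i<r. if i = r - 1 then 1 else 0)"
    using le(2) by (intro sum.cong) simp_all
  ultimately have "coeff (trace_poly b c) (2 ^ r) = 1" "degree (trace_poly b c) \<le> 2 ^ r" using r_pos by simp_all
  then show "degree (trace_poly b c) = 2 ^ r" "trace_poly b c \<noteq> 0"
    using le_degree[of "trace_poly b c" "2 ^ r"] by auto
qed

lemma prod_all_linear: "(\<Prod>e\<in>(UNIV::'a set). [:- e, 1:]) = X ^ 2 ^ r + X"
proof (rule monic_dvd_eq)
  have lt: "1 < (2::nat) ^ r" using r_pos by (intro one_less_power) auto
  have "degree (X :: 'a poly) = 1" by (simp add: X_def)
  then have d: "degree (X ^ 2 ^ r + X :: 'a poly) = 2 ^ r"
    using lt by (subst degree_add_eq_left) (auto simp: X_power degree_monom_eq)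
  show "(\<Prod>e\<in>(UNIV::'a set). [:- e, 1:]) dvd X ^ 2 ^ r + X"
    by (rule prod_linear_dvd) auto
  show "degree (X ^ 2 ^ r + X :: 'a poly) = degree (\<Prod>e\<in>(UNIV::'a set). [:- e, 1:])"
    by (simp only: d degree_prod_linear card_field)
  show "lead_coeff (\<Prod>e\<in>(UNIV::'a set). [:- e, 1:]) = 1"
    by (simp add: lead_coeff_prod)
  have "coeff (X :: 'a poly) (2 ^ r) = 0" using lt \<open>degree X = 1\<close> by (intro coeff_eq_0) simp
  then show "lead_coeff (X ^ 2 ^ r + X :: 'a poly) = 1"
    unfolding d by (simp add: X_power)
qed

text \<open>
  The abscissa of \<open>Frob \<plusminus> Q\<close> is \<open>X M\<^sup>2 / (X\<^sup>q + X)\<^sup>2\<close> with \<open>M = trace_poly b c\<close>, where \<open>c = 0\<close> for the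
  sum and \<open>c = 1\<close> for the difference. The linear factors of the denominator that cancel are \<open>X\<close>, once,
  and \<open>X - e\<close>, twice, for each \<open>e \<in> Z\<close>.
\<close>
lemma frobenius_plus_point:
  fixes b c :: 'a
  assumes b: "b \<noteq> 0" and c: "c = 0 \<or> c = 1"
  defines "Z \<equiv> {e. e \<noteq> 0 \<and> tr (e + b * inverse e) = c}"
  obtains f g :: "'a poly" where "unimodular f g" "step_rel b (X ^ 2 ^ r) 1 f g = 0"
    "height f g + 2 * card Z = 2 * 2 ^ r"
proof -
  \<comment> \<open>\<open>G\<close> collects the linear factors other than \<open>X\<close> that
    cancel, \<open>R\<close> those of \<open>X ^ 2 ^ r + X\<close> that stay in the
    denominator.\<close>
  define G where "G = (\<Prod>e\<in>Z. [:- e, 1:])"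
  define R where "R = (\<Prod>e\<in>UNIV - {0} - Z. [:- e, 1:])"
  have GR: "X * G * R = X ^ 2 ^ r + X"
  proof -
    have "UNIV - {0} - Z = - insert 0 Z" by auto
    moreover have "0 \<notin> Z" by (simp add: Z_def)
    then have "(\<Prod>e\<in>insert 0 Z. [:- e, 1:]) = X * G"
      unfolding G_def by (subst prod.insert) (auto simp: X_def)
    ultimately show ?thesis
      unfolding R_def prod_all_linear[symmetric]
      by (metis Compl_partition Compl_disjoint finite prod.union_disjoint)
  qed
  have "G dvd trace_poly b c" unfolding G_def
    by (rule prod_linear_dvd) (auto simp: Z_def poly_trace_poly)
  then obtain M1 where M1: "trace_poly b c = G * M1" by (elim dvdE)
  have dG: "degree G = card Z" by (simp only: G_def degree_prod_linear)
  have nzG: "G \<noteq> 0" "M1 \<noteq> 0" using degree_trace_poly(2)[of b c] M1 by auto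
  have dM1: "degree M1 + card Z = 2 ^ r"
    using degree_trace_poly(1)[of b c] nzG dG unfolding M1 by (simp add: degree_mult_eq)
  have cardR: "card (UNIV - {0} - Z) + card Z + 1 = 2 ^ r"
  proof -
    have "card (insert 0 Z) + card (- insert 0 Z) = 2 ^ r"
      unfolding card_field[symmetric] by (subst card_Un_disjoint[symmetric]) auto
    moreover have "0 \<notin> Z" by (simp add: Z_def)
    moreover have "UNIV - {0} - Z = - insert 0 Z" by auto
    ultimately show ?thesis by simp
  qed
  have dR: "degree R = card (UNIV - {0} - Z)" "R \<noteq> 0"
    unfolding R_def degree_prod_linear by auto
  have root: "poly M1 e \<noteq> 0" if "e \<notin> Z" for e
  proof -
    have "poly (trace_poly b c) e \<noteq> 0"
    proof (cases "e = 0")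
      case True
      then show ?thesis using b by (simp add: poly_trace_poly_0)
    next
      case False
      then show ?thesis using that by (simp add: poly_trace_poly Z_def add_eq_0)
    qed
    then show ?thesis unfolding M1 by simp
  qed
  have "unimodular M1 R" unfolding R_def
    by (intro unimodular_prod unimodular_linear root) auto
  moreover have "unimodular M1 [:- 0, 1:]"
    by (intro unimodular_linear root) (auto simp: Z_def)
  then have "unimodular M1 X" unfolding X_def by simp
  ultimately have "unimodular M1 (X * (R * R))" by (intro unimodular_mult)
  then have uni: "unimodular (M1\<^sup>2) (X * R\<^sup>2)"
    using unimodular_power[of M1 "X * (R * R)" 2 1] by (simp add: power2_eq_square)
  have "height (M1\<^sup>2) (X * R\<^sup>2) + 2 * card Z = 2 * 2 ^ r"
  proof -
    have "degree (M1\<^sup>2) = 2 * degree M1" using nzG by (simp add: degree_power_eq)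
    moreover have "degree (X * R\<^sup>2) = 1 + 2 * degree R" using dR(2)
      by (subst degree_mult_eq) (auto simp: degree_power_eq X_def)
    ultimately show ?thesis using dM1 cardR dR(1) by (simp add: height_def)
  qed
  moreover have "step_rel b (X ^ 2 ^ r) 1 (M1\<^sup>2) (X * R\<^sup>2) = 0"
  proof -
    let ?w = "X ^ 2 ^ r :: 'a poly"
    let ?M = "trace_poly b c"
    \<comment> \<open>Multiplying by \<open>(X G^2)^2\<close> undoes the cancellation: the pair
      becomes \<open>X M^2\<close> over \<open>(X^q + X)^2\<close>.\<close>
    have "(X * G\<^sup>2)\<^sup>2 * step_rel b ?w 1 (M1\<^sup>2) (X * R\<^sup>2)
        = ?w\<^sup>2 * (X * ?M\<^sup>2)\<^sup>2 + X\<^sup>2 * (?w\<^sup>2 * ((X * G * R)\<^sup>2)\<^sup>2 + (X * ?M\<^sup>2)\<^sup>2) +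
          X * ?w * (X * ?M\<^sup>2) * (X * G * R)\<^sup>2 + [:b:]\<^sup>2 * ((X * G * R)\<^sup>2)\<^sup>2"
      unfolding step_rel_def M1 by (simp only: power2_eq_square algebra_simps mult_1_left mult_1_right)
    also have "\<dots> = (?w\<^sup>2 + X\<^sup>2) * (X * ?M\<^sup>2)\<^sup>2 + (X\<^sup>2 * ?w\<^sup>2 + [:b:]\<^sup>2) * ((?w + X)\<^sup>2)\<^sup>2 +
          X * ?w * (X * ?M\<^sup>2) * (?w + X)\<^sup>2"
      unfolding GR by (simp only: algebra_simps)
    also have "\<dots> = (?w + X)\<^sup>2 * ((X * ?M\<^sup>2)\<^sup>2 + X\<^sup>2 * ?w * ?M\<^sup>2 + (X\<^sup>2 * ?w\<^sup>2 + [:b:]\<^sup>2) * (?w + X)\<^sup>2)"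
      unfolding poly_square_add[symmetric] by (simp only: power2_eq_square algebra_simps)
    \<comment> \<open>In characteristic 2 this factor is a perfect square, as \<open>X^q\<close> is
      the square of \<open>X_half\<close>; its root vanishes by
      \<open>trace_poly_quadratic\<close>.\<close>
    also have "(X * ?M\<^sup>2)\<^sup>2 + X\<^sup>2 * ?w * ?M\<^sup>2 + (X\<^sup>2 * ?w\<^sup>2 + [:b:]\<^sup>2) * (?w + X)\<^sup>2 =
        (X * (?M\<^sup>2 + X_half * ?M) + (X * ?w + [:b:]) * (?w + X))\<^sup>2"
      unfolding poly_square_add power_mult_distrib X_half_square distrib_left by (simp only: mult_ac)
    also have "\<dots> = 0" unfolding trace_poly_quadratic[OF c] by (simp only: poly_add_self) simp
    finally have "(X * G\<^sup>2)\<^sup>2 * step_rel b ?w 1 (M1\<^sup>2) (X * R\<^sup>2) = 0" by simp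
    moreover have "(X * G\<^sup>2)\<^sup>2 \<noteq> 0" using nzG by (simp add: X_def)
    ultimately show ?thesis by (metis mult_eq_0_iff)
  qed
  ultimately show ?thesis using that[OF uni] by blast
qed

section \<open>From heights to the bound and congruence for Kloosterman sums\<close>

lemma kloosterman_card:
  fixes b c :: 'a
  defines "Z \<equiv> \<lambda>c. {e. e \<noteq> 0 \<and> tr (e + b * inverse e) = c}"
  shows "2 * int (card (Z 0)) = 2 ^ r - 1 + kloosterman r b"
    and "2 * int (card (Z 1)) = 2 ^ r - 1 - kloosterman r b"
proof -
  have U: "UNIV - {0} = Z 0 \<union> Z 1" and dj: "Z 0 \<inter> Z 1 = {}"
    unfolding Z_def using tr_cases by auto
  have "kloosterman r b = (\<Sum>e\<in>Z 0. 1) + (\<Sum>e\<in>Z 1. - 1)"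
    unfolding kloosterman_def U
    by (subst sum.union_disjoint) (use dj in \<open>auto simp: Z_def add_char_def\<close>)
  then have K: "kloosterman r b = int (card (Z 0)) - int (card (Z 1))" by simp
  have "card (UNIV - {0::'a}) = card (Z 0) + card (Z 1)"
    unfolding U by (rule card_Un_disjoint) (use dj in auto)
  moreover have "card (UNIV - {0::'a}) = 2 ^ r - 1" by (simp add: card_Diff_singleton card_field)
  ultimately have "2 ^ r = card (Z 0) + card (Z 1) + 1"
    by (metis add.commute le_add_diff_inverse one_le_numeral one_le_power)
  then have "(2::int) ^ r = int (card (Z 0)) + int (card (Z 1)) + 1"
    by (metis of_nat_1 of_nat_add of_nat_numeral of_nat_power)
  then show "2 * int (card (Z 0)) = 2 ^ r - 1 + kloosterman r b"
    "2 * int (card (Z 1)) = 2 ^ r - 1 - kloosterman r b" using K by linarith+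
qed

text \<open>The choices \<open>c = 0\<close> and \<open>c = 1\<close> start the sequence in opposite
  directions and give the linear coefficients \<open>- K\<close> and \<open>K\<close>; the one equal
  to \<open>- |K|\<close> is used.\<close>

lemma kloosterman_quadratic:
  assumes b: "b \<noteq> (0::'a)"
  shows "0 \<le> (int n)\<^sup>2 - \<bar>kloosterman r b\<bar> * int n + 2 ^ r"
proof -
  have *: "0 \<le> (int n)\<^sup>2 + (2 ^ r - 1 - 2 * int (card {e. e \<noteq> 0 \<and> tr (e + b * inverse e) = c})) * int n + 2 ^ r"
    if c: "c = 0 \<or> c = 1" for c :: 'a
  proof -
    obtain f g :: "'a poly" where fg: "unimodular f g" "step_rel b (X ^ 2 ^ r) 1 f g = 0"
      "height f g + 2 * card {e. e \<noteq> 0 \<and> tr (e + b * inverse e) = c} = 2 * 2 ^ r"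
      by (rule frobenius_plus_point[OF b c])
    have h0: "int (height (X ^ 2 ^ r) (1 :: 'a poly)) = 2 ^ r"
      by (simp add: height_def X_power degree_monom_eq)
    have "int (height f g) + 2 * int (card {e. e \<noteq> 0 \<and> tr (e + b * inverse e) = c}) = 2 * 2 ^ r"
      using arg_cong[OF fg(3), of int] by simp
    then show ?thesis
      by (intro height_sequence[OF unimodular_1 fg(1) b fg(2) h0]) simp
  qed
  show ?thesis
    using *[of 0] *[of 1] kloosterman_card[of b]
    by (cases "0 \<le> kloosterman r b") (auto simp: algebra_simps)
qed

lemma kloosterman_scale:
  assumes "b \<noteq> (0::'a)"
  shows "(\<Sum>x\<in>UNIV - {0}. add_char r (b * (x + inverse x))) = kloosterman r (b\<^sup>2)"
proof -
  have "b * (\<alpha> / b + inverse (\<alpha> / b)) = \<alpha> + b\<^sup>2 * inverse \<alpha>" if "\<alpha> \<noteq> 0" for \<alpha>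
    using that assms by (simp add: distrib_left power2_eq_square inverse_eq_divide)
  then have "kloosterman r (b\<^sup>2) = (\<Sum>x\<in>UNIV - {0}. add_char r (b * (x + inverse x)))"
    unfolding kloosterman_def using assms
    by (intro sum.reindex_bij_witness[where i="\<lambda>x. b * x" and j="\<lambda>x. x / b"]) auto
  then show ?thesis ..
qed

text \<open>The substitution \<open>\<alpha> = x b\<close> with \<open>b\<^sup>2 = a\<close> makes the summand invariant under \<open>x \<mapsto> 1 / x\<close>.\<close>
lemma kloosterman_mod_4:
  assumes a: "a \<noteq> (0::'a)" and r: "2 \<le> r"
  shows "[kloosterman r a = - 1] (mod 4)"
proof -
  obtain b where b: "a = b\<^sup>2" using bij_is_surj[OF square_bij] by (rule surjE)
  have b0: "b \<noteq> 0" using a b by auto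
  let ?g = "\<lambda>x::'a. x + inverse x"
  have "kloosterman r a = (\<Sum>x\<in>UNIV - {0}. add_char r (b * ?g x))"
    unfolding b by (rule kloosterman_scale[OF b0, symmetric])
  also have "\<dots> = (\<Sum>t\<in>UNIV. \<Sum>x\<in>{x\<in>UNIV - {0}. ?g x = t}. add_char r (b * ?g x))"
    by (intro sum.group[symmetric]) auto
  also have "\<dots> = (\<Sum>t\<in>UNIV. int (card {x. x \<noteq> 0 \<and> ?g x = t}) * add_char r (b * t))"
    by (intro sum.cong) auto
  \<comment> \<open>The value \<open>t = 0\<close> is attained only at \<open>x = 1\<close> and
    contributes the summand 1.\<close>
  also have "\<dots> = 1 + (\<Sum>t\<in>UNIV - {0}. (1 + add_char r (inverse t)) * add_char r (b * t))"
    by (subst sum.remove[where x=0]) (auto simp: card_add_inverse add_inverse_eq_0 intro!: sum.cong)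
  also have "(\<Sum>t\<in>UNIV - {0}. (1 + add_char r (inverse t)) * add_char r (b * t)) =
      (\<Sum>t\<in>{t. t \<noteq> 0 \<and> tr (inverse t) = 0}. 2 * add_char r (b * t))"
    by (intro sum.mono_neutral_cong_right) (auto simp: add_char_def)
  \<comment> \<open>A character value is 1 or \<open>1 - 2\<close>, so its double is always 2 modulo
    4.\<close>
  also have "\<dots> = (\<Sum>t\<in>{t. t \<noteq> 0 \<and> tr (inverse t) = 0}. 2 - 4 * (if tr (b * t) = 0 then 0 else 1))"
    by (intro sum.cong) (auto simp: add_char_def)
  also have "\<dots> = 2 * int (card {t. t \<noteq> 0 \<and> tr (inverse t) = 0}) -
      4 * (\<Sum>t\<in>{t. t \<noteq> 0 \<and> tr (inverse t) = 0}. if tr (b * t) = 0 then 0 else 1)"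
    by (simp add: sum_subtractf sum_distrib_left)
  also have "card {t. t \<noteq> 0 \<and> tr (inverse t) = 0} = card ({x. tr x = 0} - {0})"
    by (rule bij_betw_same_card[where f=inverse])
      (auto intro!: bij_betwI[where g=inverse])
  also have "\<dots> = 2 ^ (r - 1) - 1" by (simp add: card_Diff_singleton card_tr_0)
  finally obtain m where m: "kloosterman r a = 1 + (2 * int (2 ^ (r - 1) - 1) - 4 * m)" by blast
  \<comment> \<open>For \<open>r >= 2\<close> the term \<open>2 * 2 ^ (r - 1)\<close> is divisible
    by 4, and \<open>1 - 2 = - 1\<close> is left.\<close>
  obtain k where k: "r = Suc (Suc k)" using r by (metis add_2_eq_Suc le_Suc_ex)
  have "kloosterman r a - (- 1) = 4 * (2 ^ k - m)"
    using m unfolding k by (simp add: of_nat_diff)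
  then show ?thesis unfolding cong_iff_dvd_diff by (metis dvd_triv_left)
qed

text \<open>For odd \<open>|K| = 2 k + 1\<close> an integer nearest to the vertex of the quadratic
  is \<open>k\<close>. Evaluating there gives \<open>k (k + 1) <= q\<close>, and strict inequality
  between these integers gives \<open>K^2 = 4 k (k + 1) + 1 < 4 q\<close>.\<close>

lemma kloosterman_bound:
  assumes a: "a \<noteq> (0::'a)" and r: "2 \<le> r"
  shows "\<bar>real_of_int (kloosterman r a)\<bar> < 2 * sqrt (2 ^ r)"
proof -
  define K where "K = \<bar>kloosterman r a\<bar>"
  have "odd (kloosterman r a)"
    using kloosterman_mod_4[OF assms] unfolding cong_iff_dvd_diff by presburger
  then have "odd K" unfolding K_def by simp
  then obtain k where k: "K = 2 * k + 1" by (elim oddE)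
  have k0: "0 \<le> k" using k unfolding K_def by linarith
  have "0 \<le> k\<^sup>2 - K * k + 2 ^ r"
    using kloosterman_quadratic[OF a, of "nat k"] k0 unfolding K_def by simp
  then have 1: "k * (k + 1) \<le> 2 ^ r" unfolding k by (simp add: power2_eq_square algebra_simps)
  have "k * (k + 1) \<noteq> 2 ^ r"
  proof
    assume eq: "k * (k + 1) = 2 ^ r"
    \<comment> \<open>As \<open>q >= 4\<close>, neither \<open>k = 0\<close> nor
      \<open>k = 1\<close> is possible, so both factors exceed 1 and the odd one would be a
      nontrivial odd divisor of a power of 2.\<close>
    have "2 ^ 2 \<le> (2 ^ r :: int)" using r by (intro power_increasing) auto
    moreover have "k = 0 \<or> k = 1 \<or> 1 < k" using k0 by linarith
    ultimately have k1: "1 < k" using eq by auto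
    have "\<exists>d. odd d \<and> 1 < d \<and> d dvd (2 ^ r :: int)"
    proof (cases "odd k")
      case True
      then show ?thesis using eq k1 by (metis dvd_triv_left)
    next
      case False
      then have "odd (k + 1)" "1 < k + 1" "k + 1 dvd 2 ^ r" using eq k1 by (auto simp flip: eq)
      then show ?thesis by blast
    qed
    then obtain d where d: "odd d" "1 < d" "d dvd (2 ^ r :: int)" by blast
    then have "coprime d (2 ^ r)" by simp
    then have "is_unit d" using d(3) by (rule coprime_common_divisor[OF _ dvd_refl])
    then show False using d(2) by simp
  qed
  then have "k * (k + 1) < 2 ^ r" using 1 by linarith
  then have "K\<^sup>2 < 4 * 2 ^ r"
  proof -
    have "K\<^sup>2 = 4 * (k * (k + 1)) + 1" unfolding k by (simp add: power2_eq_square algebra_simps)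
    then show ?thesis using \<open>k * (k + 1) < 2 ^ r\<close> by linarith
  qed
  then have "real_of_int (K\<^sup>2) < real_of_int (4 * 2 ^ r)" by (simp only: of_int_less_iff)
  then have "(real_of_int K)\<^sup>2 < 4 * 2 ^ r" by simp
  then have "real_of_int K < sqrt (4 * 2 ^ r)" by (rule real_less_rsqrt)
  then show ?thesis by (simp add: K_def real_sqrt_mult)
qed

end

section \<open>Traces on the double cosets\<close>

context binary_field
begin

section \<open>Matrices of size 1 and 2 with prescribed sum of trace and inverse trace\<close>

lemma card_nonzero: "card (UNIV - {0::'a}) = 2 ^ r - 1"
  by (simp add: card_Diff_singleton card_field)

lemma inv_trace_count_1: "inv_trace_count 1 \<beta> = card {x::'a. x \<noteq> 0 \<and> x + inverse x = \<beta>}"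
  unfolding inv_trace_count_def
proof (rule bij_betw_same_card[THEN sym])
  let ?m = "\<lambda>x::'a. mat 1 1 (\<lambda>_. x)"
  have GL: "?m x \<in> GL 1" if "x \<noteq> 0" for x using that by (simp add: GL_def det_single)
  have minv: "minv (?m x) = ?m (inverse x)" if "x \<noteq> 0" for x
    using that by (intro minv_unique[OF GL[OF that]]) (auto simp: scalar_prod_def intro!: eq_matI)
  have surj: "\<exists>x. x \<noteq> 0 \<and> M = ?m x" if "M \<in> GL 1" for M
  proof (intro exI conjI)
    show "M $$ (0, 0) \<noteq> 0" using that by (auto simp: GL_def det_single)
    show "M = ?m (M $$ (0, 0))" using GL_carrier[OF that] by (intro eq_matI) auto
  qed
  have inj: "x = y" if "?m x = ?m y" for x y
    using arg_cong[OF that, of "\<lambda>M. M $$ (0, 0)"] by simp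
  show "bij_betw ?m {x. x \<noteq> 0 \<and> x + inverse x = \<beta>} {M \<in> GL 1. mat_trace M + mat_trace (minv M) = \<beta>}"
    unfolding bij_betw_def
  proof
    show "inj_on ?m {x. x \<noteq> 0 \<and> x + inverse x = \<beta>}" using inj by (auto intro: inj_onI)
    show "?m ` {x. x \<noteq> 0 \<and> x + inverse x = \<beta>} = {M \<in> GL 1. mat_trace M + mat_trace (minv M) = \<beta>}"
    proof (intro equalityI subsetI)
      fix M assume "M \<in> ?m ` {x. x \<noteq> 0 \<and> x + inverse x = \<beta>}"
      then show "M \<in> {M \<in> GL 1. mat_trace M + mat_trace (minv M) = \<beta>}"
        using GL minv by (auto simp: mat_trace_def)
    next
      fix M assume M: "M \<in> {M \<in> GL 1. mat_trace M + mat_trace (minv M) = \<beta>}"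
      then obtain x where x: "x \<noteq> 0" "M = ?m x" using surj by blast
      then have "x + inverse x = \<beta>" using M minv[OF x(1)] by (simp add: mat_trace_def)
      then show "M \<in> ?m ` {x. x \<noteq> 0 \<and> x + inverse x = \<beta>}" using x by blast
    qed
  qed
qed

lemma card_product_fibre:
  "int (card {(b, c). b * c = (e::'a)}) = 2 ^ r - 1 + (if e = 0 then 2 ^ r else 0)"
proof (cases "e = 0")
  case True
  have "{(b, c). b * c = (0::'a)} = ({0} \<times> UNIV) \<union> ((UNIV - {0}) \<times> {0})" by auto
  moreover have "card (({0::'a} \<times> (UNIV::'a set)) \<union> ((UNIV - {0::'a}) \<times> {0::'a})) = 2 ^ r + (2 ^ r - 1)"
    by (subst card_Un_disjoint) (auto simp: card_cartesian_product card_nonzero[simplified] card_field)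
  ultimately have "card {(b, c). b * c = (0::'a)} + 1 = 2 ^ r + 2 ^ r" by (simp only:) simp
  from arg_cong[OF this, of int] show ?thesis using True by simp
next
  case False
  have "bij_betw (\<lambda>b. (b, e / b)) (UNIV - {0}) {(b, c). b * c = e}"
    using False by (intro bij_betwI[where g=fst]) auto
  then have "card {(b, c). b * c = e} = 2 ^ r - 1"
    unfolding card_nonzero[symmetric] by (rule bij_betw_same_card[THEN sym])
  then show ?thesis using False by (simp add: of_nat_diff)
qed

text \<open>The entries of the 2 by 2 matrices with trace \<open>T\<close> and determinant
  \<open>\<Delta>\<close>; in characteristic 2 the determinant is a sum.\<close>

definition char_poly_fibre :: "'a \<Rightarrow> 'a \<Rightarrow> ('a \<times> 'a \<times> 'a \<times> 'a) set" where
  "char_poly_fibre T \<Delta> = {(a, b, c, d). a + d = T \<and> a * d + b * c = \<Delta>}"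

text \<open>Eliminate \<open>d = T + a\<close>. The equation
  \<open>b c = \<Delta> + a (T + a)\<close> has \<open>q - 1\<close> solutions
  \<open>(b, c)\<close>, and \<open>q\<close> more when the right-hand side is 0. The latter happens
  for one \<open>a\<close> if \<open>T = 0\<close>, squaring being bijective; otherwise
  \<open>a = T z\<close> leads to an Artin-Schreier equation.\<close>

lemma card_char_poly_fibre:
  "int (card (char_poly_fibre T \<Delta>)) = 2 ^ r * (2 ^ r + (if T = 0 then 0 else add_char r (\<Delta> / T\<^sup>2)))"
proof -
  let ?e = "\<lambda>a. \<Delta> + a * (T + a)"
  have "bij_betw (\<lambda>(a, b, c). (a, b, c, T + a)) (SIGMA a:UNIV. {(b, c). b * c = ?e a}) (char_poly_fibre T \<Delta>)"
    by (rule bij_betwI[where g="\<lambda>(a, b, c, d). (a, b, c)"])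
      (auto simp: char_poly_fibre_def add_ac)
  then have "card (char_poly_fibre T \<Delta>) = card (SIGMA a:(UNIV::'a set). {(b, c). b * c = ?e a})"
    by (rule bij_betw_same_card[THEN sym])
  also have "\<dots> = (\<Sum>a\<in>UNIV. card {(b, c). b * c = ?e a})" by simp
  finally have "int (card (char_poly_fibre T \<Delta>)) = (\<Sum>a\<in>UNIV. 2 ^ r - 1 + (if ?e a = 0 then 2 ^ r else 0))"
    by (simp add: card_product_fibre)
  also have "\<dots> = 2 ^ r * (2 ^ r - 1) + 2 ^ r * int (card {a. ?e a = 0})"
    by (simp add: sum.distrib sum.If_cases card_field)
  also have "int (card {a. ?e a = 0}) = 1 + (if T = 0 then 0 else add_char r (\<Delta> / T\<^sup>2))"
  proof (cases "T = 0")
    case True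
    obtain d where d: "\<Delta> = d\<^sup>2" using bij_is_surj[OF square_bij] by (rule surjE)
    have "{a. ?e a = 0} = {d}"
      using True square_inj by (auto simp: d add_eq_0 power2_eq_square[symmetric] dest: injD)
    then show ?thesis using True by simp
  next
    case False
    have "bij_betw (\<lambda>z. T * z) {z. z\<^sup>2 + z = \<Delta> / T\<^sup>2} {a. ?e a = 0}"
    proof (rule bij_betwI[where g="\<lambda>a. a / T"])
      have *: "z\<^sup>2 + z = \<Delta> / T\<^sup>2 \<longleftrightarrow> ?e (T * z) = 0" for z
      proof -
        have "T * z * (T + T * z) = T\<^sup>2 * (z\<^sup>2 + z)" by (simp add: power2_eq_square algebra_simps)
        then show ?thesis using False by (auto simp: add_eq_0 field_simps)
      qed
      show "(\<lambda>z. T * z) \<in> {z. z\<^sup>2 + z = \<Delta> / T\<^sup>2} \<rightarrow> {a. ?e a = 0}" using * by auto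
      show "(\<lambda>a. a / T) \<in> {a. ?e a = 0} \<rightarrow> {z. z\<^sup>2 + z = \<Delta> / T\<^sup>2}"
        using *[of "_ / T"] False by auto
    qed (use False in auto)
    then have "card {a. ?e a = 0} = card {z. z\<^sup>2 + z = \<Delta> / T\<^sup>2}" by (rule bij_betw_same_card[THEN sym])
    then show ?thesis using False by (simp add: card_artin_schreier)
  qed
  finally show ?thesis by (simp add: algebra_simps)
qed

text \<open>The inverse of a 2 by 2 matrix has trace \<open>T / \<Delta>\<close>, so the condition
  depends on the characteristic polynomial alone.\<close>

lemma inv_trace_count_2_sum:
  "inv_trace_count 2 \<beta> = (\<Sum>(T, \<Delta>)\<in>{(T, \<Delta>). \<Delta> \<noteq> 0 \<and> T + T / \<Delta> = \<beta>}. card (char_poly_fibre T \<Delta>))"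
proof -
  let ?m = "\<lambda>(a, b, c, d). mat 2 2 (\<lambda>(i, j). if i = 0 then if j = 0 then a else b else if j = 0 then c else d :: 'a)"
  let ?D = "\<lambda>(a, b, c, d). a * d + b * c :: 'a"
  let ?T = "\<lambda>(a, b, c, d). a + d :: 'a"
  have det: "det (?m x) = ?D x" for x by (cases x) (simp add: det_two)
  have GL: "?m x \<in> GL 2 \<longleftrightarrow> ?D x \<noteq> 0" for x
    using det[of x] by (cases x) (simp add: GL_def)
  have tr_m: "mat_trace (?m x) = ?T x" for x
    by (cases x) (simp add: mat_trace_def numeral_2_eq_2)
  have tr_minv: "mat_trace (minv (?m x)) = ?T x / ?D x" if "?D x \<noteq> 0" for x
  proof -
    obtain a b c d where x: "x = (a, b, c, d)" by (cases x)
    let ?i = "\<lambda>y. y / ?D x"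
    have D: "a * d + b * c \<noteq> 0" using that x by simp
    have "minv (?m x) = ?m (?i d, ?i b, ?i c, ?i a)"
    proof (rule minv_unique)
      show "?m x \<in> GL 2" using GL that by blast
      have "?m x * ?m (?i d, ?i b, ?i c, ?i a) = 1\<^sub>m 2"
        using D unfolding x
        by (intro eq_matI) (auto simp: scalar_prod_def numeral_2_eq_2 less_Suc_eq add_divide_distrib[symmetric] mult_ac)
      then show "?m x * ?m (?i d, ?i b, ?i c, ?i a) = 1\<^sub>m 2 \<or> ?m (?i d, ?i b, ?i c, ?i a) * ?m x = 1\<^sub>m 2" ..
    qed simp
    then have "mat_trace (minv (?m x)) = ?T (?i d, ?i b, ?i c, ?i a)" by (simp only: tr_m)
    then show ?thesis by (simp add: x add_divide_distrib add.commute)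
  qed
  let ?S = "{x. ?D x \<noteq> 0 \<and> ?T x + ?T x / ?D x = \<beta>}"
  have "bij_betw ?m ?S {M \<in> GL 2. mat_trace M + mat_trace (minv M) = \<beta>}"
    unfolding bij_betw_def
  proof
    show "inj_on ?m ?S"
    proof (rule inj_onI)
      fix x y assume "?m x = ?m y"
      then have "?m x $$ (i, j) = ?m y $$ (i, j)" for i j by simp
      from this[of 0 0] this[of 0 1] this[of 1 0] this[of 1 1] show "x = y"
        by (cases x; cases y) simp
    qed
    have "M \<in> ?m ` ?S" if M: "M \<in> GL 2" "mat_trace M + mat_trace (minv M) = \<beta>" for M
    proof -
      let ?x = "(M $$ (0, 0), M $$ (0, 1), M $$ (1, 0), M $$ (1, 1))"
      have e: "M = ?m ?x" using GL_carrier[OF M(1)] by (intro eq_matI) (auto simp: numeral_2_eq_2 less_Suc_eq)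
      then have "?D ?x \<noteq> 0" using GL[of ?x] M(1) by simp
      moreover have "?T ?x + ?T ?x / ?D ?x = \<beta>"
        using tr_m[of ?x] tr_minv[of ?x] calculation M(2) e by simp
      ultimately show ?thesis using e by blast
    qed
    moreover have "?m x \<in> GL 2 \<and> mat_trace (?m x) + mat_trace (minv (?m x)) = \<beta>" if "x \<in> ?S" for x
      using that GL[of x] tr_m[of x] tr_minv[of x] by simp
    ultimately show "?m ` ?S = {M \<in> GL 2. mat_trace M + mat_trace (minv M) = \<beta>}" by blast
  qed
  then have "inv_trace_count 2 \<beta> = card ?S"
    unfolding inv_trace_count_def by (rule bij_betw_same_card[THEN sym])
  also have "\<dots> = (\<Sum>x\<in>?S. 1)" by simp
  also have "\<dots> = (\<Sum>y\<in>{(T, \<Delta>). \<Delta> \<noteq> 0 \<and> T + T / \<Delta> = \<beta>}. \<Sum>x\<in>{x\<in>?S. (?T x, ?D x) = y}. 1)"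
    by (rule sum.group[symmetric]) auto
  also have "\<dots> = (\<Sum>y\<in>{(T, \<Delta>). \<Delta> \<noteq> 0 \<and> T + T / \<Delta> = \<beta>}. card (char_poly_fibre (fst y) (snd y)))"
  proof (rule sum.cong[OF refl])
    fix y assume "y \<in> {(T, \<Delta>). \<Delta> \<noteq> 0 \<and> T + T / \<Delta> = \<beta>}"
    then have "{x\<in>?S. (?T x, ?D x) = y} = char_poly_fibre (fst y) (snd y)"
      by (auto simp: char_poly_fibre_def)
    then show "(\<Sum>x\<in>{x\<in>?S. (?T x, ?D x) = y}. 1) = card (char_poly_fibre (fst y) (snd y))" by simp
  qed
  finally show ?thesis by (simp add: case_prod_unfold)
qed

lemma sum_add_char_inverse: "(\<Sum>x\<in>UNIV - {0}. add_char r (inverse x ^ 2 :: 'a)) = - 1"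
proof -
  have "(\<Sum>x\<in>UNIV - {0}. add_char r (inverse x ^ 2 :: 'a)) = (\<Sum>x\<in>UNIV - {0}. add_char r (x::'a))"
    by (rule sum.reindex_bij_witness[where i=inverse and j=inverse]) (auto simp: add_char_square)
  then show ?thesis by (simp only: sum_add_char_nonzero)
qed

text \<open>The condition means \<open>T = 0\<close> or \<open>\<Delta> = 1\<close>. The second
  family, taken with \<open>T\<close> nonzero, contributes a complete character sum over nonzero
  elements, equal to \<open>- 1\<close>.\<close>

lemma inv_trace_count_2_zero: "int (inv_trace_count 2 0) = 2 * 2 ^ r * (2 ^ r * (2 ^ r - 1)) - 2 ^ r"
proof -
  let ?f = "\<lambda>(T, \<Delta>). int (card (char_poly_fibre T \<Delta>))"
  have "T + T / \<Delta> = 0 \<longleftrightarrow> T = 0 \<or> \<Delta> = 1" if "\<Delta> \<noteq> 0" for T \<Delta> :: 'a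
    using that by (auto simp: add_eq_0 field_simps)
  then have R: "{(T, \<Delta>). \<Delta> \<noteq> 0 \<and> T + T / \<Delta> = 0} = ({0::'a} \<times> (UNIV - {0})) \<union> ((UNIV - {0}) \<times> {1})"
    by auto
  have "int (inv_trace_count 2 0) = (\<Sum>y\<in>{(T, \<Delta>). \<Delta> \<noteq> 0 \<and> T + T / \<Delta> = 0}. ?f y)"
    unfolding inv_trace_count_2_sum by (simp add: case_prod_unfold)
  also have "\<dots> = (\<Sum>y\<in>{0::'a} \<times> (UNIV - {0}). ?f y) + (\<Sum>y\<in>(UNIV - {0::'a}) \<times> {1}. ?f y)"
    unfolding R by (rule sum.union_disjoint) auto
  also have "(\<Sum>y\<in>{0::'a} \<times> (UNIV - {0}). ?f y) = (\<Sum>\<Delta>\<in>UNIV - {0::'a}. 2 ^ r * 2 ^ r)"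
    by (subst sum.cartesian_product[symmetric]) (simp add: card_char_poly_fibre)
  also have "(\<Sum>y\<in>(UNIV - {0::'a}) \<times> {1}. ?f y) = (\<Sum>T\<in>UNIV - {0::'a}. 2 ^ r * (2 ^ r + add_char r (inverse T ^ 2)))"
    by (subst sum.cartesian_product[symmetric]) (simp add: card_char_poly_fibre power_one_over inverse_eq_divide)
  also have "\<dots> = (\<Sum>T\<in>UNIV - {0::'a}. 2 ^ r * 2 ^ r) + 2 ^ r * (\<Sum>T\<in>UNIV - {0::'a}. add_char r (inverse T ^ 2))"
    by (simp add: distrib_left sum.distrib sum_distrib_left)
  finally show ?thesis
    by (simp only: sum_add_char_inverse sum_constant card_nonzero) (simp add: of_nat_diff algebra_simps)
qed

text \<open>Squaring permutes the nonzero elements and preserves the trace.\<close>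

lemma kloosterman_square: "kloosterman r (b\<^sup>2) = kloosterman r (b::'a)"
proof -
  have "(\<Sum>\<alpha>\<in>UNIV - {0}. add_char r (\<alpha> + b * inverse \<alpha>)) = (\<Sum>\<alpha>\<in>UNIV - {0}. add_char r (\<alpha>\<^sup>2 + b\<^sup>2 * inverse (\<alpha>\<^sup>2)))"
  proof (rule sum.cong[OF refl])
    fix \<alpha> :: 'a
    have "\<alpha>\<^sup>2 + b\<^sup>2 * inverse (\<alpha>\<^sup>2) = (\<alpha> + b * inverse \<alpha>)\<^sup>2"
      by (simp add: square_add power_mult_distrib power_inverse)
    then show "add_char r (\<alpha> + b * inverse \<alpha>) = add_char r (\<alpha>\<^sup>2 + b\<^sup>2 * inverse (\<alpha>\<^sup>2))"
      by (simp only: add_char_square)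
  qed
  also have "\<dots> = (\<Sum>\<alpha>\<in>UNIV - {0}. add_char r (\<alpha> + b\<^sup>2 * inverse \<alpha>))"
  proof (rule sum.reindex_bij_betw[of "\<lambda>x. x\<^sup>2" "UNIV - {0}" "UNIV - {0}"])
    show "bij_betw (\<lambda>x::'a. x\<^sup>2) (UNIV - {0}) (UNIV - {0})"
    proof -
      have "{x \<in> UNIV. x\<^sup>2 \<noteq> 0} = UNIV - {0::'a}" "{y \<in> UNIV. y \<noteq> 0} = UNIV - {0::'a}" by auto
      then show ?thesis using bij_betw_Collect_comp[OF square_bij, of "\<lambda>y. y \<noteq> 0"] by (simp only:)
    qed
  qed
  finally show ?thesis by (simp add: kloosterman_def)
qed

text \<open>Here \<open>T = \<beta> \<Delta> / (\<Delta> + 1)\<close> with \<open>\<Delta>\<close>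
  different from 0 and 1. The character argument \<open>\<Delta> / T^2\<close> becomes
  \<open>(\<Delta> + 1 / \<Delta>) / \<beta>^2\<close>, whose sum is a Kloosterman sum in symmetric
  form.\<close>

lemma inv_trace_count_2_nonzero:
  assumes \<beta>: "\<beta> \<noteq> 0"
  shows "int (inv_trace_count 2 \<beta>) =
    2 ^ r * 2 ^ r * (2 ^ r - 2) + 2 ^ r * (kloosterman r (inverse \<beta>) - 1)"
proof -
  let ?f = "\<lambda>(T, \<Delta>). int (card (char_poly_fibre T \<Delta>))"
  let ?h = "\<lambda>\<Delta>. (\<beta> * \<Delta> / (\<Delta> + 1), \<Delta>)"
  let ?g = "\<lambda>x::'a. (inverse \<beta>)\<^sup>2 * (x + inverse x)"
  have R: "{(T, \<Delta>). \<Delta> \<noteq> 0 \<and> T + T / \<Delta> = \<beta>} = ?h ` (UNIV - {0, 1})"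
  proof -
    have "T + T / \<Delta> = \<beta> \<longleftrightarrow> \<Delta> \<noteq> 1 \<and> T = \<beta> * \<Delta> / (\<Delta> + 1)" if "\<Delta> \<noteq> 0" for T \<Delta>
    proof (cases "\<Delta> = 1")
      case True
      then show ?thesis using \<beta> by simp
    next
      case False
      then have "\<Delta> + 1 \<noteq> 0" by (simp add: add_eq_0)
      then show ?thesis using that False by (simp add: field_simps)
    qed
    then show ?thesis by auto
  qed
  have "int (inv_trace_count 2 \<beta>) = (\<Sum>y\<in>{(T, \<Delta>). \<Delta> \<noteq> 0 \<and> T + T / \<Delta> = \<beta>}. ?f y)"
    unfolding inv_trace_count_2_sum by (simp add: case_prod_unfold)
  also have "\<dots> = (\<Sum>\<Delta>\<in>UNIV - {0, 1}. ?f (?h \<Delta>))"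
    unfolding R by (subst sum.reindex) (auto intro: inj_onI)
  also have "\<dots> = (\<Sum>\<Delta>\<in>UNIV - {0, 1}. 2 ^ r * 2 ^ r + 2 ^ r * add_char r (?g \<Delta>))"
  proof (rule sum.cong[OF refl])
    fix \<Delta> :: 'a assume "\<Delta> \<in> UNIV - {0, 1}"
    then have D: "\<Delta> \<noteq> 0" "\<Delta> + 1 \<noteq> 0" by (auto simp: add_eq_0)
    have "\<Delta> / (\<beta> * \<Delta> / (\<Delta> + 1))\<^sup>2 = (\<Delta> + 1)\<^sup>2 / (\<beta>\<^sup>2 * \<Delta>)"
      using D \<beta> by (simp add: field_simps power2_eq_square)
    also have "\<dots> = ?g \<Delta>"
      unfolding square_add using D \<beta> by (simp add: field_simps power2_eq_square)
    finally show "?f (?h \<Delta>) = 2 ^ r * 2 ^ r + 2 ^ r * add_char r (?g \<Delta>)"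
      using D \<beta> by (simp add: card_char_poly_fibre distrib_left)
  qed
  also have "\<dots> = 2 ^ r * 2 ^ r * int (card (UNIV - {0, 1::'a})) + 2 ^ r * (\<Sum>\<Delta>\<in>UNIV - {0, 1}. add_char r (?g \<Delta>))"
    by (simp add: sum.distrib sum_distrib_left)
  also have "int (card (UNIV - {0, 1::'a})) = 2 ^ r - 2"
  proof -
    have "card (UNIV - {0, 1::'a}) = 2 ^ r - 2" by (simp add: card_Diff_subset card_field)
    moreover have "2 ^ 1 \<le> (2 ^ r :: nat)" using r_pos by (intro power_increasing) auto
    ultimately show ?thesis by (simp add: of_nat_diff)
  qed
  also have "(\<Sum>\<Delta>\<in>UNIV - {0, 1}. add_char r (?g \<Delta>)) = kloosterman r (inverse \<beta>) - 1"
  proof -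
    have "UNIV - {0, 1::'a} = UNIV - {0} - {1}" by auto
    then have "(\<Sum>\<Delta>\<in>UNIV - {0, 1}. add_char r (?g \<Delta>)) = (\<Sum>\<Delta>\<in>UNIV - {0}. add_char r (?g \<Delta>)) - add_char r (?g 1)"
      by (simp add: sum_diff1)
    moreover have "?g 1 = 0" by simp
    \<comment> \<open>Scaling gives the Kloosterman sum at the inverse of \<open>\<beta>^4\<close>,
      which two squarings link to the inverse of \<open>\<beta>\<close>. The omitted
      \<open>\<Delta> = 1\<close> has character value 1, hence the \<open>- 1\<close>.\<close>
    ultimately show ?thesis using \<beta> kloosterman_scale[of "(inverse \<beta>)\<^sup>2"]
      by (simp only: kloosterman_square add_char_0) simp
  qed
  finally show ?thesis .
qed

section \<open>Group orders and matrix counts in closed form\<close>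

definition Q :: real where "Q = 2 ^ r"
definition gl_card :: "nat \<Rightarrow> real" where "gl_card n = real (card (GL n :: 'a mat set))"
definition sym_card :: "nat \<Rightarrow> real" where "sym_card n = real (card (sym_GL n :: 'a mat set))"
definition alt_card :: "nat \<Rightarrow> real" where "alt_card n = real (card (alternating_mats n :: 'a mat set))"
definition odd_prod :: "nat \<Rightarrow> real" where "odd_prod m = (\<Prod>j=1..m. Q ^ (2 * j - 1) - 1)"
definition even_prod :: "nat \<Rightarrow> real" where "even_prod m = (\<Prod>j=1..m. Q ^ (2 * j) - 1)"

lemma Q_gt_1: "1 < Q"
  unfolding Q_def using r_pos by (intro one_less_power) auto

lemma Q_powr: "Q ^ k = Q powr real k"
  using Q_gt_1 by (simp add: powr_realpow)

lemma real_card_field: "real (card (UNIV :: 'a set)) = Q"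
  by (simp add: card_field Q_def)

lemma real_q_diff: "real (2 ^ (r * k) - 1) = Q ^ k - 1"
  by (simp add: of_nat_diff Q_def power_mult)

lemma gl_card_Suc: "gl_card (Suc m) = (Q ^ Suc m - 1) * Q ^ m * gl_card m"
  unfolding gl_card_def card_GL_Suc card_field power_mult[symmetric]
  by (simp only: of_nat_mult real_q_diff) (simp add: Q_def power_mult)

lemma gl_card_0: "gl_card 0 = 1" by (simp add: gl_card_def card_GL_0)

lemma gl_card_pos: "0 < gl_card n"
proof (induction n)
  case (Suc n)
  have "1 < Q ^ Suc n" using Q_gt_1 by (intro one_less_power) auto
  then show ?case unfolding gl_card_Suc using Suc Q_gt_1 by (intro mult_pos_pos) auto
qed (simp add: gl_card_0)

lemma sym_card_0: "sym_card 0 = 1" by (simp add: sym_card_def card_sym_GL_0)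

lemma sym_card_1: "sym_card 1 = Q - 1"
  unfolding sym_card_def card_sym_GL_1 card_field by (simp add: of_nat_diff Q_def)

lemma sym_card_Suc_Suc:
  "sym_card (Suc (Suc m)) = (Q - 1) * Q ^ Suc m * sym_card (Suc m) + (Q ^ Suc m - 1) * Q ^ Suc m * sym_card m"
proof -
  have "real (2 ^ r - 1) = Q - 1" by (simp add: of_nat_diff Q_def)
  then show ?thesis
    unfolding sym_card_def card_sym_GL_Suc_Suc card_field power_mult[symmetric]
    by (simp only: of_nat_add of_nat_mult real_q_diff) (simp add: Q_def power_mult power_add)
qed

text \<open>The two-term recursion collapses alternately: inserting either identity into the
  recursion for the next size turns it into the other one.\<close>

lemma sym_card_odd_even:
  "sym_card (2 * m + 1) = (Q ^ (2 * m + 1) - 1) * sym_card (2 * m)" "sym_card (2 * m + 2) = Q ^ (2 * m + 2) * sym_card (2 * m + 1)"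
proof -
  have 2: "sym_card (2 * m + 2) = Q ^ (2 * m + 2) * sym_card (2 * m + 1)" if "sym_card (2 * m + 1) = (Q ^ (2 * m + 1) - 1) * sym_card (2 * m)" for m
  proof -
    have "sym_card (2 * m + 2) = (Q - 1) * Q ^ (2 * m + 1) * sym_card (2 * m + 1) + Q ^ (2 * m + 1) * ((Q ^ (2 * m + 1) - 1) * sym_card (2 * m))"
      using sym_card_Suc_Suc[of "2 * m"] by simp
    also have "\<dots> = Q ^ (2 * m + 2) * sym_card (2 * m + 1)"
      unfolding that[symmetric] by (simp add: algebra_simps)
    finally show ?thesis .
  qed
  show 1: "sym_card (2 * m + 1) = (Q ^ (2 * m + 1) - 1) * sym_card (2 * m)"
  proof (induction m)
    case 0
    show ?case using sym_card_0 sym_card_1 by simp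
  next
    case (Suc m)
    have "sym_card (2 * Suc m + 1) = (Q - 1) * Q ^ (2 * m + 2) * sym_card (2 * m + 2) + (Q ^ (2 * m + 2) - 1) * (Q ^ (2 * m + 2) * sym_card (2 * m + 1))"
      using sym_card_Suc_Suc[of "2 * m + 1"] by simp
    also have "\<dots> = (Q ^ (2 * Suc m + 1) - 1) * sym_card (2 * m + 2)"
      unfolding 2[OF Suc, symmetric] by (simp add: algebra_simps)
    finally show ?case by simp
  qed
  show "sym_card (2 * m + 2) = Q ^ (2 * m + 2) * sym_card (2 * m + 1)" by (rule 2[OF 1])
qed

lemma odd_prod_Suc: "odd_prod (Suc m) = odd_prod m * (Q ^ (2 * m + 1) - 1)"
  and even_prod_Suc: "even_prod (Suc m) = even_prod m * (Q ^ (2 * m + 2) - 1)"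
  unfolding odd_prod_def even_prod_def by (simp_all add: prod.nat_ivl_Suc')

lemma odd_prod_0: "odd_prod 0 = 1" and even_prod_0: "even_prod 0 = 1"
  by (simp_all add: odd_prod_def even_prod_def)

lemma odd_prod_pos: "0 < odd_prod m"
  unfolding odd_prod_def
proof (rule prod_pos)
  fix j assume "j \<in> {1..m}"
  then have "1 < Q ^ (2 * j - 1)" using Q_gt_1 by (intro one_less_power) auto
  then show "0 < Q ^ (2 * j - 1) - 1" by simp
qed

lemma sym_card_even: "sym_card (2 * m) = Q powr (real m * (real m + 1)) * odd_prod m"
proof (induction m)
  case (Suc m)
  have "sym_card (2 * Suc m) = Q ^ (2 * m + 2) * ((Q ^ (2 * m + 1) - 1) * sym_card (2 * m))"
    using sym_card_odd_even[of m] by simp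
  also have "\<dots> = (Q ^ (2 * m + 2) * Q powr (real m * (real m + 1))) * odd_prod (Suc m)"
    by (simp add: Suc odd_prod_Suc)
  also have "Q ^ (2 * m + 2) * Q powr (real m * (real m + 1)) = Q powr (real (Suc m) * (real (Suc m) + 1))"
    unfolding Q_powr powr_add[symmetric] by (rule arg_cong[where f="(powr) Q"]) (simp add: algebra_simps)
  finally show ?case .
qed (use Q_gt_1 in \<open>simp add: sym_card_0 odd_prod_0\<close>)

lemma sym_card_odd: "sym_card (2 * m + 1) = Q powr (real m * (real m + 1)) * odd_prod (Suc m)"
  unfolding sym_card_odd_even(1) sym_card_even odd_prod_Suc by simp

lemma gl_card_even: "gl_card (2 * m) = Q powr (real m * (2 * real m - 1)) * odd_prod m * even_prod m"
proof (induction m)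
  case (Suc m)
  have "gl_card (2 * Suc m) = (Q ^ (2 * m + 2) - 1) * Q ^ (2 * m + 1) * ((Q ^ (2 * m + 1) - 1) * Q ^ (2 * m) * gl_card (2 * m))"
    using gl_card_Suc[of "2 * m + 1"] gl_card_Suc[of "2 * m"] by simp
  also have "\<dots> = (Q ^ (2 * m + 1) * Q ^ (2 * m) * Q powr (real m * (2 * real m - 1))) * odd_prod (Suc m) * even_prod (Suc m)"
    unfolding Suc odd_prod_Suc even_prod_Suc by (simp only: mult_ac)
  also have "Q ^ (2 * m + 1) * Q ^ (2 * m) * Q powr (real m * (2 * real m - 1)) = Q powr (real (Suc m) * (2 * real (Suc m) - 1))"
    unfolding Q_powr powr_add[symmetric] by (rule arg_cong[where f="(powr) Q"]) (simp add: algebra_simps)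
  finally show ?case .
qed (use Q_gt_1 in \<open>simp add: gl_card_0 odd_prod_0 even_prod_0\<close>)

lemma gl_card_odd: "gl_card (2 * m + 1) = Q powr (real m * (2 * real m + 1)) * odd_prod (Suc m) * even_prod m"
proof -
  have "gl_card (2 * m + 1) = (Q ^ (2 * m) * Q powr (real m * (2 * real m - 1))) * odd_prod (Suc m) * even_prod m"
    using gl_card_Suc[of "2 * m"] unfolding gl_card_even odd_prod_Suc by simp
  also have "Q ^ (2 * m) * Q powr (real m * (2 * real m - 1)) = Q powr (real m * (2 * real m + 1))"
    unfolding Q_powr powr_add[symmetric] by (rule arg_cong[where f="(powr) Q"]) (simp add: algebra_simps)
  finally show ?thesis .
qed

lemma gl_card_1: "gl_card 1 = Q - 1" using gl_card_Suc[of 0] by (simp add: gl_card_0)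

lemma gl_card_2: "gl_card 2 = Q * (Q - 1) * (Q\<^sup>2 - 1)"
  using gl_card_Suc[of 1] gl_card_1 by (simp add: numeral_2_eq_2 mult_ac)

lemma alt_card_powr: "alt_card n = Q powr (real n * (real n - 1) / 2)"
proof -
  have "even (n * (n - 1))" by (cases n) auto
  then have "real (n * (n - 1) div 2) = real (n * (n - 1)) / 2" by (simp add: real_of_nat_div)
  also have "\<dots> = real n * (real n - 1) / 2" by (cases n) (auto simp: algebra_simps)
  finally have e: "real (n * (n - 1) div 2) = real n * (real n - 1) / 2" .
  show ?thesis
    unfolding alt_card_def card_alternating_mats of_nat_power real_card_field Q_powr e ..
qed

text \<open>Solves \<open>card_DC_trace\<close> for the fibre size \<open>C\<close>. Here
  \<open>gn\<close>, \<open>gs\<close>, \<open>gt\<close> are orders of general linear groups,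
  \<open>as\<close>, \<open>al\<close>, \<open>N\<close> count alternating matrices of sizes
  \<open>s\<close>, \<open>t\<close>, \<open>n\<close>, \<open>ss\<close> counts invertible
  symmetric ones, \<open>e\<close> is \<open>q^(t s)\<close> and \<open>c\<close> is the inverse
  trace count.\<close>

lemma double_coset_algebra:
  fixes C :: real
  assumes eq: "q * C * (gs * e * gt * (e * al)) = gn * N * (N * (gn - ss * e * gt + q * (ss * e * c)))"
    and N: "N = as * e * al" and pos: "0 < q" "0 < gs" "0 < gt" "0 < as" "0 < al" "0 < ss" "0 < e"
  shows "C = inverse q * (gn * as * N * ss / (gs * gt)) * (gn / (ss * e) - gt + q * c)"
proof -
  let ?W = "gn / (ss * e) - gt + q * c" and ?K = "q * (gs * e * gt * (e * al))"
  have W: "ss * e * ?W = gn - ss * e * gt + q * (ss * e * c)"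
    using pos by (simp add: field_simps)
  have "inverse q * (gn * as * N * ss / (gs * gt)) * w * ?K = gn * N * ((as * e * al) * (ss * e * w))" for w
    using pos by (simp add: field_simps)
  then have "inverse q * (gn * as * N * ss / (gs * gt)) * ?W * ?K = C * ?K"
    using eq by (simp only: W N[symmetric]) (simp add: mult_ac)
  moreover have "?K \<noteq> 0" using pos by simp
  ultimately show ?thesis by (metis mult_right_cancel)
qed

text \<open>With \<open>B0\<close>, a form of the factors uniform in \<open>t\<close>. For
  \<open>t = 1\<close> they are \<open>A1\<close> and \<open>B1\<close>; for \<open>t = 2\<close> a
  factor \<open>Q\<close> is exchanged, so \<open>A2\<close> is \<open>Q * A0 2 n\<close> and
  \<open>B0 2 n\<close> is \<open>Q\<close> times \<open>B2\<close>.\<close>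

definition A0 :: "nat \<Rightarrow> nat \<Rightarrow> real" where
  "A0 t n = gl_card n * alt_card (n - t) * alt_card n * sym_card (n - t) / (gl_card (n - t) * gl_card t)"

definition B0 :: "nat \<Rightarrow> nat \<Rightarrow> real" where
  "B0 t n = gl_card n / (sym_card (n - t) * Q ^ (t * (n - t)))"

lemma sym_card_pos: "0 < sym_card n"
proof -
  have "sym_card n = (if even n then sym_card (2 * (n div 2)) else sym_card (2 * (n div 2) + 1))" by simp
  then show ?thesis unfolding sym_card_even sym_card_odd using odd_prod_pos Q_gt_1 by (simp split: if_splits)
qed

lemma real_card_DC_trace:
  assumes n: "n = s + t"
  shows "real (card {w \<in> DC t n. mat_trace w = (\<beta>::'a)}) =
    inverse Q * A0 t n * (B0 t n - gl_card t + Q * real (inv_trace_count t \<beta>))"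
proof -
  have Q0: "0 < Q" using Q_gt_1 by simp
  have le: "card (sym_GL s :: 'a mat set) * (2 ^ r) ^ (t * s) * card (GL t :: 'a mat set) \<le> card (GL n :: 'a mat set)"
  proof -
    have "card (good s n) \<le> card (GL n :: 'a mat set)" by (rule card_mono) (auto simp: good_def)
    then show ?thesis using card_good_trace[of s t "\<lambda>_. True"] by (simp add: n)
  qed
  have Qr: "real ((2 ^ r) ^ k) = Q ^ k" "real (2 ^ r) = Q" for k by (simp_all add: Q_def)
  have altn: "alt_card n = alt_card s * Q ^ (t * s) * alt_card t"
    unfolding alt_card_def n card_alternating_mats_add by (simp add: card_field Q_def mult.commute[of t s])
  let ?C = "real (card {w \<in> DC t n. mat_trace w = \<beta>})"
  have "Q * ?C * (gl_card s * Q ^ (t * s) * gl_card t * (Q ^ (t * s) * alt_card t)) =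
      gl_card n * alt_card n * (alt_card n * (gl_card n - sym_card s * Q ^ (t * s) * gl_card t + Q * (sym_card s * Q ^ (t * s) * real (inv_trace_count t \<beta>))))"
    using arg_cong[OF card_DC_trace[OF n, of \<beta>], of real]
    by (simp only: of_nat_mult of_nat_add of_nat_diff[OF le] Qr gl_card_def sym_card_def alt_card_def)
  moreover have "0 < gl_card s" "0 < gl_card t" "0 < alt_card s" "0 < alt_card t" "0 < sym_card s" "0 < Q ^ (t * s)"
    using gl_card_pos sym_card_pos Q0 by (simp_all add: alt_card_powr)
  ultimately show ?thesis
    unfolding A0_def B0_def using n Q0 altn double_coset_algebra by simp
qed

text \<open>Gaussian binomials enter here: the order of \<open>GL (s + t)\<close> divided by those
  of \<open>GL s\<close> and \<open>GL t\<close> is \<open>Q^(s t)\<close> times the binomial, used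
  for \<open>t = 1\<close> and \<open>t = 2\<close>.\<close>

lemma gl_card_ratio_1: "gl_card (Suc s) / (gl_card s * gl_card 1) = Q ^ s * ((Q ^ Suc s - 1) / (Q - 1))"
  unfolding gl_card_Suc[of s] gl_card_1 using gl_card_pos[of s] by simp

lemma gl_card_ratio_2: "gl_card (s + 2) / (gl_card s * gl_card 2) = Q powr (2 * real s) * qbinom Q (s + 2) 2"
proof -
  have "qbinom Q (s + 2) 2 = (Q ^ (s + 2) - 1) / (Q\<^sup>2 - 1) * ((Q ^ (s + 1) - 1) / (Q - 1))"
    by (simp add: qbinom_def numeral_2_eq_2)
  moreover have "Q powr (2 * real s) = Q ^ s * Q ^ s"
    unfolding Q_powr powr_add[symmetric] by simp
  moreover have "gl_card (s + 2) = (Q ^ (s + 2) - 1) * (Q * Q ^ s) * ((Q ^ (s + 1) - 1) * Q ^ s * gl_card s)"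
    using gl_card_Suc[of "s + 1"] gl_card_Suc[of s] by simp
  ultimately show ?thesis using gl_card_pos[of s] Q_gt_1 by (simp add: gl_card_2 power2_eq_square mult_ac)
qed

lemma qbinom_1: "qbinom q n 1 = (q ^ n - 1) / (q - 1)"
  by (simp add: qbinom_def)

lemma A0_1: "A0 1 (Suc s) = (Q ^ s * alt_card s * alt_card (Suc s) * sym_card s) * qbinom Q (Suc s) 1"
proof -
  have "A0 1 (Suc s) = (gl_card (Suc s) / (gl_card s * gl_card 1)) * (alt_card s * alt_card (Suc s) * sym_card s)"
    by (simp add: A0_def)
  then show ?thesis unfolding gl_card_ratio_1 qbinom_1 by simp
qed

lemma A0_2: "A0 2 (s + 2) = (Q powr (2 * real s) * alt_card s * alt_card (s + 2) * sym_card s) * qbinom Q (s + 2) 2"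
proof -
  have "A0 2 (s + 2) = (gl_card (s + 2) / (gl_card s * gl_card 2)) * (alt_card s * alt_card (s + 2) * sym_card s)"
    by (simp add: A0_def)
  then show ?thesis unfolding gl_card_ratio_2 by simp
qed

lemma powr_eqI: "x = y \<Longrightarrow> Q powr x = Q powr y"
  by simp

lemma powr_divide_eqI: "x = y - z \<Longrightarrow> Q powr y / Q powr z = Q powr x"
  by (simp add: powr_diff)

text \<open>\<open>Plus\<close> and \<open>Minus\<close> are the cases of odd and even
  \<open>n - 1\<close>, matching the closed forms of \<open>sym_card\<close>. Once the products are
  matched, only an identity between exponents of \<open>Q\<close> remains.\<close>

lemma A1_eq:
  "A1 Plus (2 * m + 2) Q = A0 1 (2 * m + 2)" "A1 Minus (2 * m + 1) Q = A0 1 (2 * m + 1)"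
proof -
  have "A0 1 (2 * m + 2) = (Q ^ (2 * m + 1) * alt_card (2 * m + 1) * alt_card (2 * m + 2) * Q powr (real m * (real m + 1))) *
      qbinom Q (2 * m + 2) 1 * odd_prod (Suc m)"
    using A0_1[of "2 * m + 1"] unfolding sym_card_odd by simp
  also have "Q ^ (2 * m + 1) * alt_card (2 * m + 1) * alt_card (2 * m + 2) * Q powr (real m * (real m + 1)) =
      Q powr ((5 * real (2 * m + 2) ^ 2 - 6 * real (2 * m + 2)) / 4)"
    unfolding Q_powr alt_card_powr powr_add[symmetric] by (rule powr_eqI) (simp add: field_simps power2_eq_square)
  finally show "A1 Plus (2 * m + 2) Q = A0 1 (2 * m + 2)" by (simp add: odd_prod_def)
  have "A0 1 (2 * m + 1) = (Q ^ (2 * m) * alt_card (2 * m) * alt_card (2 * m + 1) * Q powr (real m * (real m + 1))) *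
      qbinom Q (2 * m + 1) 1 * odd_prod m"
    using A0_1[of "2 * m"] unfolding sym_card_even by simp
  also have "Q ^ (2 * m) * alt_card (2 * m) * alt_card (2 * m + 1) * Q powr (real m * (real m + 1)) =
      Q powr ((5 * real (2 * m + 1) ^ 2 - 4 * real (2 * m + 1) - 1) / 4)"
    unfolding Q_powr alt_card_powr powr_add[symmetric] by (rule powr_eqI) (simp add: field_simps power2_eq_square)
  finally show "A1 Minus (2 * m + 1) Q = A0 1 (2 * m + 1)" by (simp add: odd_prod_def)
qed

lemma B1_eq:
  "B1 Plus (2 * m + 2) Q = B0 1 (2 * m + 2)" "B1 Minus (2 * m + 1) Q = B0 1 (2 * m + 1)"
proof -
  have pos: "odd_prod k \<noteq> 0" for k using odd_prod_pos[of k] by simp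
  have "B0 1 (2 * m + 2) = gl_card (2 * Suc m) / (sym_card (2 * m + 1) * Q ^ (2 * m + 1))" by (simp add: B0_def)
  also have "\<dots> = Q powr (real (Suc m) * (2 * real (Suc m) - 1)) / Q powr (real m * (real m + 1) + real (2 * m + 1)) * even_prod (Suc m)"
    unfolding gl_card_even sym_card_odd Q_powr powr_add using pos[of "Suc m"] by simp
  also have "Q powr (real (Suc m) * (2 * real (Suc m) - 1)) / Q powr (real m * (real m + 1) + real (2 * m + 1)) =
      Q powr ((real (2 * m + 2) - 2) ^ 2 / 4)"
    by (rule powr_divide_eqI) (simp add: field_simps power2_eq_square)
  finally show "B1 Plus (2 * m + 2) Q = B0 1 (2 * m + 2)" by (simp add: even_prod_def)
  have "B0 1 (2 * m + 1) = gl_card (2 * m + 1) / (sym_card (2 * m) * Q ^ (2 * m))" by (simp add: B0_def)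
  also have "\<dots> = Q powr (real m * (2 * real m + 1)) / Q powr (real m * (real m + 1) + real (2 * m)) * (Q ^ (2 * m + 1) - 1) * even_prod m"
    unfolding gl_card_odd sym_card_even Q_powr[of "2 * m"] powr_add odd_prod_Suc using pos[of m] by simp
  also have "Q powr (real m * (2 * real m + 1)) / Q powr (real m * (real m + 1) + real (2 * m)) =
      Q powr ((real (2 * m + 1) ^ 2 - 6 * real (2 * m + 1) + 5) / 4)"
    by (rule powr_divide_eqI) (simp add: field_simps power2_eq_square)
  finally show "B1 Minus (2 * m + 1) Q = B0 1 (2 * m + 1)" by (simp add: even_prod_def)
qed

lemma A2_eq:
  "A2 Plus (2 * m + 2) Q = Q * A0 2 (2 * m + 2)" "A2 Minus (2 * m + 3) Q = Q * A0 2 (2 * m + 3)"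
proof -
  have Q1: "Q = Q powr 1" using Q_gt_1 by simp
  have "Q * A0 2 (2 * m + 2) = (Q powr 1 * Q powr (2 * real (2 * m)) * alt_card (2 * m) * alt_card (2 * m + 2) * Q powr (real m * (real m + 1))) *
      qbinom Q (2 * m + 2) 2 * odd_prod m"
    using A0_2[of "2 * m"] Q1 unfolding sym_card_even by simp
  also have "Q powr 1 * Q powr (2 * real (2 * m)) * alt_card (2 * m) * alt_card (2 * m + 2) * Q powr (real m * (real m + 1)) =
      Q powr ((5 * real (2 * m + 2) ^ 2 - 6 * real (2 * m + 2)) / 4)"
    unfolding alt_card_powr powr_add[symmetric] by (rule powr_eqI) (simp add: field_simps power2_eq_square)
  finally show "A2 Plus (2 * m + 2) Q = Q * A0 2 (2 * m + 2)" by (simp add: odd_prod_def)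
  have "Q * A0 2 (2 * m + 3) = (Q powr 1 * Q powr (2 * real (2 * m + 1)) * alt_card (2 * m + 1) * alt_card (2 * m + 3) * Q powr (real m * (real m + 1))) *
      qbinom Q (2 * m + 3) 2 * odd_prod (Suc m)"
    using A0_2[of "2 * m + 1"] Q1 unfolding sym_card_odd by (simp add: numeral_3_eq_3)
  also have "Q powr 1 * Q powr (2 * real (2 * m + 1)) * alt_card (2 * m + 1) * alt_card (2 * m + 3) * Q powr (real m * (real m + 1)) =
      Q powr ((5 * real (2 * m + 3) ^ 2 - 8 * real (2 * m + 3) + 3) / 4)"
    unfolding alt_card_powr powr_add[symmetric] by (rule powr_eqI) (simp add: field_simps power2_eq_square)
  finally show "A2 Minus (2 * m + 3) Q = Q * A0 2 (2 * m + 3)" by (simp add: odd_prod_def)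
qed

lemma B2_eq:
  "Q * B2 Plus (2 * m + 2) Q = B0 2 (2 * m + 2)" "Q * B2 Minus (2 * m + 3) Q = B0 2 (2 * m + 3)"
proof -
  have Q1: "Q * Q powr x = Q powr (x + 1)" for x using Q_gt_1 by (simp add: powr_add)
  have pos: "odd_prod k \<noteq> 0" for k using odd_prod_pos[of k] by simp
  have "B0 2 (2 * m + 2) = gl_card (2 * Suc m) / (sym_card (2 * m) * Q ^ (2 * (2 * m)))" by (simp add: B0_def)
  also have "\<dots> = Q powr (real (Suc m) * (2 * real (Suc m) - 1)) / Q powr (real m * (real m + 1) + real (2 * (2 * m))) *
      (Q ^ (2 * m + 1) - 1) * (Q ^ (2 * m + 2) - 1) * even_prod m"
    unfolding gl_card_even sym_card_even Q_powr[of "2 * (2 * m)"] powr_add odd_prod_Suc even_prod_Suc using pos[of m] by simp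
  also have "Q powr (real (Suc m) * (2 * real (Suc m) - 1)) / Q powr (real m * (real m + 1) + real (2 * (2 * m))) =
      Q * Q powr ((real (2 * m + 2) ^ 2 - 8 * real (2 * m + 2) + 12) / 4)"
    unfolding Q1 by (rule powr_divide_eqI) (simp add: field_simps power2_eq_square)
  finally show "Q * B2 Plus (2 * m + 2) Q = B0 2 (2 * m + 2)" by (simp add: even_prod_def)
  have "B0 2 (2 * m + 3) = gl_card (2 * Suc m + 1) / (sym_card (2 * m + 1) * Q ^ (2 * (2 * m + 1)))"
    by (simp add: B0_def numeral_3_eq_3)
  also have "\<dots> = Q powr (real (Suc m) * (2 * real (Suc m) + 1)) / Q powr (real m * (real m + 1) + real (2 * (2 * m + 1))) *
      (Q ^ (2 * m + 3) - 1) * even_prod (Suc m)"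
    unfolding gl_card_odd sym_card_odd Q_powr[of "2 * (2 * m + 1)"] powr_add odd_prod_Suc[of "Suc m"]
    using pos[of "Suc m"] by (simp add: numeral_3_eq_3)
  also have "Q powr (real (Suc m) * (2 * real (Suc m) + 1)) / Q powr (real m * (real m + 1) + real (2 * (2 * m + 1))) =
      Q * Q powr ((real (2 * m + 3) - 3) ^ 2 / 4)"
    unfolding Q1 by (rule powr_divide_eqI) (simp add: field_simps power2_eq_square)
  finally show "Q * B2 Minus (2 * m + 3) Q = B0 2 (2 * m + 3)" by (simp add: even_prod_def)
qed

lemma A1_B1:
  assumes "(\<epsilon> = Plus \<and> even n \<and> 2 \<le> n) \<or> (\<epsilon> = Minus \<and> odd n \<and> 1 \<le> n)"
  shows "A1 \<epsilon> n Q = A0 1 n" "B1 \<epsilon> n Q = B0 1 n"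
proof -
  consider m where "\<epsilon> = Plus" "n = 2 * m + 2" | m where "\<epsilon> = Minus" "n = 2 * m + 1"
  proof -
    have "\<exists>m. n = 2 * m + 2" if "even n" "2 \<le> n" using that by presburger
    then show thesis using assms that by (metis oddE)
  qed
  then show "A1 \<epsilon> n Q = A0 1 n" "B1 \<epsilon> n Q = B0 1 n"
    by (cases; simp only: A1_eq B1_eq)+
qed

lemma A2_B2:
  assumes "(\<epsilon> = Plus \<and> even n \<and> 2 \<le> n) \<or> (\<epsilon> = Minus \<and> odd n \<and> 3 \<le> n)"
  shows "A2 \<epsilon> n Q = Q * A0 2 n" "Q * B2 \<epsilon> n Q = B0 2 n"
proof -
  consider m where "\<epsilon> = Plus" "n = 2 * m + 2" | m where "\<epsilon> = Minus" "n = 2 * m + 3"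
  proof -
    have "\<exists>m. n = 2 * m + 2" if "even n" "2 \<le> n" using that by presburger
    moreover have "\<exists>m. n = 2 * m + 3" if "odd n" "3 \<le> n" using that by presburger
    ultimately show thesis using assms that by metis
  qed
  then show "A2 \<epsilon> n Q = Q * A0 2 n" "Q * B2 \<epsilon> n Q = B0 2 n"
    by (cases; simp only: A2_eq B2_eq)+
qed

text \<open>The three cases are the values 1, 2 and 0 of \<open>inv_trace_count 1\<close>; the order
  of \<open>GL 1\<close> contributes the common shift \<open>1 - Q\<close>.\<close>

lemma card_DC_1_trace:
  assumes \<epsilon>: "(\<epsilon> = Plus \<and> even n \<and> 2 \<le> n) \<or> (\<epsilon> = Minus \<and> odd n \<and> 1 \<le> n)"
  shows "real (card {w \<in> DC 1 n. mat_trace w = (\<beta>::'a)}) = inverse Q * A1 \<epsilon> n Q *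
    (if \<beta> = 0 then B1 \<epsilon> n Q + 1 else if tr (inverse \<beta>) = 0 then B1 \<epsilon> n Q + Q + 1 else B1 \<epsilon> n Q - Q + 1)"
proof -
  have n: "n = (n - 1) + 1" using \<epsilon> by auto
  have "real (inv_trace_count 1 \<beta>) = real_of_int (if \<beta> = 0 then 1 else 1 + add_char r (inverse \<beta>))"
  proof (cases "\<beta> = 0")
    case False
    then show ?thesis
      unfolding inv_trace_count_1 using arg_cong[OF card_add_inverse[OF False], of real_of_int] by simp
  next
    case True
    show ?thesis unfolding inv_trace_count_1 True add_inverse_eq_0 by simp
  qed
  then show ?thesis
    unfolding A1_B1[OF \<epsilon>] real_card_DC_trace[OF n] gl_card_1 by (simp add: add_char_def algebra_simps)
qed

text \<open>A factor \<open>Q\<close> is taken out of the bracket of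
  \<open>real_card_DC_trace\<close> and absorbed in \<open>A2\<close>. The constants result from
  combining \<open>- gl_card 2 / Q\<close> with the two values of
  \<open>inv_trace_count 2\<close>.\<close>

lemma card_DC_2_trace:
  assumes \<epsilon>: "(\<epsilon> = Plus \<and> even n \<and> 2 \<le> n) \<or> (\<epsilon> = Minus \<and> odd n \<and> 3 \<le> n)"
  shows "real (card {w \<in> DC 2 n. mat_trace w = (\<beta>::'a)}) = inverse Q * A2 \<epsilon> n Q *
    (if \<beta> = 0 then B2 \<epsilon> n Q + Q ^ 3 - Q ^ 2 - 1
     else B2 \<epsilon> n Q + Q * real_of_int (kloosterman r (inverse \<beta>)) - Q ^ 2 - 1)"
proof -
  have n: "n = (n - 2) + 2" using \<epsilon> by auto
  let ?c = "real (inv_trace_count 2 \<beta>)"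
  let ?c' = "if \<beta> = 0 then 2 * Q * (Q * (Q - 1)) - Q else Q * Q * (Q - 2) + Q * (real_of_int (kloosterman r (inverse \<beta>)) - 1)"
  have c: "?c = ?c'"
  proof (cases "\<beta> = 0")
    case True
    then show ?thesis using arg_cong[OF inv_trace_count_2_zero, of real_of_int] by (simp add: Q_def)
  next
    case False
    then show ?thesis using arg_cong[OF inv_trace_count_2_nonzero[OF False], of real_of_int] by (simp add: Q_def)
  qed
  have "B0 2 n - gl_card 2 + Q * ?c = Q * (B2 \<epsilon> n Q - (Q - 1) * (Q\<^sup>2 - 1) + ?c)"
    unfolding A2_B2(2)[OF \<epsilon>, symmetric] gl_card_2 by (simp add: algebra_simps)
  then have "real (card {w \<in> DC 2 n. mat_trace w = \<beta>}) =
      inverse Q * A2 \<epsilon> n Q * (B2 \<epsilon> n Q - (Q - 1) * (Q\<^sup>2 - 1) + ?c)"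
    unfolding A2_B2(1)[OF \<epsilon>] real_card_DC_trace[OF n] by simp
  moreover have "B2 \<epsilon> n Q - (Q - 1) * (Q\<^sup>2 - 1) + ?c' =
    (if \<beta> = 0 then B2 \<epsilon> n Q + Q ^ 3 - Q ^ 2 - 1
     else B2 \<epsilon> n Q + Q * real_of_int (kloosterman r (inverse \<beta>)) - Q ^ 2 - 1)"
    by (simp add: algebra_simps power2_eq_square power3_eq_cube)
  ultimately show ?thesis unfolding c by (simp only:)
qed

section \<open>The weight distributions\<close>

lemma weight_dist_DC_1:
  assumes \<epsilon>: "(\<epsilon> = Plus \<and> even n \<and> 2 \<le> n) \<or> (\<epsilon> = Minus \<and> odd n \<and> 1 \<le> n)"
    and gs: "ordering_of (DC 1 n :: 'a mat set) gs"
  shows "real (weight_dist (trace_code gs) j) =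
          (\<Sum>\<nu>\<in>(families j :: ('a \<Rightarrow> nat) set).
             ((inverse Q * A1 \<epsilon> n Q * (B1 \<epsilon> n Q + 1)) gchoose \<nu> 0) *
             (\<Prod>\<beta> | \<beta> \<noteq> 0 \<and> tr (inverse \<beta>) = 0.
                (inverse Q * A1 \<epsilon> n Q * (B1 \<epsilon> n Q + Q + 1)) gchoose \<nu> \<beta>) *
             (\<Prod>\<beta> | \<beta> \<noteq> 0 \<and> tr (inverse \<beta>) = 1.
                (inverse Q * A1 \<epsilon> n Q * (B1 \<epsilon> n Q - Q + 1)) gchoose \<nu> \<beta>))"
  unfolding weight_dist_trace_code[OF gs] of_nat_sum of_nat_prod
proof (rule sum.cong[OF refl])
  fix \<nu> :: "'a \<Rightarrow> nat"
  let ?N = "\<lambda>\<beta>. card {w \<in> DC 1 n. mat_trace w = (\<beta>::'a)}"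
  have U: "UNIV = {0} \<union> ({\<beta>::'a. \<beta> \<noteq> 0 \<and> tr (inverse \<beta>) = 0} \<union> {\<beta>. \<beta> \<noteq> 0 \<and> tr (inverse \<beta>) = 1})"
    using tr_cases by auto
  have "(\<Prod>\<beta>\<in>UNIV. real (?N \<beta> choose \<nu> \<beta>)) = real (?N 0 choose \<nu> 0) *
      ((\<Prod>\<beta> | \<beta> \<noteq> 0 \<and> tr (inverse \<beta>) = 0. real (?N \<beta> choose \<nu> \<beta>)) *
       (\<Prod>\<beta> | \<beta> \<noteq> 0 \<and> tr (inverse \<beta>) = 1. real (?N \<beta> choose \<nu> \<beta>)))"
    by (subst U, subst prod.union_disjoint, simp, simp, force, subst prod.union_disjoint) auto
  also have "\<dots> = ((inverse Q * A1 \<epsilon> n Q * (B1 \<epsilon> n Q + 1)) gchoose \<nu> 0) *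
             ((\<Prod>\<beta> | \<beta> \<noteq> 0 \<and> tr (inverse \<beta>) = 0.
                (inverse Q * A1 \<epsilon> n Q * (B1 \<epsilon> n Q + Q + 1)) gchoose \<nu> \<beta>) *
             (\<Prod>\<beta> | \<beta> \<noteq> 0 \<and> tr (inverse \<beta>) = 1.
                (inverse Q * A1 \<epsilon> n Q * (B1 \<epsilon> n Q - Q + 1)) gchoose \<nu> \<beta>))"
    unfolding binomial_gbinomial card_DC_1_trace[OF \<epsilon>]
    by (intro arg_cong2[where f="(*)"] prod.cong) auto
  finally show "(\<Prod>\<beta>\<in>UNIV. real (?N \<beta> choose \<nu> \<beta>)) = ((inverse Q * A1 \<epsilon> n Q * (B1 \<epsilon> n Q + 1)) gchoose \<nu> 0) *
             (\<Prod>\<beta> | \<beta> \<noteq> 0 \<and> tr (inverse \<beta>) = 0.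
                (inverse Q * A1 \<epsilon> n Q * (B1 \<epsilon> n Q + Q + 1)) gchoose \<nu> \<beta>) *
             (\<Prod>\<beta> | \<beta> \<noteq> 0 \<and> tr (inverse \<beta>) = 1.
                (inverse Q * A1 \<epsilon> n Q * (B1 \<epsilon> n Q - Q + 1)) gchoose \<nu> \<beta>)"
    by (simp only: mult.assoc)
qed

text \<open>Nonzero \<open>\<beta>\<close> are grouped by their Kloosterman sum; the bound and the
  congruence place this value in the finite index range of the outer product. A
  \<open>\<tau>\<close> that is not attained contributes an empty product.\<close>

lemma weight_dist_DC_2:
  assumes \<epsilon>: "(\<epsilon> = Plus \<and> even n \<and> 2 \<le> n) \<or> (\<epsilon> = Minus \<and> odd n \<and> 3 \<le> n)"
    and r: "2 \<le> r" and gs: "ordering_of (DC 2 n :: 'a mat set) gs"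
  shows "real (weight_dist (trace_code gs) j) =
          (\<Sum>\<nu>\<in>(families j :: ('a \<Rightarrow> nat) set).
             ((inverse Q * A2 \<epsilon> n Q * (B2 \<epsilon> n Q + Q ^ 3 - Q ^ 2 - 1)) gchoose \<nu> 0) *
             (\<Prod>\<tau> | \<bar>real_of_int \<tau>\<bar> < 2 * sqrt Q \<and> [\<tau> = - 1] (mod 4).
                \<Prod>\<beta> | \<beta> \<noteq> 0 \<and> kloosterman r (inverse \<beta>) = \<tau>.
                  (inverse Q * A2 \<epsilon> n Q * (B2 \<epsilon> n Q + Q * real_of_int \<tau> - Q ^ 2 - 1)) gchoose \<nu> \<beta>))"
  unfolding weight_dist_trace_code[OF gs] of_nat_sum of_nat_prod
proof (rule sum.cong[OF refl])
  fix \<nu> :: "'a \<Rightarrow> nat"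
  let ?N = "\<lambda>\<beta>. card {w \<in> DC 2 n. mat_trace w = (\<beta>::'a)}"
  let ?T = "{\<tau>. \<bar>real_of_int \<tau>\<bar> < 2 * sqrt Q \<and> [\<tau> = - 1] (mod 4)}"
  let ?K = "\<lambda>\<beta>::'a. kloosterman r (inverse \<beta>)"
  let ?h = "\<lambda>\<tau> \<beta>. (inverse Q * A2 \<epsilon> n Q * (B2 \<epsilon> n Q + Q * real_of_int \<tau> - Q ^ 2 - 1)) gchoose \<nu> \<beta>"
  have fin: "finite ?T"
  proof (rule finite_subset)
    show "?T \<subseteq> {- \<lceil>2 * sqrt Q\<rceil>..\<lceil>2 * sqrt Q\<rceil>}" by (auto simp: abs_less_iff) linarith+
  qed simp
  have "(\<Prod>\<beta>\<in>UNIV. real (?N \<beta> choose \<nu> \<beta>)) = real (?N 0 choose \<nu> 0) * (\<Prod>\<beta>\<in>UNIV - {0}. real (?N \<beta> choose \<nu> \<beta>))"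
    by (rule prod.remove) auto
  also have "\<dots> = ((inverse Q * A2 \<epsilon> n Q * (B2 \<epsilon> n Q + Q ^ 3 - Q ^ 2 - 1)) gchoose \<nu> 0) *
      (\<Prod>\<beta>\<in>UNIV - {0}. ?h (?K \<beta>) \<beta>)"
    unfolding binomial_gbinomial card_DC_2_trace[OF \<epsilon>]
    by (intro arg_cong2[where f="(*)"] prod.cong) auto
  also have "(\<Prod>\<beta>\<in>UNIV - {0}. ?h (?K \<beta>) \<beta>) = (\<Prod>\<tau>\<in>?T. \<Prod>\<beta>\<in>{\<beta> \<in> UNIV - {0}. ?K \<beta> = \<tau>}. ?h (?K \<beta>) \<beta>)"
  proof (rule prod.group[symmetric])
    show "?K ` (UNIV - {0}) \<subseteq> ?T"
      using kloosterman_bound[OF _ r] kloosterman_mod_4[OF _ r] by (auto simp: Q_def)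
  qed (use fin in auto)
  also have "\<dots> = (\<Prod>\<tau>\<in>?T. \<Prod>\<beta> | \<beta> \<noteq> 0 \<and> ?K \<beta> = \<tau>. ?h \<tau> \<beta>)"
    by (intro prod.cong) auto
  finally show "(\<Prod>\<beta>\<in>UNIV. real (?N \<beta> choose \<nu> \<beta>)) =
      ((inverse Q * A2 \<epsilon> n Q * (B2 \<epsilon> n Q + Q ^ 3 - Q ^ 2 - 1)) gchoose \<nu> 0) *
      (\<Prod>\<tau>\<in>?T. \<Prod>\<beta> | \<beta> \<noteq> 0 \<and> ?K \<beta> = \<tau>. ?h \<tau> \<beta>)" .
qed

end

theorem theorem19:
  fixes \<epsilon> :: pm and n r :: nat and q :: real
  assumes card: "card (UNIV :: 'a::{finite,field} set) = 2 ^ r"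
    and q: "q = 2 ^ r"
  shows
    "((\<epsilon> = Plus \<and> even n \<and> 2 \<le> n) \<or> (\<epsilon> = Minus \<and> odd n \<and> 1 \<le> n) \<longrightarrow>
       (\<forall>gs :: 'a mat list. \<forall>j :: nat. ordering_of (DC 1 n) gs \<and> real j \<le> N1 \<epsilon> n q \<longrightarrow>
          real (weight_dist (trace_code gs) j) =
          (\<Sum>\<nu>\<in>(families j :: ('a \<Rightarrow> nat) set).
             ((inverse q * A1 \<epsilon> n q * (B1 \<epsilon> n q + 1)) gchoose \<nu> 0) *
             (\<Prod>\<beta> | \<beta> \<noteq> 0 \<and> field_tr r (inverse \<beta>) = 0.
                (inverse q * A1 \<epsilon> n q * (B1 \<epsilon> n q + q + 1)) gchoose \<nu> \<beta>) *
             (\<Prod>\<beta> | \<beta> \<noteq> 0 \<and> field_tr r (inverse \<beta>) = 1.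
                (inverse q * A1 \<epsilon> n q * (B1 \<epsilon> n q - q + 1)) gchoose \<nu> \<beta>))))
     \<and>
     ((\<epsilon> = Plus \<and> even n \<and> 2 \<le> n) \<or> (\<epsilon> = Minus \<and> odd n \<and> 3 \<le> n) \<longrightarrow> 4 \<le> q \<longrightarrow>
       (\<forall>gs :: 'a mat list. \<forall>j :: nat. ordering_of (DC 2 n) gs \<and> real j \<le> N2 \<epsilon> n q \<longrightarrow>
          real (weight_dist (trace_code gs) j) =
          (\<Sum>\<nu>\<in>(families j :: ('a \<Rightarrow> nat) set).
             ((inverse q * A2 \<epsilon> n q * (B2 \<epsilon> n q + q ^ 3 - q ^ 2 - 1)) gchoose \<nu> 0) *
             (\<Prod>\<tau> | \<bar>real_of_int \<tau>\<bar> < 2 * sqrt q \<and> [\<tau> = - 1] (mod 4).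
                \<Prod>\<beta> | \<beta> \<noteq> 0 \<and> kloosterman r (inverse \<beta>) = \<tau>.
                  (inverse q * A2 \<epsilon> n q * (B2 \<epsilon> n q + q * real_of_int \<tau> - q ^ 2 - 1)) gchoose \<nu> \<beta>))))"
proof -
  interpret binary_field r "TYPE('a)" by standard (rule card)
  have Q: "q = Q" by (simp add: q Q_def)
  have r: "2 \<le> r" if "4 \<le> q"
  proof (rule ccontr)
    assume "\<not> 2 \<le> r"
    then have "r = 0 \<or> r = 1" by linarith
    then show False using that q by auto
  qed
  show ?thesis
    unfolding Q
    by (intro conjI impI allI; elim conjE; rule weight_dist_DC_1 weight_dist_DC_2;
      (assumption | erule r[unfolded Q]))
qed

end
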